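(* Let $T>0$, let $V,H$ be separable Hilbert spaces over $\mathbb{K}\in\{\mathbb{R},\mathbb{C}\}$ with $V$ continuously and densely embedded in $H$. Let $\mathfrak a=\mathfrak a_1+\mathfrak a_2$ and $\mathfrak b=\mathfrak b_1+\mathfrak b_2$ be non-autonomous $V$-bounded and quasi-coercive sesquilinear forms $[0,T]\times V\times V\to\mathbb{K}$, where there are constants $M,\dot M\ge0$, $\alpha>0$ and points $0=\tau_0<\tau_1<\dots<\tau_n=T$ such that for $\mathfrak c_1\in\{\mathfrak a_1,\mathfrak b_1\}$ and $\mathfrak c_2\in\{\mathfrak a_2,\mathfrak b_2\}$: a) $|\mathfrak c_1(t,u,v)|\le M\|u\|_V\|v\|_V$ for all $u,v\in V$, $t\in[0,T]$; b) $\mathfrak c_1(t,u,u)\ge\alpha\|u\|_V^2$ for all $u\in V$, $t\in[0,T]$; c) $\mathfrak c_1(t,u,v)=\overline{\mathfrak c_1(t,v,u)}$ for all $u,v\in V$, $t\in[0,T]$; d) $|\mathfrak c_1(t,u,v)-\mathfrak c_1(s,u,v)|\le\dot M|t-s|\,\|u\|_V\|v\|_V$ for all $u,v\in V$, $s,t\in[\tau_{i-1},\tau_i]$, $i\in\{1,\dots,n\}$; e) $\mathfrak c_2(\cdot,u,v)$ is measurable and $|\mathfrak c_2(t,u,v)|\le M\|u\|_V\|v\|_H$ for all $u,v\in V$, $t\in[0,T]$. Let $\mathcal A(t),\mathcal B(t)$ be the operators associated with $\mathfrak a(t,\cdot,\cdot)$, $\mathfrak b(t,\cdot,\cdot)$.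 Then for every $u_0,u_1\in V$ and $f\in L^2(0,T;H)$ there exists a unique $u\in MR(V,V,H)$ such that $$\ddot u(t)+\mathcal B(t)\dot u(t)+\mathcal A(t)u(t)=f(t)\ \text{ for a.e. } t\in(0,T),\qquad u(0)=u_0,\quad\dot u(0)=u_1.$$ Moreover, $\dot u(t)\in V$ for all $t\in[0,T]$.
   Context: $V'$ is the antidual (dual if $\mathbb{K}=\mathbb{R}$) of $V$, with duality $\langle\cdot,\cdot\rangle$, and $H$ is identified with a dense subspace of $V'$ via $\langle u,v\rangle=(u\mid v)_H$ for $u\in H$, $v\in V$. A family of sesquilinear forms $\mathfrak a\colon[0,T]\times V\times V\to\mathbb{K}$ is a $V$-bounded non-autonomous sesquilinear form if $\mathfrak a(\cdot,u,v)$ is measurable for all $u,v\in V$ and $|\mathfrak a(t,u,v)|\le M'\|u\|_V\|v\|_V$ for some constant $M'$ and all $t,u,v$. It is quasi-coercive if there are $\alpha'>0$, $\omega\in\mathbb{R}$ with $\mathrm{Re}\,\mathfrak a(t,u,u)+\omega\|u\|_H^2\ge\alpha'\|u\|_V^2$ for all $t\in[0,T]$, $u\in V$. The associated operators $\mathcal A(t),\mathcal B(t)\in\mathcal L(V,V')$ are given by $\langle\mathcal A(t)u,v\rangle=\mathfrak a(t,u,v)$ and $\langle\mathcal B(t)u,v\rangle=\mathfrak b(t,u,v)$ for $u,v\in V$. $MR(V,V,H):=H^1(0,T;V)\cap H^2(0,T;H)$. Here $u\in C([0,T];V)$ and $\dot u\in C([0,T];H)$ denote the continuous representatives, so pointwise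 values $u(t)$, $\dot u(t)$ make sense. *)

theory Defs
  imports "HOL-Analysis.Analysis"
begin

text \<open>
  The scalar field \<open>\<bbbK> \<in> {\<real>, \<complex>}\<close>.  By the Gelfand--Mazur theorem a \<open>real_normed_field\<close> is
  isometrically isomorphic to \<open>\<real>\<close> or \<open>\<complex>\<close>, and the axioms below force \<open>kconj\<close> and \<open>kre\<close> to be
  conjugation and real part there, so this class describes exactly the two intended fields.
\<close>

class real_or_complex_field = real_normed_field +
  fixes kconj :: "'a \<Rightarrow> 'a" and kre :: "'a \<Rightarrow> real"
  assumes kconj_add: "kconj (x + y) = kconj x + kconj y"
    and kconj_mult: "kconj (x * y) = kconj x * kconj y"
    and kconj_scaleR_one: "kconj (r *\<^sub>R 1) = r *\<^sub>R 1"
    and mult_kconj: "x * kconj x = (norm x)\<^sup>2 *\<^sub>R 1"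
    and add_kconj: "x + kconj x = (2 * kre x) *\<^sub>R 1"

instantiation real :: real_or_complex_field
begin
definition kconj_real :: "real \<Rightarrow> real" where "kconj_real x = x"
definition kre_real :: "real \<Rightarrow> real" where "kre_real x = x"
instance
  by standard (simp_all add: kconj_real_def kre_real_def power2_eq_square)
end

instantiation complex :: real_or_complex_field
begin
definition kconj_complex :: "complex \<Rightarrow> complex" where "kconj_complex x = cnj x"
definition kre_complex :: "complex \<Rightarrow> real" where "kre_complex x = Re x"
instance
proof
  show "x * kconj x = (norm x)\<^sup>2 *\<^sub>R 1" for x :: complex
    by (simp only: kconj_complex_def scaleR_conv_of_real complex_norm_square mult_1_right)
qed (simp_all add: kconj_complex_def kre_complex_def complex_eq_iff)
end

text \<open>
  A separable Hilbert space over \<open>\<bbbK>\<close>: the type carries the complete, second countable norm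
  topology (and the underlying real vector space), \<open>sc\<close> is multiplication by scalars of \<open>\<bbbK>\<close>, and
  \<open>ip\<close> is the inner product, linear in the first argument, that induces the norm.
\<close>

locale separable_hilbert = vector_space sc
  for sc :: "'k::real_or_complex_field \<Rightarrow> 'x::{banach, second_countable_topology} \<Rightarrow> 'x"
    and ip :: "'x \<Rightarrow> 'x \<Rightarrow> 'k" +
  assumes sc_of_real: "sc (of_real r) x = r *\<^sub>R x"
    and ip_add_left: "ip (x + y) z = ip x z + ip y z"
    and ip_scale_left: "ip (sc c x) z = c * ip x z"
    and ip_commute: "ip x y = kconj (ip y x)"
    and ip_self: "ip x x = of_real ((norm x)\<^sup>2)"

lemma separable_hilbert_real:
  "separable_hilbert scaleR
     (inner :: 'x::{real_inner, banach, second_countable_topology} \<Rightarrow> 'x \<Rightarrow> real)"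
proof unfold_locales
  show "inner x y = kconj (inner y x)" for x y :: 'x
    by (simp add: kconj_real_def inner_commute)
qed (simp_all add: scaleR_add_right scaleR_add_left inner_add_left power2_norm_eq_inner)

lemma separable_hilbert_complex:
  "separable_hilbert (*) (\<lambda>x y. x * cnj y :: complex)"
proof unfold_locales
  show "x * cnj x = of_real ((norm x)\<^sup>2)" for x :: complex
    by (rule complex_norm_square[symmetric])
qed (simp_all add: kconj_complex_def scaleR_conv_of_real ring_distribs)

text \<open>The embedding of \<open>V\<close> into \<open>H\<close> is an explicit map \<open>j\<close>, so \<open>\<parallel>v\<parallel>\<^sub>H\<close> is \<open>norm (j v)\<close>.\<close>

locale dense_hilbert_embedding =
  V: separable_hilbert scV ipV + H: separable_hilbert scH ipH
  for scV :: "'k::real_or_complex_field \<Rightarrow> 'v::{banach, second_countable_topology} \<Rightarrow> 'v"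
    and ipV :: "'v \<Rightarrow> 'v \<Rightarrow> 'k"
    and scH :: "'k \<Rightarrow> 'h::{banach, second_countable_topology} \<Rightarrow> 'h"
    and ipH :: "'h \<Rightarrow> 'h \<Rightarrow> 'k" +
  fixes j :: "'v \<Rightarrow> 'h"
  assumes j_linear: "Vector_Spaces.linear scV scH j"
    and j_inj: "inj j"
    and j_bounded: "\<exists>C. \<forall>v. norm (j v) \<le> C * norm v"
    and j_dense: "closure (range j) = UNIV"

definition sesquilinear ::
  "('k::real_or_complex_field \<Rightarrow> 'v::real_normed_vector \<Rightarrow> 'v) \<Rightarrow> ('v \<Rightarrow> 'v \<Rightarrow> 'k) \<Rightarrow> bool" where
  "sesquilinear sc c \<longleftrightarrow>
     (\<forall>u u' v. c (u + u') v = c u v + c u' v) \<and>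
     (\<forall>k u v. c (sc k u) v = k * c u v) \<and>
     (\<forall>u v v'. c u (v + v') = c u v + c u v') \<and>
     (\<forall>k u v. c u (sc k v) = kconj k * c u v)"

definition nonaut_form ::
  "('k::real_or_complex_field \<Rightarrow> 'v::real_normed_vector \<Rightarrow> 'v) \<Rightarrow> real
    \<Rightarrow> (real \<Rightarrow> 'v \<Rightarrow> 'v \<Rightarrow> 'k) \<Rightarrow> bool" where
  "nonaut_form sc T c \<longleftrightarrow> (\<forall>t\<in>{0..T}. sesquilinear sc (c t))"

text \<open>Measurability is Lebesgue measurability, which is implied by Borel measurability.\<close>

definition V_bounded_form ::
  "('k::real_or_complex_field \<Rightarrow> 'v::real_normed_vector \<Rightarrow> 'v) \<Rightarrow> real
    \<Rightarrow> (real \<Rightarrow> 'v \<Rightarrow> 'v \<Rightarrow> 'k) \<Rightarrow> bool" where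
  "V_bounded_form sc T c \<longleftrightarrow>
     nonaut_form sc T c \<and>
     (\<forall>u v. (\<lambda>t. c t u v) \<in> borel_measurable (lebesgue_on {0..T})) \<and>
     (\<exists>M'. \<forall>t\<in>{0..T}. \<forall>u v. norm (c t u v) \<le> M' * norm u * norm v)"

definition quasi_coercive_form ::
  "('v::real_normed_vector \<Rightarrow> 'h::real_normed_vector) \<Rightarrow> real
    \<Rightarrow> (real \<Rightarrow> 'v \<Rightarrow> 'v \<Rightarrow> 'k::real_or_complex_field) \<Rightarrow> bool" where
  "quasi_coercive_form j T c \<longleftrightarrow>
     (\<exists>\<alpha>'>0. \<exists>\<omega>. \<forall>t\<in>{0..T}. \<forall>u.
        kre (c t u u) + \<omega> * (norm (j u))\<^sup>2 \<ge> \<alpha>' * (norm u)\<^sup>2)"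

text \<open>
  The antidual \<open>V'\<close> is the subspace of antilinear maps in the space of bounded real-linear maps
  \<open>V \<rightarrow> \<bbbK>\<close>; identities in \<open>V'\<close> are stated in the latter space.
\<close>

definition antidual ::
  "('k::real_or_complex_field \<Rightarrow> 'v::real_normed_vector \<Rightarrow> 'v) \<Rightarrow> ('v \<Rightarrow>\<^sub>L 'k) set" where
  "antidual sc = {\<phi>. \<forall>k v. blinfun_apply \<phi> (sc k v) = kconj k * blinfun_apply \<phi> v}"

definition assoc_op ::
  "('v::real_normed_vector \<Rightarrow> 'v \<Rightarrow> 'k::real_or_complex_field) \<Rightarrow> 'v \<Rightarrow>\<^sub>L ('v \<Rightarrow>\<^sub>L 'k)" where
  "assoc_op c = Blinfun (\<lambda>u. Blinfun (\<lambda>v. c u v))"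

definition embed_antidual ::
  "('h \<Rightarrow> 'h \<Rightarrow> 'k::real_or_complex_field) \<Rightarrow> ('v::real_normed_vector \<Rightarrow> 'h) \<Rightarrow> 'h \<Rightarrow> 'v \<Rightarrow>\<^sub>L 'k" where
  "embed_antidual ip j h = Blinfun (\<lambda>v. ip h (j v))"

text \<open>
  Smooth test functions with compact support in \<open>(0,T)\<close>; a closed set contained in \<open>(0,T)\<close> is
  automatically compact.
\<close>

definition test_function :: "real \<Rightarrow> (real \<Rightarrow> real) \<Rightarrow> bool" where
  "test_function T \<phi> \<longleftrightarrow>
     (\<forall>k x. (deriv ^^ k) \<phi> field_differentiable at x) \<and>
     closure {t. \<phi> t \<noteq> 0} \<subseteq> {0<..<T}"

text \<open>Elements of the \<open>L\<^sup>2\<close> and Sobolev spaces are represented by functions modulo null sets.\<close>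

definition L2 :: "real \<Rightarrow> (real \<Rightarrow> 'x::{banach, second_countable_topology}) set" where
  "L2 T = {f \<in> borel_measurable (lebesgue_on {0<..<T}).
            integrable (lebesgue_on {0<..<T}) (\<lambda>t. (norm (f t))\<^sup>2)}"

definition weak_derivative ::
  "real \<Rightarrow> (real \<Rightarrow> 'x::{banach, second_countable_topology}) \<Rightarrow> (real \<Rightarrow> 'x) \<Rightarrow> bool" where
  "weak_derivative T u g \<longleftrightarrow>
     (\<forall>\<phi>. test_function T \<phi> \<longrightarrow>
        integral\<^sup>L (lebesgue_on {0<..<T}) (\<lambda>t. deriv \<phi> t *\<^sub>R u t) =
        - integral\<^sup>L (lebesgue_on {0<..<T}) (\<lambda>t. \<phi> t *\<^sub>R g t))"

definition H1 :: "real \<Rightarrow> (real \<Rightarrow> 'x::{banach, second_countable_topology}) set" where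
  "H1 T = {u \<in> L2 T. \<exists>g\<in>L2 T. weak_derivative T u g}"

definition H2 :: "real \<Rightarrow> (real \<Rightarrow> 'x::{banach, second_countable_topology}) set" where
  "H2 T = {u \<in> L2 T. \<exists>g\<in>H1 T. weak_derivative T u g}"

definition MR :: "('v::{banach, second_countable_topology} \<Rightarrow> 'h::{banach, second_countable_topology})
    \<Rightarrow> real \<Rightarrow> (real \<Rightarrow> 'v) set" where
  "MR j T = {u \<in> H1 T. (\<lambda>t. j (u t)) \<in> H2 T}"

text \<open>
  Here \<open>u\<close> is the continuous \<open>V\<close>-valued representative of an element of \<open>MR(V,V,H)\<close> and \<open>du\<close> the
  continuous \<open>H\<close>-valued representative of its derivative; \<open>v\<close> is the \<open>V\<close>-valued weak derivative
  (which coincides with \<open>du\<close> almost everywhere) and \<open>w\<close> the \<open>H\<close>-valued second derivative.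
\<close>

definition solves_cauchy ::
  "('h \<Rightarrow> 'h \<Rightarrow> 'k::real_or_complex_field)
    \<Rightarrow> ('v::{banach, second_countable_topology} \<Rightarrow> 'h::{banach, second_countable_topology}) \<Rightarrow> real
    \<Rightarrow> (real \<Rightarrow> 'v \<Rightarrow>\<^sub>L ('v \<Rightarrow>\<^sub>L 'k)) \<Rightarrow> (real \<Rightarrow> 'v \<Rightarrow>\<^sub>L ('v \<Rightarrow>\<^sub>L 'k)) \<Rightarrow> (real \<Rightarrow> 'h) \<Rightarrow> 'v \<Rightarrow> 'v
    \<Rightarrow> (real \<Rightarrow> 'v) \<Rightarrow> (real \<Rightarrow> 'h) \<Rightarrow> bool" where
  "solves_cauchy ip j T A B f u0 u1 u du \<longleftrightarrow>
     u \<in> MR j T \<and> continuous_on {0..T} u \<and>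
     continuous_on {0..T} du \<and> weak_derivative T (\<lambda>t. j (u t)) du \<and>
     (\<exists>v\<in>L2 T. \<exists>w\<in>L2 T. weak_derivative T u v \<and> weak_derivative T du w \<and>
        (AE t in lebesgue_on {0<..<T}.
           embed_antidual ip j (w t) + blinfun_apply (B t) (v t) + blinfun_apply (A t) (u t)
             = embed_antidual ip j (f t))) \<and>
     u 0 = u0 \<and> du 0 = j u1"

lemma kconj_of_real [simp]: "kconj (of_real r :: 'k::real_or_complex_field) = of_real r"
  by (simp add: of_real_def kconj_scaleR_one)

lemma kconj_0 [simp]: "kconj (0::'k::real_or_complex_field) = 0"
  using kconj_of_real[of 0] by simp

lemma norm_kconj [simp]: "norm (kconj (x::'k::real_or_complex_field)) = norm x"
proof (cases "x = 0")
  case False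
  have "norm x * norm (kconj x) = norm x * norm x"
    using arg_cong[OF mult_kconj[of x], of norm] by (simp add: norm_mult power2_eq_square)
  with False show ?thesis by simp
qed simp

context separable_hilbert
begin

lemma bounded_linear_assoc:
  assumes "sesquilinear sc c" "\<And>u v. norm (c u v) \<le> M * norm u * norm v"
  shows "bounded_linear (c u)"
proof (rule bounded_linear_intro)
  show "c u (x + y) = c u x + c u y" for x y
    using assms(1) by (auto simp: sesquilinear_def)
  show "c u (r *\<^sub>R x) = r *\<^sub>R c u x" for r x
  proof -
    have "c u (sc (of_real r) x) = kconj (of_real r) * c u x"
      using assms(1) by (simp add: sesquilinear_def del: kconj_of_real)
    then show ?thesis by (simp add: sc_of_real scaleR_conv_of_real)
  qed
  show "norm (c u x) \<le> norm x * (M * norm u)" for x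
    using assms(2)[of u x] by (simp add: mult_ac)
qed

text \<open>For a bounded sesquilinear form, \<open>assoc_op\<close> is the associated operator in \<open>\<L>(V,V')\<close>.\<close>

lemma assoc_op_apply:
  assumes s: "sesquilinear sc c" and M: "\<And>u v. norm (c u v) \<le> M * norm u * norm v"
  shows "blinfun_apply (blinfun_apply (assoc_op c) u) v = c u v"
    and "blinfun_apply (assoc_op c) u \<in> antidual sc"
proof -
  have bl: "blinfun_apply (Blinfun (c u)) = c u" for u
    by (rule bounded_linear_Blinfun_apply[OF bounded_linear_assoc[OF s M]])
  have "bounded_linear (\<lambda>u. Blinfun (c u))"
  proof (rule bounded_linear_intro)
    show "Blinfun (c (x + y)) = Blinfun (c x) + Blinfun (c y)" for x y
      using s by (intro blinfun_eqI) (auto simp: bl blinfun.add_left sesquilinear_def)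
    show "Blinfun (c (r *\<^sub>R x)) = r *\<^sub>R Blinfun (c x)" for r x
    proof (rule blinfun_eqI)
      fix v
      have "c (sc (of_real r) x) v = of_real r * c x v"
        using s by (simp add: sesquilinear_def)
      then have "c (r *\<^sub>R x) v = r *\<^sub>R c x v"
        by (simp add: sc_of_real scaleR_conv_of_real)
      then show "blinfun_apply (Blinfun (c (r *\<^sub>R x))) v = blinfun_apply (r *\<^sub>R Blinfun (c x)) v"
        by (simp add: bl blinfun.scaleR_left)
    qed
    show "norm (Blinfun (c x)) \<le> norm x * \<bar>M\<bar>" for x
    proof (rule norm_blinfun_bound)
      fix v
      have "norm (c x v) \<le> M * norm x * norm v" by (rule M)
      also have "\<dots> \<le> norm x * \<bar>M\<bar> * norm v"
        by (simp add: mult.commute mult_left_mono mult_right_mono)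
      finally show "norm (blinfun_apply (Blinfun (c x)) v) \<le> norm x * \<bar>M\<bar> * norm v"
        by (simp add: bl)
    qed simp
  qed
  then have *: "blinfun_apply (assoc_op c) u = Blinfun (c u)" for u
    unfolding assoc_op_def by (simp add: bounded_linear_Blinfun_apply)
  show "blinfun_apply (blinfun_apply (assoc_op c) u) v = c u v"
    by (simp add: * bl)
  show "blinfun_apply (assoc_op c) u \<in> antidual sc"
    using s by (auto simp: antidual_def * bl sesquilinear_def)
qed

lemma ip_add_right: "ip z (x + y) = ip z x + ip z y"
  by (metis ip_commute ip_add_left kconj_add)

lemma ip_scale_right: "ip z (sc c x) = kconj c * ip z x"
  by (metis ip_commute ip_scale_left kconj_mult)

lemma norm_ip_le: "norm (ip x y) \<le> norm x * norm y"
proof (cases "y = 0")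
  case True
  have "ip x 0 = 0" using ip_add_right[of x 0 0] by simp
  with True show ?thesis by simp
next
  case False
  define N :: 'k where "N = of_real ((norm y)\<^sup>2)"
  define c where "c = ip x y / N"
  have N: "N \<noteq> 0" "ip y y = N" "kconj N = N"
    using False ip_self[of y] by (auto simp: N_def simp del: of_real_power)
  define z where "z = x + sc (- c) y"
  have "ip z y = ip x y + (- c) * ip y y"
    by (simp only: z_def ip_add_left ip_scale_left)
  then have zy: "ip z y = 0"
    using N by (simp add: c_def)
  have "ip z z = ip z x + kconj (- c) * ip z y"
    by (subst (2) z_def) (simp only: ip_add_right ip_scale_right)
  then have "ip z z = ip x x + (- c) * ip y x"
    by (simp only: zy mult_zero_right add_0_right) (simp only: z_def ip_add_left ip_scale_left)
  also have "ip y x = kconj (ip x y)"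
    by (rule ip_commute)
  finally have "ip z z = ip x x - (ip x y * kconj (ip x y)) / N"
    by (simp add: c_def)
  then have "(of_real ((norm z)\<^sup>2) :: 'k) =
      of_real ((norm x)\<^sup>2) - of_real ((norm (ip x y))\<^sup>2) / of_real ((norm y)\<^sup>2)"
    unfolding ip_self mult_kconj N_def of_real_def by this
  then have "(of_real ((norm z)\<^sup>2) :: 'k) =
      of_real ((norm x)\<^sup>2 - (norm (ip x y))\<^sup>2 / (norm y)\<^sup>2)"
    by (simp only: of_real_diff of_real_divide)
  then have "(norm z)\<^sup>2 = (norm x)\<^sup>2 - (norm (ip x y))\<^sup>2 / (norm y)\<^sup>2"
    by (simp only: of_real_eq_iff)
  then have "(norm (ip x y))\<^sup>2 / (norm y)\<^sup>2 \<le> (norm x)\<^sup>2"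
    using zero_le_power2[of "norm z"] by linarith
  then have "(norm (ip x y))\<^sup>2 \<le> (norm x * norm y)\<^sup>2"
    using False by (simp add: field_simps)
  then show ?thesis by (rule power2_le_imp_le) simp
qed

end

context dense_hilbert_embedding
begin

lemma embed_antidual_apply:
  shows "blinfun_apply (embed_antidual ipH j h) v = ipH h (j v)"
    and "embed_antidual ipH j h \<in> antidual scV"
proof -
  obtain C where C: "norm (j v) \<le> C * norm v" for v
    using j_bounded by blast
  have add: "j (x + y) = j x + j y" and scale: "j (scV k x) = scH k (j x)" for x y k
    using j_linear by (auto simp: Vector_Spaces.linear_iff)
  have "bounded_linear (\<lambda>v. ipH h (j v))"
  proof (rule bounded_linear_intro)
    show "ipH h (j (x + y)) = ipH h (j x) + ipH h (j y)" for x y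
      by (simp add: add H.ip_add_right)
    show "ipH h (j (r *\<^sub>R x)) = r *\<^sub>R ipH h (j x)" for r x
      using scale[of "of_real r" x] H.ip_scale_right[of h "of_real r" "j x"]
      by (simp add: V.sc_of_real scaleR_conv_of_real)
    show "norm (ipH h (j x)) \<le> norm x * (norm h * C)" for x
    proof -
      have "norm (ipH h (j x)) \<le> norm h * norm (j x)" by (rule H.norm_ip_le)
      also have "\<dots> \<le> norm h * (C * norm x)" by (rule mult_left_mono[OF C]) simp
      finally show ?thesis by (simp add: mult_ac)
    qed
  qed
  then show *: "blinfun_apply (embed_antidual ipH j h) v = ipH h (j v)" for v
    unfolding embed_antidual_def by (simp add: bounded_linear_Blinfun_apply)
  show "embed_antidual ipH j h \<in> antidual scV"
    by (simp add: antidual_def * scale H.ip_scale_right)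
qed

end

end

theory Submission
  imports Defs
begin

text \<open>
  Taking real parts turns all forms into real bilinear ones, and since consecutive intervals of the
  partition share an endpoint, the forms \<open>a1\<close> and \<open>b1\<close> are Lipschitz in time on all of \<open>[0,T]\<close>.

  Existence uses a variational formulation in space and time.  For the acceleration \<open>\<psi>\<close>, with
  \<open>\<phi> = \<integral>\<psi>\<close> and \<open>u = \<integral>\<phi>\<close>, consider
  \<open>E(\<psi>,\<zeta>) = \<integral> e\<^sup>-\<^sup>\<rho>\<^sup>t ((\<psi>,\<zeta>)\<^sub>H + b(t,\<phi>,\<zeta>) + a(t,u,\<zeta>)) dt\<close>.  Testing with \<open>\<zeta> = \<psi>\<close> and integrating the Lipschitz
  parts by parts in time, which is where the symmetry of \<open>b1\<close> enters, shows for large \<open>\<rho>\<close> that \<open>E(\<psi>,\<psi>)\<close>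
  controls \<open>\<psi>\<close> in \<open>L\<^sup>2(H)\<close>, \<open>\<phi>\<close> in \<open>L\<^sup>2(V)\<close> and the end value of \<open>\<phi>\<close> in \<open>V\<close>.  Among
  the Galerkin approximations of increasing order those of nearly minimal norm converge strongly by
  the parallelogram law, so no weak compactness is needed.  Uniqueness follows from testing with the
  velocity and the same exponential weight.  The control of the end value, applied on \<open>[0,t]\<close> for each
  \<open>t\<close> and combined with uniqueness, gives that the velocity lies in \<open>V\<close> at every time.
\<close>

section \<open>Square-integrable functions\<close>

text \<open>The acceleration is used as a test because the velocity has to be bounded in V at the
  end time; a given solution, however, has its acceleration only in H, so uniqueness has to use the
  velocity instead. The price is that \<psi> enters the V-slots of \<open>b1\<close> and
  \<open>a1\<close>, while the energy bounds it only in H. For \<open>b1\<close> the pairing is half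
  a time derivative up to Lipschitz errors, and differentiating the weight yields \<rho> times a
  coercive term that pays for the rest. For \<open>a1\<close> the time derivative is moved off
  \<psi>, which creates a term of size \<rho> M; it is harmless because u gains a factor 1/\<rho>
  over \<phi>. The parts \<open>a2\<close>, \<open>b2\<close> see only the H-norm of \<psi>.

  In the limit \<psi> is lost in V: what survives are the limits of j \<psi> in L^2(H), of \<phi> in
  L^2(V) and of \<phi>(S) in V. The third is kept separately because a class in L^2(V) says nothing
  about a single time. The equation is recovered by testing with e^(\<rho> t) times the indicator of
  (0,r) times a vector, which cancels the weight and is admissible since tests need no smoothness in
  time.\<close>

abbreviation Leb :: "real \<Rightarrow> real measure" where
  "Leb S \<equiv> lebesgue_on {0<..<S}"

section \<open>Lebesgue measure on (0,S) and on its initial intervals\<close>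

lemma finite_measure_Leb [simp]: "finite_measure (Leb S)"
  using finite_measure_lebesgue_on[OF lmeasurable_box[of 0 S]] by (simp only: box_real)

lemma integrable_Leb_const [simp]: "integrable (Leb S) (\<lambda>t. c :: 'x::{banach, second_countable_topology})"
  by (rule finite_measure.integrable_const[OF finite_measure_Leb])

lemma space_Leb [simp]: "space (Leb S) = {0<..<S}"
  by simp

lemma borel_measurable_Leb : "f \<in> borel_measurable borel \<Longrightarrow> f \<in> borel_measurable (Leb S)"
  by (intro measurable_restrict_space1 measurable_completion) simp

lemma measurable_id_Leb: "(\<lambda>t. t) \<in> borel_measurable (Leb S)"
  by (rule borel_measurable_Leb) simp

lemma lessThan_Leb_sets: "{..<t} \<inter> space (Leb S) \<in> sets (Leb S)"
  by (auto simp: sets_restrict_space)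

lemma restrict_Leb: "t \<le> S \<Longrightarrow> restrict_space (Leb S) {..<t} = Leb t"
  by (subst restrict_restrict_space) (auto intro!: arg_cong2[where f=restrict_space])

text \<open>Initial intervals are handled by indicators over the fixed measure \<open>Leb S\<close>;
  in this form a variable upper limit \<open>t\<close> is accessible to dominated convergence and to
  Fubini's theorem.\<close>

lemma
  fixes f :: "real \<Rightarrow> 'x::{banach, second_countable_topology}"
  assumes "t \<le> S"
  shows integral_Leb_sub: "integral\<^sup>L (Leb t) f = integral\<^sup>L (Leb S) (\<lambda>s. indicator {..<t} s *\<^sub>R f s)"
    and integrable_Leb_sub_iff: "integrable (Leb t) f \<longleftrightarrow> integrable (Leb S) (\<lambda>s. indicator {..<t} s *\<^sub>R f s)"
proof -
  note A = lessThan_Leb_sets[of t S]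
  show "integral\<^sup>L (Leb t) f = integral\<^sup>L (Leb S) (\<lambda>s. indicator {..<t} s *\<^sub>R f s)"
    unfolding restrict_Leb[OF assms, symmetric] by (rule integral_restrict_space[OF A])
  show "integrable (Leb t) f \<longleftrightarrow> integrable (Leb S) (\<lambda>s. indicator {..<t} s *\<^sub>R f s)"
    unfolding restrict_Leb[OF assms, symmetric] by (rule integrable_restrict_space[OF A])
qed

lemma borel_measurable_Leb_mono:
  "f \<in> borel_measurable (Leb S) \<Longrightarrow> t \<le> S \<Longrightarrow> f \<in> borel_measurable (Leb t)"
  by (subst restrict_Leb[symmetric]) (assumption | rule measurable_restrict_space1)+

lemma integrable_indicator_Leb:
  fixes f :: "real \<Rightarrow> 'x::{banach, second_countable_topology}"
  assumes "integrable (Leb S) f" "A \<in> sets borel"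
  shows "integrable (Leb S) (\<lambda>s. indicator A s *\<^sub>R f s)"
proof -
  have [measurable]: "f \<in> borel_measurable (Leb S)" using assms by auto
  have [measurable]: "(indicator A :: real \<Rightarrow> real) \<in> borel_measurable (Leb S)"
    using assms(2) by (intro borel_measurable_Leb) simp
  show ?thesis
    by (rule Bochner_Integration.integrable_bound[OF assms(1)]) (measurable, auto split: split_indicator)
qed

lemma integrable_Leb_mono:
  fixes f :: "real \<Rightarrow> 'x::{banach, second_countable_topology}"
  shows "integrable (Leb S) f \<Longrightarrow> t \<le> S \<Longrightarrow> integrable (Leb t) f"
  by (simp add: integrable_Leb_sub_iff integrable_indicator_Leb)

lemma AE_Leb_mono:
  assumes "AE s in Leb S. P s" "t \<le> S"
  shows "AE s in Leb t. P s"
proof -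
  have "AE s in Leb t. s \<in> {..<t} \<longrightarrow> P s"
    unfolding restrict_Leb[OF assms(2), symmetric] using assms(1)
    by (subst AE_restrict_space_iff[OF lessThan_Leb_sets]) auto
  then show ?thesis using AE_space by eventually_elim auto
qed

lemma integrable_norm_le:
  fixes f :: "'a \<Rightarrow> 'x::{banach, second_countable_topology}" and g :: "'a \<Rightarrow> real"
  assumes "integrable M g" "f \<in> borel_measurable M" "\<And>t. t \<in> space M \<Longrightarrow> norm (f t) \<le> g t"
  shows "integrable M f"
proof (rule Bochner_Integration.integrable_bound[OF assms(1,2)], rule AE_I2)
  show "norm (f t) \<le> norm (g t)" if "t \<in> space M" for t
    using assms(3)[OF that] abs_ge_self[of "g t"] unfolding real_norm_def by linarith
qed

section \<open>Closure properties and completeness of L^2(0,S;X)\<close>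

lemma
  assumes "f \<in> L2 S"
  shows L2_measurable: "f \<in> borel_measurable (Leb S)"
    and L2_sq: "integrable (Leb S) (\<lambda>t. (norm (f t))\<^sup>2)"
  using assms by (auto simp: L2_def)

lemma L2_dominated:
  assumes "g \<in> L2 S" "f \<in> borel_measurable (Leb S)" "\<And>t. t \<in> {0<..<S} \<Longrightarrow> norm (f t) \<le> C * norm (g t)"
  shows "f \<in> L2 S"
proof -
  note [measurable] = assms(2)
  have "integrable (Leb S) (\<lambda>t. C\<^sup>2 * (norm (g t))\<^sup>2)"
    using L2_sq[OF assms(1)] by simp
  then have "integrable (Leb S) (\<lambda>t. (norm (f t))\<^sup>2)"
  proof (rule Bochner_Integration.integrable_bound)
    have "(norm (f t))\<^sup>2 \<le> C\<^sup>2 * (norm (g t))\<^sup>2" if "t \<in> {0<..<S}" for t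
      using power_mono[OF assms(3)[OF that] norm_ge_zero, of 2] by (simp only: power_mult_distrib)
    then show "AE t in Leb S. norm ((norm (f t))\<^sup>2) \<le> norm (C\<^sup>2 * (norm (g t))\<^sup>2)"
      by (intro AE_I2) simp
  qed measurable
  then show ?thesis using assms(2) by (simp add: L2_def)
qed

lemma L2_bounded:
  assumes "f \<in> borel_measurable (Leb S)" "\<And>t. t \<in> {0<..<S} \<Longrightarrow> norm (f t) \<le> C"
  shows "f \<in> L2 S"
proof (rule L2_dominated[where g="\<lambda>t. 1::real" and C=C])
  show "(\<lambda>t. 1::real) \<in> L2 S" by (simp add: L2_def)
qed (use assms in auto)

lemma L2_const: "(\<lambda>t. c) \<in> L2 S"
  by (rule L2_bounded[where C="norm c"]) auto

lemma L2_add: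
  assumes "f \<in> L2 S" "g \<in> L2 S"
  shows "(\<lambda>t. f t + g t) \<in> L2 S"
proof -
  note [measurable] = assms[THEN L2_measurable]
  have int: "integrable (Leb S) (\<lambda>t. 2 * (norm (f t))\<^sup>2 + 2 * (norm (g t))\<^sup>2)"
    using assms[THEN L2_sq] by simp
  have le: "(norm (f t + g t))\<^sup>2 \<le> 2 * (norm (f t))\<^sup>2 + 2 * (norm (g t))\<^sup>2" for t
  proof -
    have "(norm (f t + g t))\<^sup>2 \<le> (norm (f t) + norm (g t))\<^sup>2"
      by (simp add: norm_triangle_ineq)
    also have "\<dots> \<le> 2 * (norm (f t))\<^sup>2 + 2 * (norm (g t))\<^sup>2"
      using zero_le_power2[of "norm (f t) - norm (g t)"] by (simp add: power2_eq_square algebra_simps)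
    finally show ?thesis .
  qed
  have "integrable (Leb S) (\<lambda>t. (norm (f t + g t))\<^sup>2)"
    by (rule integrable_norm_le[OF int]) (measurable, use le in simp)
  then show ?thesis by (simp add: L2_def)
qed

lemma L2_scaleR:
  fixes f :: "real \<Rightarrow> 'x::{banach, second_countable_topology}"
  shows "f \<in> L2 S \<Longrightarrow> (\<lambda>t. c *\<^sub>R f t) \<in> L2 S"
  by (rule L2_dominated[where g=f and C="\<bar>c\<bar>"]) (auto dest: L2_measurable)

lemma L2_diff:
  fixes f :: "real \<Rightarrow> 'x::{banach, second_countable_topology}"
  assumes "f \<in> L2 S" "g \<in> L2 S"
  shows "(\<lambda>t. f t - g t) \<in> L2 S"
  using L2_add[OF assms(1) L2_scaleR[OF assms(2), of "-1"]] by simp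

lemma L2_sum:
  "finite A \<Longrightarrow> (\<And>k. k \<in> A \<Longrightarrow> f k \<in> L2 S) \<Longrightarrow> (\<lambda>t. \<Sum>k\<in>A. f k t) \<in> L2 S"
proof (induction A rule: finite_induct)
  case empty
  then show ?case using L2_const[of 0] by simp
next
  case (insert k A)
  then show ?case using L2_add[of "f k" S "\<lambda>t. \<Sum>k\<in>A. f k t"] by simp
qed

lemma L2_norm_mult:
  assumes "f \<in> L2 S" "g \<in> L2 S"
  shows "integrable (Leb S) (\<lambda>t. norm (f t) * norm (g t))"
proof -
  note [measurable] = assms[THEN L2_measurable]
  have int: "integrable (Leb S) (\<lambda>t. (norm (f t))\<^sup>2 + (norm (g t))\<^sup>2)"
    using assms[THEN L2_sq] by simp
  have le: "norm (f t) * norm (g t) \<le> (norm (f t))\<^sup>2 + (norm (g t))\<^sup>2" for t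
    using sum_squares_bound[of "norm (f t)" "norm (g t)"] mult_nonneg_nonneg[of "norm (f t)" "norm (g t)"]
    by (simp add: mult.assoc del: mult_nonneg_nonneg)
  show ?thesis
    by (rule integrable_norm_le[OF int]) (measurable, use le in \<open>simp only: real_norm_def abs_mult abs_norm_cancel\<close>)
qed

lemma L2_integrable: 
  assumes "f \<in> L2 S"
  shows "integrable (Leb S) f"
  by (rule integrable_norm_cancel)
    (use L2_norm_mult[OF assms L2_const[of "1::real"]] L2_measurable[OF assms] in simp_all)

lemma L2_bounded_linear:
  assumes "bounded_linear h" "f \<in> L2 S"
  shows "(\<lambda>t. h (f t)) \<in> L2 S"
proof -
  obtain K where "\<And>x. norm (h x) \<le> norm x * K"
    using bounded_linear.bounded[OF assms(1)] by blast
  moreover have "(\<lambda>t. h (f t)) \<in> borel_measurable (Leb S)"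
    by (rule measurable_compose[OF L2_measurable[OF assms(2)]
          borel_measurable_continuous_onI[OF linear_continuous_on[OF assms(1)]]])
  ultimately show ?thesis
    by (intro L2_dominated[OF assms(2), where C=K]) (auto simp: mult.commute)
qed

lemma L2_mono: "f \<in> L2 S \<Longrightarrow> t \<le> S \<Longrightarrow> f \<in> L2 t"
  by (auto simp: L2_def intro: borel_measurable_Leb_mono integrable_Leb_mono)

lemma young_mult:
  fixes x y \<delta> :: real
  assumes "\<delta> > 0"
  shows "x * y \<le> \<delta> * x\<^sup>2 + y\<^sup>2 / (4 * \<delta>)"
proof -
  have "0 \<le> (2 * \<delta> * x - y)\<^sup>2 / (4 * \<delta>)" using assms by simp
  also have "\<dots> = \<delta> * x\<^sup>2 + y\<^sup>2 / (4 * \<delta>) - x * y"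
    using assms by (simp add: power2_eq_square field_simps)
  finally show ?thesis by simp
qed

text \<open>The measure is finite, so an L^2-Cauchy sequence is L^1-Cauchy and has an almost
  everywhere convergent subsequence; Fatou's lemma along it turns the pointwise limit into an L^2
  limit. The subsequence is part of the conclusion because pointwise relations have to be carried to
  the limit later.\<close>

lemma L2_complete:
  fixes s :: "nat \<Rightarrow> real \<Rightarrow> 'x::{banach, second_countable_topology}"
  assumes s: "\<And>n. s n \<in> L2 S"
    and Cau: "\<And>e. e > 0 \<Longrightarrow> \<exists>N. \<forall>m\<ge>N. \<forall>n\<ge>N. (\<integral>t. (norm (s m t - s n t))\<^sup>2 \<partial>Leb S) < e"
  obtains f r where "f \<in> L2 S" "(\<lambda>n. \<integral>t. (norm (s n t - f t))\<^sup>2 \<partial>Leb S) \<longlonglongrightarrow> 0"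
    "strict_mono r" "AE t in Leb S. (\<lambda>n. s (r n) t) \<longlonglongrightarrow> f t"
proof -
  note [measurable] = s[THEN L2_measurable]
  let ?d = "\<lambda>m n. \<integral>t. (norm (s m t - s n t))\<^sup>2 \<partial>Leb S"
  have sq: "integrable (Leb S) (\<lambda>t. (norm (s m t - s n t))\<^sup>2)" for m n
    by (rule L2_sq[OF L2_diff[OF s s]])
  have "\<exists>N. \<forall>i\<ge>N. \<forall>k\<ge>N. (\<integral>t. norm (s i t - s k t) \<partial>Leb S) < e" if e: "e > 0" for e
  proof -
    \<comment> \<open>The summand 1 keeps \<open>c\<close> positive for an empty interval. Young's
      inequality with weight \<open>\<delta> = c / e\<close> leaves a constant part below e / 4, and
      the Cauchy bound e / (4 \<delta>) makes the quadratic part at most e / 4.\<close>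
    define c where "c = measure (Leb S) {0<..<S} + 1"
    have c: "c > 0" by (simp add: c_def add_nonneg_pos)
    define \<delta> where "\<delta> = c / e"
    have \<delta>: "\<delta> > 0" using c e by (simp add: \<delta>_def)
    obtain N where N: "\<And>m n. m \<ge> N \<Longrightarrow> n \<ge> N \<Longrightarrow> ?d m n < e / (4 * \<delta>)"
      using Cau[of "e / (4 * \<delta>)"] e \<delta> by auto
    have "(\<integral>t. norm (s i t - s k t) \<partial>Leb S) < e" if "i \<ge> N" "k \<ge> N" for i k
    proof -
      have "(\<integral>t. norm (s i t - s k t) \<partial>Leb S) \<le> (\<integral>t. \<delta> * (norm (s i t - s k t))\<^sup>2 + 1 / (4 * \<delta>) \<partial>Leb S)"
      proof (rule integral_mono)
        show "integrable (Leb S) (\<lambda>t. norm (s i t - s k t))"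
          using L2_integrable[OF L2_diff[OF s s]] by auto
        show "norm (s i t - s k t) \<le> \<delta> * (norm (s i t - s k t))\<^sup>2 + 1 / (4 * \<delta>)" for t
          using young_mult[OF \<delta>, of "norm (s i t - s k t)" 1] by simp
      qed (use sq in simp)
      also have "\<dots> = \<delta> * ?d i k + (c - 1) / (4 * \<delta>)"
        using sq by (simp add: c_def)
      also have "\<dots> \<le> \<delta> * (e / (4 * \<delta>)) + (c - 1) / (4 * \<delta>)"
        using N[OF that] \<delta> by (intro add_right_mono mult_left_mono) auto
      also have "\<dots> < e / 4 + c / (4 * \<delta>)"
        using \<delta> by (auto simp: field_simps)
      also have "\<dots> \<le> e" using \<delta> c e by (simp add: \<delta>_def field_simps)
      finally show ?thesis .
    qed
    then show ?thesis by blast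
  qed
  then obtain r where r: "strict_mono r" and AEC: "AE t in Leb S. Cauchy (\<lambda>i. s (r i) t)"
    using cauchy_L1_AE_cauchy_subseq[of "Leb S" s] L2_integrable[OF s] by blast
  define f where "f = (\<lambda>t. if Cauchy (\<lambda>i. s (r i) t) then lim (\<lambda>i. s (r i) t) else 0)"
  have [measurable]: "f \<in> borel_measurable (Leb S)"
    unfolding f_def by measurable
  have lim: "AE t in Leb S. (\<lambda>n. s (r n) t) \<longlonglongrightarrow> f t"
    using AEC by eventually_elim (simp add: f_def Cauchy_convergent_iff convergent_LIMSEQ_iff)
  have fatou: "(\<integral>\<^sup>+t. ennreal ((norm (s m t - f t))\<^sup>2) \<partial>Leb S) \<le> ennreal e"
    if e: "e > 0" and N: "\<And>n. n \<ge> N \<Longrightarrow> ?d m n < e" for m N e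
  proof -
    have "(\<integral>\<^sup>+t. ennreal ((norm (s m t - f t))\<^sup>2) \<partial>Leb S) =
        (\<integral>\<^sup>+t. liminf (\<lambda>k. ennreal ((norm (s m t - s (r k) t))\<^sup>2)) \<partial>Leb S)"
    proof (rule nn_integral_cong_AE, use lim in eventually_elim)
      case (elim t)
      then have "(\<lambda>k. ennreal ((norm (s m t - s (r k) t))\<^sup>2)) \<longlonglongrightarrow> ennreal ((norm (s m t - f t))\<^sup>2)"
        by (intro tendsto_ennrealI tendsto_intros)
      from lim_imp_Liminf[OF _ this] show ?case by simp
    qed
    also have "\<dots> \<le> liminf (\<lambda>k. \<integral>\<^sup>+t. ennreal ((norm (s m t - s (r k) t))\<^sup>2) \<partial>Leb S)"
      by (rule nn_integral_liminf) simp
    also have "\<dots> = liminf (\<lambda>k. ennreal (?d m (r k)))"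
      using sq by (simp add: nn_integral_eq_integral)
    also have "\<dots> \<le> liminf (\<lambda>k. ennreal e)"
    proof (rule Liminf_mono)
      show "eventually (\<lambda>k. ennreal (?d m (r k)) \<le> ennreal e) sequentially"
        using eventually_ge_at_top[of N]
      proof eventually_elim
        case (elim k)
        then have "r k \<ge> N" using seq_suble[OF r, of k] by simp
        then show ?case using N[of "r k"] by (intro ennreal_leI) simp
      qed
    qed
    finally show ?thesis by (simp add: Liminf_const)
  qed
  have diff: "(\<lambda>t. s m t - f t) \<in> L2 S \<and> (\<integral>t. (norm (s m t - f t))\<^sup>2 \<partial>Leb S) \<le> e"
    if e: "e > 0" and N: "\<And>n. n \<ge> N \<Longrightarrow> ?d m n < e" for m N e
  proof -
    have le: "(\<integral>\<^sup>+t. ennreal ((norm (s m t - f t))\<^sup>2) \<partial>Leb S) \<le> ennreal e"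
      by (rule fatou[OF e]) (rule N)
    have "integrable (Leb S) (\<lambda>t. (norm (s m t - f t))\<^sup>2)"
      by (rule integrableI_bounded) (use le in \<open>auto simp: le_less_trans\<close>)
    moreover from this have "(\<integral>t. (norm (s m t - f t))\<^sup>2 \<partial>Leb S) \<le> e"
      using le e by (simp add: nn_integral_eq_integral)
    ultimately show ?thesis by (simp add: L2_def)
  qed
  show thesis
  proof (rule that[OF _ _ r lim])
    obtain N where "\<And>m n. m \<ge> N \<Longrightarrow> n \<ge> N \<Longrightarrow> ?d m n < 1" using Cau[of 1] by auto
    then have "(\<lambda>t. s N t - f t) \<in> L2 S" using diff[of 1 N N] by auto
    from L2_diff[OF s[of N] this] show "f \<in> L2 S" by simp
    show "(\<lambda>n. \<integral>t. (norm (s n t - f t))\<^sup>2 \<partial>Leb S) \<longlonglongrightarrow> 0"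
    proof (rule LIMSEQ_I)
      fix e :: real assume "e > 0"
      then have e2: "e / 2 > 0" by simp
      obtain N where N: "\<And>m n. m \<ge> N \<Longrightarrow> n \<ge> N \<Longrightarrow> ?d m n < e / 2" using Cau[OF e2] by auto
      have "(\<integral>t. (norm (s n t - f t))\<^sup>2 \<partial>Leb S) \<le> e / 2" if "n \<ge> N" for n
        using diff[OF e2, of N n] N that by auto
      then show "\<exists>no. \<forall>n\<ge>no. norm ((\<integral>t. (norm (s n t - f t))\<^sup>2 \<partial>Leb S) - 0) < e"
        using \<open>e > 0\<close> by (intro exI[of _ N]) (force simp: abs_of_nonneg intro: le_less_trans)
    qed
  qed
qed

section \<open>Primitives and integration by parts\<close>

lemma AE_Leb_neq: "AE t in Leb S. t \<noteq> c"
proof -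
  have "AE t in lebesgue. t \<noteq> c" by (rule AE_completion[OF AE_lborel_singleton])
  then show ?thesis by (subst AE_restrict_space_iff) auto
qed

text \<open>The integral of f over A, as a function of A, vanishes on half-lines, an
  intersection-stable generator of the Borel sets, hence on all Borel sets by Dynkin's theorem.
  Lebesgue sets differ from Borel sets by null sets, and a function whose integrals over all
  measurable sets vanish is zero almost everywhere.\<close>

lemma integral_zero_imp_AE_zero:
  fixes f :: "real \<Rightarrow> 'x::{banach, second_countable_topology}"
  assumes f: "integrable (Leb S) f" and zero: "\<And>t. t \<in> {0..S} \<Longrightarrow> integral\<^sup>L (Leb t) f = 0"
  shows "AE t in Leb S. f t = 0"
proof -
  \<comment> \<open>Extension by zero makes all half-lines of the real line available as
    generators.\<close>
  define F where "F = (\<lambda>s. indicator {0<..<S} s *\<^sub>R f s)"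
  have sets: "{0<..<S} \<inter> space lebesgue \<in> sets lebesgue" by simp
  have F: "integrable lebesgue F"
    using f unfolding F_def integrable_restrict_space[OF sets] .
  have lt: "(LINT s:{..<t}|lebesgue. F s) = 0" for t
  proof -
    consider "t < 0" | "0 \<le> t" "t \<le> S" | "t > S" by linarith
    then show ?thesis
    proof cases
      case 1
      then have "(\<lambda>s. indicator {..<t} s *\<^sub>R F s) = (\<lambda>s. 0)" by (auto simp: F_def indicator_def)
      then show ?thesis unfolding set_lebesgue_integral_def by simp
    next
      case 2
      then have "(\<lambda>s. indicator {..<t} s *\<^sub>R F s) = (\<lambda>s. indicator {0<..<t} s *\<^sub>R f s)"
        by (auto simp: F_def indicator_def)
      moreover have "integral\<^sup>L lebesgue (\<lambda>s. indicator {0<..<t} s *\<^sub>R f s) = integral\<^sup>L (Leb t) f"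
        by (rule integral_restrict_space[symmetric]) simp
      ultimately show ?thesis using zero[of t] 2 unfolding set_lebesgue_integral_def by simp
    next
      case 3
      then have "(\<lambda>s. indicator {..<t} s *\<^sub>R F s) = (\<lambda>s. indicator {0<..<S} s *\<^sub>R f s)"
        by (auto simp: F_def indicator_def)
      moreover have "integral\<^sup>L lebesgue (\<lambda>s. indicator {0<..<S} s *\<^sub>R f s) = integral\<^sup>L (Leb S) f"
        by (rule integral_restrict_space[symmetric]) simp
      moreover have "integral\<^sup>L (Leb S) f = 0"
      proof (cases "S \<ge> 0")
        case True then show ?thesis using zero[of S] by simp
      next
        case False
        have "integral\<^sup>L (Leb S) f = integral\<^sup>L (Leb S) (\<lambda>x. 0)"
          by (rule Bochner_Integration.integral_cong) (use False in auto)
        then show ?thesis by simp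
      qed
      ultimately show ?thesis unfolding set_lebesgue_integral_def by simp
    qed
  qed
  have int: "set_integrable lebesgue A F" if "A \<in> sets lebesgue" for A
    unfolding set_integrable_def using integrable_mult_indicator[OF that F] .
  have all: "integral\<^sup>L lebesgue F = 0"
  proof -
    have "integral\<^sup>L lebesgue F = (LINT s:{..<S}|lebesgue. F s)"
      unfolding set_lebesgue_integral_def
      by (intro Bochner_Integration.integral_cong) (auto simp: F_def indicator_def)
    then show ?thesis using lt by simp
  qed
  have borel: "(LINT s:B|lebesgue. F s) = 0" if "B \<in> sigma_sets UNIV (range lessThan)" for B
  proof (rule sigma_sets_induct_disjoint[of "range lessThan" UNIV, OF _ _ that])
    show "Int_stable (range (lessThan :: real \<Rightarrow> _))"
    proof (rule Int_stableI)
      show "A \<inter> B \<in> range lessThan" if AB: "A \<in> range lessThan" "B \<in> range lessThan" for A B :: "real set"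
      proof -
        obtain a b where "A = {..<a}" "B = {..<b}" using AB by blast
        then have "A \<inter> B = {..<min a b}" by auto
        then show ?thesis by blast
      qed
    qed
    show "range (lessThan :: real \<Rightarrow> _) \<subseteq> Pow UNIV" by simp
    show "(LINT s:A|lebesgue. F s) = 0" if "A \<in> range lessThan" for A
      using that lt by auto
    show "(LINT s:{}|lebesgue. F s) = 0" by (simp add: set_lebesgue_integral_def)
    have sig: "A \<in> sets lebesgue" if "A \<in> sigma_sets UNIV (range lessThan)" for A :: "real set"
      using that sets_completionI_sets[of A lborel] by (simp add: borel_Iio)
    show "(LINT s:UNIV - A|lebesgue. F s) = 0"
      if A: "A \<in> sigma_sets UNIV (range lessThan)" and "(LINT s:A|lebesgue. F s) = 0" for A
    proof -
      have "(LINT s:A \<union> (UNIV - A)|lebesgue. F s) = (LINT s:A|lebesgue. F s) + (LINT s:UNIV - A|lebesgue. F s)"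
        using sig[OF A] by (intro set_integral_Un int) auto
      then show ?thesis using that(2) all by (simp add: set_lebesgue_integral_def)
    qed
    show "(LINT s:(\<Union>i. A i)|lebesgue. F s) = 0"
      if "disjoint_family A" "range A \<subseteq> sigma_sets UNIV (range lessThan)"
        "\<And>i. (LINT s:A i|lebesgue. F s) = 0" for A :: "nat \<Rightarrow> real set"
    proof -
      have A: "A i \<in> sets lebesgue" for i using that(2) sig by blast
      have "(LINT s:(\<Union>i. A i)|lebesgue. F s) = (\<Sum>i. (LINT s:A i|lebesgue. F s))"
      proof (rule lebesgue_integral_countable_add[OF A])
        show "set_integrable lebesgue (\<Union>i. A i) F"
          by (rule int) (use A in blast)
      qed (use that(1) in \<open>auto simp: disjoint_family_on_def\<close>)
      then show ?thesis using that(3) by simp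
    qed
  qed
  show ?thesis
  proof (rule sigma_finite_measure.density_zero[OF _ f])
    show "sigma_finite_measure (Leb S)"
      using finite_measure_Leb by (rule finite_measure.axioms)
    fix A assume "A \<in> sets (Leb S)"
    then have A_leb: "A \<in> sets lebesgue" by (auto simp: sets_restrict_space)
    \<comment> \<open>A Lebesgue set is a Borel set up to a part of a null set, so its integral is
      already known to vanish.\<close>
    then obtain B N N' where A: "A = B \<union> N" "N \<subseteq> N'" "N' \<in> null_sets lborel" "B \<in> sets lborel"
      by (rule sets_completionE)
    then have B: "B \<in> sigma_sets UNIV (range lessThan)" "B \<in> sets lebesgue" by (auto simp: borel_Iio)
    have "N' \<in> null_sets lebesgue" using A(3) by (rule null_sets_completionI)
    then have "AE s in lebesgue. s \<notin> N'" by (rule AE_not_in)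
    then have "AE s in lebesgue. s \<in> A \<longleftrightarrow> s \<in> B"
      by eventually_elim (use A in auto)
    then have "(LINT s:A|lebesgue. F s) = (LINT s:B|lebesgue. F s)"
      using int[OF A_leb] int[OF B(2)] unfolding set_integrable_def
      by (intro set_integral_cong_set[symmetric])
        (auto simp: set_borel_measurable_def)
    moreover have "(LINT s:A|Leb S. f s) = (LINT s:A|lebesgue. F s)"
      unfolding set_lebesgue_integral_def F_def integral_restrict_space[OF sets]
      by (simp add: mult.commute)
    ultimately show "(LINT s:A|Leb S. f s) = 0" using borel[OF B(1)] by simp
  qed
qed

text \<open>Fubini's theorem on the square (0,S) x (0,S): the integral of \<beta> (f s) (g t) is the
  product on the left, and the diagonal, a null set, cuts the square into two triangles whose inner
  integrals are the primitives of g and of f.\<close>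

lemma bilinear_integral_by_parts:
  fixes f :: "real \<Rightarrow> 'a::{banach, second_countable_topology}"
    and g :: "real \<Rightarrow> 'b::{banach, second_countable_topology}"
    and \<beta> :: "'a \<Rightarrow> 'b \<Rightarrow> 'c::{banach, second_countable_topology}"
  assumes \<beta>: "bounded_bilinear \<beta>" and f: "integrable (Leb S) f" and g: "integrable (Leb S) g"
  shows "integrable (Leb S) (\<lambda>t. \<beta> (f t) (integral\<^sup>L (Leb t) g))"
    and "integrable (Leb S) (\<lambda>t. \<beta> (integral\<^sup>L (Leb t) f) (g t))"
    and "\<beta> (integral\<^sup>L (Leb S) f) (integral\<^sup>L (Leb S) g) =
      integral\<^sup>L (Leb S) (\<lambda>t. \<beta> (f t) (integral\<^sup>L (Leb t) g) + \<beta> (integral\<^sup>L (Leb t) f) (g t))"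
proof -
  interpret bounded_bilinear \<beta> by fact
  let ?M = "Leb S"
  interpret finite_measure ?M by simp
  interpret P: pair_sigma_finite ?M ?M ..
  obtain K where K: "\<And>a b. norm (\<beta> a b) \<le> norm a * norm b * K" using bounded by blast
  have [measurable]: "f \<in> borel_measurable ?M" "g \<in> borel_measurable ?M" using f g by auto
  have [measurable]: "fst \<in> borel_measurable (?M \<Otimes>\<^sub>M ?M)" "snd \<in> borel_measurable (?M \<Otimes>\<^sub>M ?M)"
    using measurable_compose[OF measurable_fst measurable_id_Leb, of S ?M]
      measurable_compose[OF measurable_snd measurable_id_Leb, of ?M S] by simp_all
  define F where "F = (\<lambda>p. \<beta> (f (fst p)) (g (snd p)))"
  have [measurable]: "F \<in> borel_measurable (?M \<Otimes>\<^sub>M ?M)"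
    unfolding F_def
  proof (rule borel_measurable_continuous_Pair[where H=\<beta>])
    show "continuous_on UNIV (\<lambda>x. \<beta> (fst x) (snd x))" by (intro continuous_on continuous_intros)
  qed measurable
  have F: "integrable (?M \<Otimes>\<^sub>M ?M) F"
  proof (rule P.Fubini_integrable)
    show "AE s in ?M. integrable ?M (\<lambda>t. F (s, t))"
      unfolding F_def using g by (auto intro!: integrable_bounded_linear[OF bounded_linear_right])
    have int: "integrable ?M (\<lambda>s. norm (f s) * (\<integral>t. norm (g t) * K \<partial>?M))"
      using f by simp
    show "integrable ?M (\<lambda>s. \<integral>t. norm (F (s, t)) \<partial>?M)"
    proof (rule integrable_norm_le[OF int])
      show "norm (\<integral>t. norm (F (s, t)) \<partial>?M) \<le> norm (f s) * (\<integral>t. norm (g t) * K \<partial>?M)" for s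
      proof -
        have "norm (\<integral>t. norm (F (s, t)) \<partial>?M) = (\<integral>t. norm (F (s, t)) \<partial>?M)" by simp
        also have "\<dots> \<le> (\<integral>t. norm (f s) * (norm (g t) * K) \<partial>?M)"
        proof (rule integral_mono)
          show "integrable ?M (\<lambda>t. norm (F (s, t)))"
            unfolding F_def using g by (auto intro!: integrable_norm integrable_bounded_linear[OF bounded_linear_right])
          show "norm (F (s, t)) \<le> norm (f s) * (norm (g t) * K)" for t
            using K[of "f s" "g t"] by (simp add: F_def mult.assoc)
        qed (use g in simp)
        finally show ?thesis by simp
      qed
    qed measurable
  qed measurable
  \<comment> \<open>\<open>A1\<close> lives on the triangle t < s, where integration over t yields
    the primitive of g at s; \<open>A2\<close> lives on s < t and yields the primitive of f at
    t.\<close>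
  define A1 where "A1 = (\<lambda>p. indicator {p. snd p < fst p} p *\<^sub>R F p)"
  define A2 where "A2 = (\<lambda>p. indicator {p. fst p < snd p} p *\<^sub>R F p)"
  have [measurable]: "A1 \<in> borel_measurable (?M \<Otimes>\<^sub>M ?M)" "A2 \<in> borel_measurable (?M \<Otimes>\<^sub>M ?M)"
    unfolding A1_def A2_def indicator_def by measurable
  have A1: "integrable (?M \<Otimes>\<^sub>M ?M) A1"
    by (rule Bochner_Integration.integrable_bound[OF F]) (auto simp: A1_def indicator_def)
  have A2: "integrable (?M \<Otimes>\<^sub>M ?M) A2"
    by (rule Bochner_Integration.integrable_bound[OF F]) (auto simp: A2_def indicator_def)
  have in1: "(\<integral>t. A1 (s, t) \<partial>?M) = \<beta> (f s) (integral\<^sup>L (Leb s) g)" if "s \<in> {0<..<S}" for s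
  proof -
    have "(\<integral>t. A1 (s, t) \<partial>?M) = (\<integral>t. \<beta> (f s) (indicator {..<s} t *\<^sub>R g t) \<partial>?M)"
      by (intro Bochner_Integration.integral_cong) (auto simp: A1_def F_def indicator_def zero_right)
    also have "\<dots> = \<beta> (f s) (\<integral>t. indicator {..<s} t *\<^sub>R g t \<partial>?M)"
      by (rule integral_bounded_linear[OF bounded_linear_right]) (rule integrable_indicator_Leb[OF g], simp)
    finally show ?thesis using that by (simp add: integral_Leb_sub[of s S g])
  qed
  have in2: "(\<integral>s. A2 (s, t) \<partial>?M) = \<beta> (integral\<^sup>L (Leb t) f) (g t)" if "t \<in> {0<..<S}" for t
  proof -
    have "(\<integral>s. A2 (s, t) \<partial>?M) = (\<integral>s. \<beta> (indicator {..<t} s *\<^sub>R f s) (g t) \<partial>?M)"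
      by (intro Bochner_Integration.integral_cong) (auto simp: A2_def F_def indicator_def zero_left)
    also have "\<dots> = \<beta> (\<integral>s. indicator {..<t} s *\<^sub>R f s \<partial>?M) (g t)"
      by (rule integral_bounded_linear[OF bounded_linear_left]) (rule integrable_indicator_Leb[OF f], simp)
    finally show ?thesis using that by (simp add: integral_Leb_sub[of t S f])
  qed
  have "integrable ?M (\<lambda>s. \<integral>t. A1 (s, t) \<partial>?M)" by (rule P.integrable_fst'[OF A1])
  then show i1: "integrable ?M (\<lambda>t. \<beta> (f t) (integral\<^sup>L (Leb t) g))"
    by (rule Bochner_Integration.integrable_cong[THEN iffD1, rotated -1]) (use in1 in auto)
  have A2': "integrable (?M \<Otimes>\<^sub>M ?M) (case_prod (\<lambda>s t. A2 (s, t)))" using A2 by simp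
  have "integrable ?M (\<lambda>t. \<integral>s. A2 (s, t) \<partial>?M)" by (rule P.integrable_snd[OF A2'])
  then show i2: "integrable ?M (\<lambda>t. \<beta> (integral\<^sup>L (Leb t) f) (g t))"
    by (rule Bochner_Integration.integrable_cong[THEN iffD1, rotated -1]) (use in2 in auto)
  have "\<beta> (integral\<^sup>L ?M f) (integral\<^sup>L ?M g) = (\<integral>s. \<beta> (f s) (integral\<^sup>L ?M g) \<partial>?M)"
    by (rule integral_bounded_linear[OF bounded_linear_left f, symmetric])
  also have "\<dots> = (\<integral>s. (\<integral>t. F (s, t) \<partial>?M) \<partial>?M)"
    unfolding F_def fst_conv snd_conv
    by (intro Bochner_Integration.integral_cong refl integral_bounded_linear[OF bounded_linear_right g, symmetric])
  also have "\<dots> = integral\<^sup>L (?M \<Otimes>\<^sub>M ?M) F"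
    by (rule P.integral_fst'[OF F])
  also have "\<dots> = integral\<^sup>L (?M \<Otimes>\<^sub>M ?M) (\<lambda>p. A1 p + A2 p)"
  proof (rule integral_cong_AE)
    have "AE p in ?M \<Otimes>\<^sub>M ?M. fst p \<noteq> snd p"
    proof (rule P.AE_pair_measure)
      show "{x \<in> space (?M \<Otimes>\<^sub>M ?M). fst x \<noteq> snd x} \<in> sets (?M \<Otimes>\<^sub>M ?M)" by measurable
      show "AE x in ?M. AE y in ?M. fst (x, y) \<noteq> snd (x, y)"
        using AE_Leb_neq by (auto simp: eq_commute)
    qed
    then show "AE p in ?M \<Otimes>\<^sub>M ?M. F p = A1 p + A2 p"
      by eventually_elim (auto simp: A1_def A2_def indicator_def)
  qed measurable
  also have "\<dots> = integral\<^sup>L (?M \<Otimes>\<^sub>M ?M) A1 + integral\<^sup>L (?M \<Otimes>\<^sub>M ?M) A2"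
    by (rule Bochner_Integration.integral_add[OF A1 A2])
  also have "integral\<^sup>L (?M \<Otimes>\<^sub>M ?M) A1 = (\<integral>s. (\<integral>t. A1 (s, t) \<partial>?M) \<partial>?M)"
    by (rule P.integral_fst'[OF A1, symmetric])
  also have "\<dots> = (\<integral>s. \<beta> (f s) (integral\<^sup>L (Leb s) g) \<partial>?M)"
    by (rule Bochner_Integration.integral_cong) (use in1 in auto)
  also have "integral\<^sup>L (?M \<Otimes>\<^sub>M ?M) A2 = (\<integral>t. (\<integral>s. A2 (s, t) \<partial>?M) \<partial>?M)"
    using P.integral_snd[OF A2'] by simp
  also have "\<dots> = (\<integral>t. \<beta> (integral\<^sup>L (Leb t) f) (g t) \<partial>?M)"
    by (rule Bochner_Integration.integral_cong) (use in2 in auto)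
  also have "(\<integral>s. \<beta> (f s) (integral\<^sup>L (Leb s) g) \<partial>?M) + \<dots> =
      integral\<^sup>L ?M (\<lambda>t. \<beta> (f t) (integral\<^sup>L (Leb t) g) + \<beta> (integral\<^sup>L (Leb t) f) (g t))"
    by (rule Bochner_Integration.integral_add[OF i1 i2, symmetric])
  finally show "\<beta> (integral\<^sup>L ?M f) (integral\<^sup>L ?M g) =
      integral\<^sup>L ?M (\<lambda>t. \<beta> (f t) (integral\<^sup>L (Leb t) g) + \<beta> (integral\<^sup>L (Leb t) f) (g t))" .
qed

text \<open>Absolute continuity in integral form, with \<open>x'\<close> relevant only up to null
  sets and \<open>x\<close> only on [0,S]. Vector-valued functions are never differentiated
  pointwise; every product rule below is an identity or an estimate between integrals.\<close>

definition primitive_on :: "real \<Rightarrow> (real \<Rightarrow> 'x::{banach, second_countable_topology}) \<Rightarrow> (real \<Rightarrow> 'x) \<Rightarrow> bool" where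
  "primitive_on S x x' \<longleftrightarrow>
     integrable (Leb S) x' \<and> (\<forall>t\<in>{0..S}. x t = x 0 + integral\<^sup>L (Leb t) x')"

lemma
  assumes "primitive_on S x x'"
  shows primitive_on_integrable: "integrable (Leb S) x'"
    and primitive_on_eq: "t \<in> {0..S} \<Longrightarrow> x t = x 0 + integral\<^sup>L (Leb t) x'"
  using assms unfolding primitive_on_def by blast+

lemma integral_Leb_0 [simp]: "integral\<^sup>L (Leb 0) (f :: real \<Rightarrow> 'x::{banach, second_countable_topology}) = 0"
proof -
  have "integral\<^sup>L (Leb 0) f = integral\<^sup>L (Leb 0) (\<lambda>t. 0)"
    by (rule Bochner_Integration.integral_cong) auto
  then show ?thesis by simp
qed

lemma primitive_on_integral:
  "integrable (Leb S) g \<Longrightarrow> primitive_on S (\<lambda>t. c + integral\<^sup>L (Leb t) g) g"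
  unfolding primitive_on_def by simp

lemma primitive_on_const: "primitive_on S (\<lambda>t. c) (\<lambda>t. 0)"
  unfolding primitive_on_def integral_zero add_0_right by (intro conjI ballI integrable_zero refl)

lemma primitive_on_add:
  "primitive_on S x x' \<Longrightarrow> primitive_on S y y' \<Longrightarrow> primitive_on S (\<lambda>t. x t + y t) (\<lambda>t. x' t + y' t)"
  unfolding primitive_on_def
proof (intro conjI ballI; elim conjE)
  fix t assume int: "integrable (Leb S) x'" "integrable (Leb S) y'" and t: "t \<in> {0..S}"
    and eq: "\<forall>t\<in>{0..S}. x t = x 0 + integral\<^sup>L (Leb t) x'" "\<forall>t\<in>{0..S}. y t = y 0 + integral\<^sup>L (Leb t) y'"
  have "integral\<^sup>L (Leb t) (\<lambda>t. x' t + y' t) = integral\<^sup>L (Leb t) x' + integral\<^sup>L (Leb t) y'"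
    by (rule Bochner_Integration.integral_add; rule integrable_Leb_mono[of S], rule int) (use t in auto)
  then show "x t + y t = x 0 + y 0 + integral\<^sup>L (Leb t) (\<lambda>t. x' t + y' t)"
    unfolding eq(1)[THEN bspec, OF t] eq(2)[THEN bspec, OF t] by (simp only: ac_simps)
qed (rule Bochner_Integration.integrable_add)

lemma primitive_on_linear:
  assumes "bounded_linear h" "primitive_on S x x'"
  shows "primitive_on S (\<lambda>t. h (x t)) (\<lambda>t. h (x' t))"
  unfolding primitive_on_def
proof (intro conjI ballI)
  note x' = primitive_on_integrable[OF assms(2)]
  show "integrable (Leb S) (\<lambda>t. h (x' t))" by (rule integrable_bounded_linear[OF assms(1) x'])
  fix t assume t: "t \<in> {0..S}"
  have "h (x t) = h (x 0 + integral\<^sup>L (Leb t) x')"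
    by (rule arg_cong[OF primitive_on_eq[OF assms(2) t]])
  also have "\<dots> = h (x 0) + h (integral\<^sup>L (Leb t) x')"
    by (rule linear_add[OF bounded_linear.linear[OF assms(1)]])
  also have "h (integral\<^sup>L (Leb t) x') = integral\<^sup>L (Leb t) (\<lambda>t. h (x' t))"
    using integral_bounded_linear[OF assms(1) integrable_Leb_mono[OF x']] t by simp
  finally show "h (x t) = h (x 0) + integral\<^sup>L (Leb t) (\<lambda>t. h (x' t))" .
qed

lemma primitive_on_cong:
  assumes "primitive_on S x x'" "\<And>t. t \<in> {0..S} \<Longrightarrow> y t = x t"
    "AE t in Leb S. y' t = x' t" "y' \<in> borel_measurable (Leb S)"
  shows "primitive_on S y y'"
  unfolding primitive_on_def
proof (intro conjI ballI)
  note x' = primitive_on_integrable[OF assms(1)]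
  show "integrable (Leb S) y'"
    using x' assms(3,4) by (subst integrable_cong_AE[where g=x']) auto
  fix t assume t: "t \<in> {0..S}"
  have tS: "t \<le> S" using t by simp
  have "integral\<^sup>L (Leb t) y' = integral\<^sup>L (Leb t) x'"
    by (rule integral_cong_AE[OF borel_measurable_Leb_mono[OF assms(4) tS] _ AE_Leb_mono[OF assms(3) tS]])
      (use integrable_Leb_mono[OF x' tS] in auto)
  then show "y t = y 0 + integral\<^sup>L (Leb t) y'"
    using primitive_on_eq[OF assms(1) t] assms(2)[OF t] assms(2)[of 0] t by (metis atLeastAtMost_iff order.trans order_refl)
qed

lemma continuous_on_primitive:
  assumes "primitive_on S x x'"
  shows "continuous_on {0..S} x"
proof -
  note x' = primitive_on_integrable[OF assms]
  have [measurable]: "x' \<in> borel_measurable (Leb S)" using x' by auto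
  have "continuous_on {0..S} (\<lambda>t. x 0 + (\<integral>s. indicator {..<t} s *\<^sub>R x' s \<partial>Leb S))"
    unfolding continuous_on_sequentially
  proof (intro ballI allI impI, unfold comp_def)
    fix t and r :: "nat \<Rightarrow> real" assume "(\<forall>n. r n \<in> {0..S}) \<and> r \<longlonglongrightarrow> t"
    then have r: "r \<longlonglongrightarrow> t" by simp
    have "(\<lambda>n. \<integral>s. indicator {..<r n} s *\<^sub>R x' s \<partial>Leb S) \<longlonglongrightarrow> (\<integral>s. indicator {..<t} s *\<^sub>R x' s \<partial>Leb S)"
    proof (rule integral_dominated_convergence[where w="\<lambda>s. norm (x' s)"])
      have "(\<lambda>s. indicator A s *\<^sub>R x' s) \<in> borel_measurable (Leb S)" if "A \<in> sets borel" for A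
        using integrable_indicator_Leb[OF x' that] by auto
      then show "(\<lambda>s. indicator {..<t} s *\<^sub>R x' s) \<in> borel_measurable (Leb S)"
        "\<And>i. (\<lambda>s. indicator {..<r i} s *\<^sub>R x' s) \<in> borel_measurable (Leb S)" by auto
      \<comment> \<open>At s = t the moving indicators may oscillate, but a single point is a null
        set; elsewhere they are eventually constant.\<close>
      show "AE s in Leb S. (\<lambda>i. indicator {..<r i} s *\<^sub>R x' s) \<longlonglongrightarrow> indicator {..<t} s *\<^sub>R x' s"
        using AE_Leb_neq[of t S]
      proof eventually_elim
        case (elim s)
        have "eventually (\<lambda>i. s < r i \<longleftrightarrow> s < t) sequentially"
        proof (cases "s < t")
          case True
          from order_tendstoD(1)[OF r this] show ?thesis by (rule eventually_mono) (use True in simp)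
        next
          case False
          then have "t < s" using elim by simp
          from order_tendstoD(2)[OF r this] show ?thesis by (rule eventually_mono) (use False in simp)
        qed
        then have "eventually (\<lambda>i. indicator {..<r i} s *\<^sub>R x' s = indicator {..<t} s *\<^sub>R x' s) sequentially"
          by eventually_elim (simp add: indicator_def)
        then show ?case by (rule tendsto_eventually)
      qed
      show "\<And>i. AE s in Leb S. norm (indicator {..<r i} s *\<^sub>R x' s) \<le> norm (x' s)"
        by (intro AE_I2) (simp add: indicator_def)
    qed (use x' in auto)
    then show "(\<lambda>n. x 0 + (\<integral>s. indicator {..<r n} s *\<^sub>R x' s \<partial>Leb S)) \<longlonglongrightarrow> x 0 + (\<integral>s. indicator {..<t} s *\<^sub>R x' s \<partial>Leb S)"
      by (intro tendsto_intros)
  qed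
  moreover have "x 0 + (\<integral>s. indicator {..<t} s *\<^sub>R x' s \<partial>Leb S) = x t" if "t \<in> {0..S}" for t
    by (subst primitive_on_eq[OF assms that]) (use integral_Leb_sub[of t S x'] that in simp)
  ultimately show ?thesis by (rule continuous_on_eq)
qed

lemma continuous_on_borel_measurable_Leb:
  fixes x :: "real \<Rightarrow> 'x::{banach, second_countable_topology}"
  assumes "continuous_on {0..S} x"
  shows "x \<in> borel_measurable (Leb S)"
proof -
  have "continuous_on {0<..<S} x" using assms by (rule continuous_on_subset) auto
  then have "x \<in> borel_measurable (restrict_space borel {0<..<S})"
    by (rule borel_measurable_continuous_on_restrict)
  then have "(\<lambda>t. indicator {0<..<S} t *\<^sub>R x t) \<in> borel_measurable borel"
    by (subst (asm) borel_measurable_restrict_space_iff) auto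
  then have "(\<lambda>t. indicator {0<..<S} t *\<^sub>R x t) \<in> borel_measurable lebesgue"
    by (intro measurable_completion) simp
  then show ?thesis by (subst borel_measurable_restrict_space_iff) auto
qed

lemma continuous_on_Icc_bounded:
  fixes x :: "real \<Rightarrow> 'x::real_normed_vector"
  assumes "continuous_on {0..S} x"
  obtains B where "B \<ge> 0" "\<And>t. t \<in> {0..S} \<Longrightarrow> norm (x t) \<le> B"
proof -
  have "compact (x ` {0..S})"
    by (rule compact_continuous_image[OF assms]) simp
  then obtain B where B: "\<forall>y\<in>x ` {0..S}. norm y \<le> B"
    by (metis compact_imp_bounded bounded_iff)
  show thesis
  proof (rule that[of "max B 0"])
    show "norm (x t) \<le> max B 0" if "t \<in> {0..S}" for t
      using B[THEN bspec, OF imageI[OF that]] by simp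
  qed simp
qed

lemma continuous_on_L2:
  assumes "continuous_on {0..S} x"
  shows "x \<in> L2 S"
proof -
  obtain B where "\<And>t. t \<in> {0..S} \<Longrightarrow> norm (x t) \<le> B" using continuous_on_Icc_bounded[OF assms] by blast
  then show ?thesis
    by (intro L2_bounded[where C=B] continuous_on_borel_measurable_Leb[OF assms]) auto
qed

text \<open>The initial values are split off as constants, which contribute linear terms only; the
  remainder is \<open>bilinear_integral_by_parts\<close> for primitives that vanish at 0.\<close>

lemma primitive_on_bilinear:
  assumes \<beta>: "bounded_bilinear \<beta>" and x: "primitive_on S x x'" and y: "primitive_on S y y'"
  shows "integrable (Leb S) (\<lambda>t. \<beta> (x' t) (y t))" "integrable (Leb S) (\<lambda>t. \<beta> (x t) (y' t))"
    and "primitive_on S (\<lambda>t. \<beta> (x t) (y t)) (\<lambda>t. \<beta> (x' t) (y t) + \<beta> (x t) (y' t))"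
proof -
  interpret bounded_bilinear \<beta> by fact
  note x' = primitive_on_integrable[OF x] and y' = primitive_on_integrable[OF y]
  have i1: "integrable (Leb t) (\<lambda>s. \<beta> (x' s) (y 0))" and i2: "integrable (Leb t) (\<lambda>s. \<beta> (x 0) (y' s))" if "t \<le> S" for t
    using that integrable_Leb_mono[OF x'] integrable_Leb_mono[OF y']
    by (auto intro: integrable_bounded_linear[OF bounded_linear_left] integrable_bounded_linear[OF bounded_linear_right])
  have i3: "integrable (Leb t) (\<lambda>s. \<beta> (x' s) (integral\<^sup>L (Leb s) y'))"
    and i4: "integrable (Leb t) (\<lambda>s. \<beta> (integral\<^sup>L (Leb s) x') (y' s))"
    and eq: "\<beta> (integral\<^sup>L (Leb t) x') (integral\<^sup>L (Leb t) y') =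
      integral\<^sup>L (Leb t) (\<lambda>s. \<beta> (x' s) (integral\<^sup>L (Leb s) y') + \<beta> (integral\<^sup>L (Leb s) x') (y' s))" if "t \<le> S" for t
    using bilinear_integral_by_parts[OF \<beta> integrable_Leb_mono[OF x' that] integrable_Leb_mono[OF y' that]] by auto
  have e1: "\<beta> (x' s) (y s) = \<beta> (x' s) (y 0) + \<beta> (x' s) (integral\<^sup>L (Leb s) y')"
    and e2: "\<beta> (x s) (y' s) = \<beta> (x 0) (y' s) + \<beta> (integral\<^sup>L (Leb s) x') (y' s)" if "s \<in> {0<..<t}" "t \<le> S" for s t
  proof -
    have s: "s \<in> {0..S}" using that by simp
    show "\<beta> (x' s) (y s) = \<beta> (x' s) (y 0) + \<beta> (x' s) (integral\<^sup>L (Leb s) y')"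
      by (subst primitive_on_eq[OF y s]) (rule add_right)
    show "\<beta> (x s) (y' s) = \<beta> (x 0) (y' s) + \<beta> (integral\<^sup>L (Leb s) x') (y' s)"
      by (subst primitive_on_eq[OF x s]) (rule add_left)
  qed
  have j1: "integrable (Leb t) (\<lambda>s. \<beta> (x' s) (y s))" and j2: "integrable (Leb t) (\<lambda>s. \<beta> (x s) (y' s))" if "t \<le> S" for t
  proof -
    show "integrable (Leb t) (\<lambda>s. \<beta> (x' s) (y s))"
      by (rule Bochner_Integration.integrable_cong[THEN iffD1, OF refl _
          Bochner_Integration.integrable_add[OF i1[OF that] i3[OF that]]]) (simp only: space_Leb e1[OF _ that])
    show "integrable (Leb t) (\<lambda>s. \<beta> (x s) (y' s))"
      by (rule Bochner_Integration.integrable_cong[THEN iffD1, OF refl _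
          Bochner_Integration.integrable_add[OF i2[OF that] i4[OF that]]]) (simp only: space_Leb e2[OF _ that])
  qed
  show "integrable (Leb S) (\<lambda>t. \<beta> (x' t) (y t))" "integrable (Leb S) (\<lambda>t. \<beta> (x t) (y' t))"
    using j1[of S] j2[of S] by auto
  show "primitive_on S (\<lambda>t. \<beta> (x t) (y t)) (\<lambda>t. \<beta> (x' t) (y t) + \<beta> (x t) (y' t))"
    unfolding primitive_on_def
  proof (intro conjI ballI)
    show "integrable (Leb S) (\<lambda>t. \<beta> (x' t) (y t) + \<beta> (x t) (y' t))" using j1[of S] j2[of S] by auto
    fix t assume t: "t \<in> {0..S}"
    then have tS: "t \<le> S" by simp
    have "integral\<^sup>L (Leb t) (\<lambda>s. \<beta> (x' s) (y s) + \<beta> (x s) (y' s)) =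
      integral\<^sup>L (Leb t) (\<lambda>s. (\<beta> (x' s) (y 0) + \<beta> (x 0) (y' s)) +
        (\<beta> (x' s) (integral\<^sup>L (Leb s) y') + \<beta> (integral\<^sup>L (Leb s) x') (y' s)))"
      by (rule Bochner_Integration.integral_cong) (auto simp: e1[OF _ tS] e2[OF _ tS])
    also have "\<dots> = (integral\<^sup>L (Leb t) (\<lambda>s. \<beta> (x' s) (y 0)) + integral\<^sup>L (Leb t) (\<lambda>s. \<beta> (x 0) (y' s))) +
      \<beta> (integral\<^sup>L (Leb t) x') (integral\<^sup>L (Leb t) y')"
      using i1[OF tS] i2[OF tS] i3[OF tS] i4[OF tS] by (simp add: eq[OF tS])
    also have "integral\<^sup>L (Leb t) (\<lambda>s. \<beta> (x' s) (y 0)) = \<beta> (integral\<^sup>L (Leb t) x') (y 0)"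
      by (rule integral_bounded_linear[OF bounded_linear_left integrable_Leb_mono[OF x' tS]])
    also have "integral\<^sup>L (Leb t) (\<lambda>s. \<beta> (x 0) (y' s)) = \<beta> (x 0) (integral\<^sup>L (Leb t) y')"
      by (rule integral_bounded_linear[OF bounded_linear_right integrable_Leb_mono[OF y' tS]])
    finally show "\<beta> (x t) (y t) = \<beta> (x 0) (y 0) + integral\<^sup>L (Leb t) (\<lambda>s. \<beta> (x' s) (y s) + \<beta> (x s) (y' s))"
      by (subst primitive_on_eq[OF x t], subst primitive_on_eq[OF y t]) (simp add: add_left add_right algebra_simps)
  qed
qed

lemma primitive_on_deriv:
  fixes x x' :: "real \<Rightarrow> real"
  assumes d: "\<And>t. (x has_real_derivative x' t) (at t)" and c: "continuous_on UNIV x'"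
  shows "primitive_on S x x'"
  unfolding primitive_on_def
proof (intro conjI ballI)
  have int: "integrable (Leb t) x'" for t
    by (intro L2_integrable continuous_on_L2 continuous_on_subset[OF c]) simp
  then show "integrable (Leb S) x'" .
  fix t assume t: "t \<in> {0..S}"
  have "integral\<^sup>L (Leb t) x' = integral {0<..<t} x'"
    by (rule lebesgue_integral_eq_integral[OF int]) simp
  also have "\<dots> = integral {0..t} x'" by (rule integral_open_interval_real[symmetric])
  also have "\<dots> = x t - x 0"
    using t by (intro integral_unique fundamental_theorem_of_calculus)
      (auto intro!: has_vector_derivative_at_within d[unfolded has_real_derivative_iff_has_vector_derivative])
  finally show "x t = x 0 + integral\<^sup>L (Leb t) x'" by simp
qed

section \<open>Time-dependent forms\<close>

text \<open>The two arguments have separate types because the same calculus serves the forms on V x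
  V, the pairing \<open>rH x (j y)\<close> on H x V and the multiplication of real numbers.\<close>

definition bounded_forms :: "real \<Rightarrow> real \<Rightarrow> (real \<Rightarrow> 'a::real_normed_vector \<Rightarrow> 'b::real_normed_vector \<Rightarrow> real) \<Rightarrow> bool" where
  "bounded_forms S C c \<longleftrightarrow> 0 \<le> C \<and>
     (\<forall>t\<in>{0..S}. bounded_bilinear (c t) \<and> (\<forall>x y. \<bar>c t x y\<bar> \<le> C * norm x * norm y))"

definition measurable_forms :: "real \<Rightarrow> real \<Rightarrow> (real \<Rightarrow> 'a::real_normed_vector \<Rightarrow> 'b::real_normed_vector \<Rightarrow> real) \<Rightarrow> bool" where
  "measurable_forms S C c \<longleftrightarrow> bounded_forms S C c \<and> (\<forall>x y. (\<lambda>t. c t x y) \<in> borel_measurable (Leb S))"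

definition lipschitz_forms :: "real \<Rightarrow> real \<Rightarrow> real \<Rightarrow> (real \<Rightarrow> 'a::real_normed_vector \<Rightarrow> 'b::real_normed_vector \<Rightarrow> real) \<Rightarrow> bool" where
  "lipschitz_forms S C D c \<longleftrightarrow> bounded_forms S C c \<and>
     (\<forall>s\<in>{0..S}. \<forall>t\<in>{0..S}. \<forall>x y. \<bar>c t x y - c s x y\<bar> \<le> D * \<bar>t - s\<bar> * norm x * norm y)"

lemma
  assumes "bounded_forms S C c"
  shows bounded_forms_nonneg: "0 \<le> C"
    and bounded_forms_bilinear: "t \<in> {0..S} \<Longrightarrow> bounded_bilinear (c t)"
    and bounded_forms_le: "t \<in> {0..S} \<Longrightarrow> \<bar>c t x y\<bar> \<le> C * norm x * norm y"
  using assms unfolding bounded_forms_def by blast+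

lemma measurable_forms_bounded: "measurable_forms S C c \<Longrightarrow> bounded_forms S C c"
  by (simp add: measurable_forms_def)

lemma lipschitz_forms_bounded: "lipschitz_forms S C D c \<Longrightarrow> bounded_forms S C c"
  by (simp add: lipschitz_forms_def)

lemma lipschitz_forms_continuous:
  assumes "lipschitz_forms S C D c"
  shows "continuous_on {0..S} (\<lambda>t. c t x y)"
proof (rule lipschitz_on_continuous_on, rule lipschitz_onI)
  fix t s assume "t \<in> {0..S}" "s \<in> {0..S}"
  then have "\<bar>c t x y - c s x y\<bar> \<le> D * (\<bar>t - s\<bar> * norm x * norm y)"
    using assms unfolding lipschitz_forms_def by (auto simp: mult.assoc)
  also have "\<dots> \<le> \<bar>D\<bar> * (\<bar>t - s\<bar> * norm x * norm y)"
    by (rule mult_right_mono) auto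
  finally show "dist (c t x y) (c s x y) \<le> \<bar>D\<bar> * norm x * norm y * dist t s"
    by (simp add: dist_real_def mult_ac)
qed simp

lemma lipschitz_forms_measurable:
  assumes "lipschitz_forms S C D c"
  shows "measurable_forms S C c"
  unfolding measurable_forms_def
  using lipschitz_forms_bounded[OF assms] continuous_on_borel_measurable_Leb[OF lipschitz_forms_continuous[OF assms]]
  by blast

text \<open>Measurability in time is given for fixed vectors only. For simple f and g the
  composition is a finite sum of indicators times functions \<open>c t a b\<close>, and continuity
  of each bilinear form gives the general case as a pointwise limit.\<close>

lemma measurable_forms_compose:
  fixes c :: "real \<Rightarrow> 'a::{banach, second_countable_topology} \<Rightarrow> 'b::{banach, second_countable_topology} \<Rightarrow> real"
  assumes c: "measurable_forms S C c" and f: "f \<in> borel_measurable (Leb S)" and g: "g \<in> borel_measurable (Leb S)"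
  shows "(\<lambda>t. c t (f t) (g t)) \<in> borel_measurable (Leb S)"
proof -
  note cb = measurable_forms_bounded[OF c]
  from borel_measurable_implies_sequence_metric[OF f, of 0]
  obtain F where "(\<forall>i. simple_function (Leb S) (F i)) \<and> (\<forall>t\<in>space (Leb S). (\<lambda>i. F i t) \<longlonglongrightarrow> f t) \<and>
    (\<forall>i. \<forall>t\<in>space (Leb S). dist (F i t) 0 \<le> 2 * dist (f t) 0)" ..
  note F = this[THEN conjunct1, THEN spec] this[THEN conjunct2, THEN conjunct1, THEN bspec]
  from borel_measurable_implies_sequence_metric[OF g, of 0]
  obtain G where "(\<forall>i. simple_function (Leb S) (G i)) \<and> (\<forall>t\<in>space (Leb S). (\<lambda>i. G i t) \<longlonglongrightarrow> g t) \<and>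
    (\<forall>i. \<forall>t\<in>space (Leb S). dist (G i t) 0 \<le> 2 * dist (g t) 0)" ..
  note G = this[THEN conjunct1, THEN spec] this[THEN conjunct2, THEN conjunct1, THEN bspec]
  show ?thesis
  proof (rule borel_measurable_LIMSEQ_metric)
    fix i
    let ?A = "F i ` space (Leb S)" and ?B = "G i ` space (Leb S)"
    have fin: "finite ?A" "finite ?B" by (rule simple_functionD[OF F(1)], rule simple_functionD[OF G(1)])
    have sets: "F i -` {a} \<inter> space (Leb S) \<in> sets (Leb S)" "G i -` {a'} \<inter> space (Leb S) \<in> sets (Leb S)" for a a'
      by (rule simple_functionD[OF F(1)], rule simple_functionD[OF G(1)])
    have "(\<lambda>t. \<Sum>a\<in>?A. \<Sum>b\<in>?B. indicator (F i -` {a} \<inter> space (Leb S)) t * indicator (G i -` {b} \<inter> space (Leb S)) t * c t a b)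
      \<in> borel_measurable (Leb S)"
      using c unfolding measurable_forms_def
      by (intro borel_measurable_sum borel_measurable_times borel_measurable_indicator sets) blast
    moreover have "(\<Sum>a\<in>?A. \<Sum>b\<in>?B. indicator (F i -` {a} \<inter> space (Leb S)) t * indicator (G i -` {b} \<inter> space (Leb S)) t * c t a b)
        = c t (F i t) (G i t)" if t: "t \<in> space (Leb S)" for t
    proof -
      have "(\<Sum>a\<in>?A. \<Sum>b\<in>?B. indicator (F i -` {a} \<inter> space (Leb S)) t * indicator (G i -` {b} \<inter> space (Leb S)) t * c t a b)
         = (\<Sum>a\<in>?A. if a = F i t then (\<Sum>b\<in>?B. if b = G i t then c t a b else 0) else 0)"
        using t by (intro sum.cong refl) (auto simp: indicator_def intro!: sum.cong)
      also have "\<dots> = c t (F i t) (G i t)" using t fin by (simp add: sum.delta)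
      finally show ?thesis .
    qed
    ultimately show "(\<lambda>t. c t (F i t) (G i t)) \<in> borel_measurable (Leb S)"
      by (subst measurable_cong[OF sym])
  next
    fix t assume t: "t \<in> space (Leb S)"
    then have "bounded_bilinear (c t)" by (intro bounded_forms_bilinear[OF cb]) simp
    then show "(\<lambda>i. c t (F i t) (G i t)) \<longlonglongrightarrow> c t (f t) (g t)"
      by (rule bounded_bilinear.tendsto[OF _ F(2)[OF t] G(2)[OF t]])
  qed
qed

lemma bounded_linear_bounded_bilinear:
  assumes "bounded_linear h" "bounded_bilinear \<beta>"
  shows "bounded_bilinear (\<lambda>x y. h (\<beta> x y))"
proof -
  interpret h: bounded_linear h by fact
  interpret bounded_bilinear \<beta> by fact
  obtain K where K: "\<And>x. norm (h x) \<le> norm x * K" "K \<ge> 0" using h.nonneg_bounded by blast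
  obtain L where L: "\<And>x y. norm (\<beta> x y) \<le> norm x * norm y * L" using bounded by blast
  show ?thesis
  proof
    show "\<exists>K. \<forall>a b. norm (h (\<beta> a b)) \<le> norm a * norm b * K"
    proof (intro exI[of _ "L * K"] allI)
      show "norm (h (\<beta> a b)) \<le> norm a * norm b * (L * K)" for a b
        using K(1)[of "\<beta> a b"] mult_right_mono[OF L[of a b] K(2)] by (simp add: mult.assoc)
    qed
  qed (simp_all add: add_left add_right scaleR_left scaleR_right h.add h.scaleR)
qed

section \<open>Integrals of a measurable form along square-integrable functions\<close>

context
  fixes c :: "real \<Rightarrow> 'a::{banach, second_countable_topology} \<Rightarrow> 'b::{banach, second_countable_topology} \<Rightarrow> real" and S C
  assumes c: "measurable_forms S C c"
begin

lemma forms_integrable: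
  assumes "f \<in> L2 S" "g \<in> L2 S"
  shows "integrable (Leb S) (\<lambda>t. c t (f t) (g t))"
proof (rule integrable_norm_le)
  show "integrable (Leb S) (\<lambda>t. C * (norm (f t) * norm (g t)))"
    by (intro Bochner_Integration.integrable_mult_right L2_norm_mult assms)
  show "(\<lambda>t. c t (f t) (g t)) \<in> borel_measurable (Leb S)"
    by (intro measurable_forms_compose[OF c] L2_measurable assms)
  show "norm (c t (f t) (g t)) \<le> C * (norm (f t) * norm (g t))" if "t \<in> space (Leb S)" for t
    using bounded_forms_le[OF measurable_forms_bounded[OF c], of t "f t" "g t"] that by (simp add: mult.assoc)
qed

lemma forms_integral_le:
  assumes "f \<in> L2 S" "g \<in> L2 S"
  shows "\<bar>\<integral>t. c t (f t) (g t) \<partial>Leb S\<bar> \<le> C * (\<integral>t. norm (f t) * norm (g t) \<partial>Leb S)"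
proof -
  have "norm (\<integral>t. c t (f t) (g t) \<partial>Leb S) \<le> (\<integral>t. C * (norm (f t) * norm (g t)) \<partial>Leb S)"
  proof (rule order_trans[OF integral_norm_bound integral_mono[OF integrable_norm[OF forms_integrable[OF assms]]]])
    show "integrable (Leb S) (\<lambda>t. C * (norm (f t) * norm (g t)))"
      by (intro Bochner_Integration.integrable_mult_right L2_norm_mult assms)
    show "norm (c t (f t) (g t)) \<le> C * (norm (f t) * norm (g t))" if "t \<in> space (Leb S)" for t
      using bounded_forms_le[OF measurable_forms_bounded[OF c], of t "f t" "g t"] that by (simp add: mult.assoc)
  qed
  then show ?thesis by simp
qed

lemma forms_integral_add:
  assumes "f \<in> L2 S" "f' \<in> L2 S" "g \<in> L2 S"
  shows "(\<integral>t. c t (f t + f' t) (g t) \<partial>Leb S) = (\<integral>t. c t (f t) (g t) \<partial>Leb S) + (\<integral>t. c t (f' t) (g t) \<partial>Leb S)"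
proof -
  have "(\<integral>t. c t (f t + f' t) (g t) \<partial>Leb S) = (\<integral>t. c t (f t) (g t) + c t (f' t) (g t) \<partial>Leb S)"
    by (intro Bochner_Integration.integral_cong refl bounded_bilinear.add_left
        bounded_forms_bilinear[OF measurable_forms_bounded[OF c]]) simp
  then show ?thesis by (simp add: forms_integrable assms)
qed

lemma forms_integral_scale:
  shows "(\<integral>t. c t (r *\<^sub>R f t) (g t) \<partial>Leb S) = r * (\<integral>t. c t (f t) (g t) \<partial>Leb S)"
proof -
  have "(\<integral>t. c t (r *\<^sub>R f t) (g t) \<partial>Leb S) = (\<integral>t. r *\<^sub>R c t (f t) (g t) \<partial>Leb S)"
    by (intro Bochner_Integration.integral_cong refl bounded_bilinear.scaleR_left
        bounded_forms_bilinear[OF measurable_forms_bounded[OF c]]) simp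
  then show ?thesis by simp
qed

lemma forms_integral_add_right:
  assumes "f \<in> L2 S" "g \<in> L2 S" "g' \<in> L2 S"
  shows "(\<integral>t. c t (f t) (g t + g' t) \<partial>Leb S) = (\<integral>t. c t (f t) (g t) \<partial>Leb S) + (\<integral>t. c t (f t) (g' t) \<partial>Leb S)"
proof -
  have "(\<integral>t. c t (f t) (g t + g' t) \<partial>Leb S) = (\<integral>t. c t (f t) (g t) + c t (f t) (g' t) \<partial>Leb S)"
    by (intro Bochner_Integration.integral_cong refl bounded_bilinear.add_right
        bounded_forms_bilinear[OF measurable_forms_bounded[OF c]]) simp
  then show ?thesis by (simp add: forms_integrable assms)
qed

lemma forms_integral_scale_right:
  shows "(\<integral>t. c t (f t) (r *\<^sub>R g t) \<partial>Leb S) = r * (\<integral>t. c t (f t) (g t) \<partial>Leb S)"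
proof -
  have "(\<integral>t. c t (f t) (r *\<^sub>R g t) \<partial>Leb S) = (\<integral>t. r *\<^sub>R c t (f t) (g t) \<partial>Leb S)"
    by (intro Bochner_Integration.integral_cong refl bounded_bilinear.scaleR_right
        bounded_forms_bilinear[OF measurable_forms_bounded[OF c]]) simp
  then show ?thesis by simp
qed

text \<open>Bilinearity reduces the claim to the difference of \<open>f n\<close> and
  \<open>f'\<close>, which Young's inequality estimates with a free parameter: the part containing g
  is made small by \<delta>, the rest by convergence.\<close>

lemma forms_integral_tendsto:
  assumes f: "\<And>n. f n \<in> L2 S" "f' \<in> L2 S" and g: "g \<in> L2 S"
    and lim: "(\<lambda>n. \<integral>t. (norm (f n t - f' t))\<^sup>2 \<partial>Leb S) \<longlonglongrightarrow> 0"
  shows "(\<lambda>n. \<integral>t. c t (f n t) (g t) \<partial>Leb S) \<longlonglongrightarrow> (\<integral>t. c t (f' t) (g t) \<partial>Leb S)"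
proof -
  let ?d = "\<lambda>n. \<integral>t. (norm (f n t - f' t))\<^sup>2 \<partial>Leb S"
  define G where "G = (\<integral>t. (norm (g t))\<^sup>2 \<partial>Leb S)"
  have C: "C \<ge> 0" by (rule bounded_forms_nonneg[OF measurable_forms_bounded[OF c]])
  have G: "G \<ge> 0" by (simp add: G_def)
  have est: "\<bar>(\<integral>t. c t (f n t) (g t) \<partial>Leb S) - (\<integral>t. c t (f' t) (g t) \<partial>Leb S)\<bar>
      \<le> C * (\<delta> * G + ?d n / (4 * \<delta>))" if \<delta>: "\<delta> > 0" for n \<delta>
  proof -
    have d: "(\<lambda>t. f n t - f' t) \<in> L2 S" by (rule L2_diff[OF f])
    have "(\<integral>t. c t (f n t) (g t) \<partial>Leb S) = (\<integral>t. c t (f n t - f' t) (g t) \<partial>Leb S) + (\<integral>t. c t (f' t) (g t) \<partial>Leb S)"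
      using forms_integral_add[OF d f(2) g] by simp
    then have "\<bar>(\<integral>t. c t (f n t) (g t) \<partial>Leb S) - (\<integral>t. c t (f' t) (g t) \<partial>Leb S)\<bar>
      \<le> C * (\<integral>t. norm (f n t - f' t) * norm (g t) \<partial>Leb S)"
      using forms_integral_le[OF d g] by simp
    also have "(\<integral>t. norm (f n t - f' t) * norm (g t) \<partial>Leb S)
        \<le> (\<integral>t. \<delta> * (norm (g t))\<^sup>2 + (norm (f n t - f' t))\<^sup>2 / (4 * \<delta>) \<partial>Leb S)"
    proof (rule integral_mono[OF L2_norm_mult[OF d g]])
      show "norm (f n t - f' t) * norm (g t) \<le> \<delta> * (norm (g t))\<^sup>2 + (norm (f n t - f' t))\<^sup>2 / (4 * \<delta>)" for t
        using young_mult[OF \<delta>, of "norm (g t)" "norm (f n t - f' t)"] by (simp only: mult.commute)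
    qed (use L2_sq[OF d] L2_sq[OF g] in simp)
    also have "\<dots> = \<delta> * G + ?d n / (4 * \<delta>)"
      using L2_sq[OF d] L2_sq[OF g] by (simp add: G_def)
    finally show ?thesis using C by (simp add: mult_left_mono)
  qed
  show ?thesis
  proof (rule LIMSEQ_I)
    fix e :: real assume e: "e > 0"
    \<comment> \<open>The increments by 1 prevent division by zero; with this \<delta> the part
      containing g is at most e / 4.\<close>
    define \<delta> where "\<delta> = e / (4 * (C + 1) * (G + 1))"
    have \<delta>: "\<delta> > 0" using e C G unfolding \<delta>_def by (intro divide_pos_pos mult_pos_pos) auto
    have "C * (\<delta> * G) \<le> (C + 1) * (\<delta> * (G + 1))"
      using C G \<delta> by (intro mult_mono) auto
    also have "\<dots> = e / 4"
    proof -
      have "p * (e / (4 * p * q) * q) = e / 4" if "p > 0" "q > 0" for p q :: real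
        using that by (simp add: field_simps)
      from this[of "C + 1" "G + 1"] show ?thesis using C G by (simp add: \<delta>_def)
    qed
    finally have 1: "C * (\<delta> * G) \<le> e / 4" .
    have "(\<lambda>n. C * (?d n / (4 * \<delta>))) \<longlonglongrightarrow> C * (0 / (4 * \<delta>))"
      by (intro tendsto_intros lim) (use \<delta> in simp)
    then have "eventually (\<lambda>n. C * (?d n / (4 * \<delta>)) < e / 4) sequentially"
      by (rule order_tendstoD(2)) (use e in simp)
    then obtain n0 where n0: "\<And>n. n \<ge> n0 \<Longrightarrow> C * (?d n / (4 * \<delta>)) < e / 4"
      unfolding eventually_sequentially by blast
    have "norm ((\<integral>t. c t (f n t) (g t) \<partial>Leb S) - (\<integral>t. c t (f' t) (g t) \<partial>Leb S)) < e" if "n \<ge> n0" for n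
      using est[OF \<delta>, of n] n0[OF that] 1 e unfolding distrib_left real_norm_def by linarith
    then show "\<exists>no. \<forall>n\<ge>no. norm ((\<integral>t. c t (f n t) (g t) \<partial>Leb S) - (\<integral>t. c t (f' t) (g t) \<partial>Leb S)) < e"
      by blast
  qed
qed

lemma forms_weighted:
  assumes "\<And>t. t \<in> {0..S} \<Longrightarrow> \<bar>e t\<bar> \<le> 1" "e \<in> borel_measurable (Leb S)"
  shows "measurable_forms S C (\<lambda>t x y. e t * c t x y)"
  unfolding measurable_forms_def bounded_forms_def
proof (intro conjI ballI allI)
  note cb = measurable_forms_bounded[OF c]
  show "C \<ge> 0" by (rule bounded_forms_nonneg[OF cb])
  show "(\<lambda>t. e t * c t x y) \<in> borel_measurable (Leb S)" for x y
    using c assms(2) unfolding measurable_forms_def by (intro borel_measurable_times) blast+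
  fix t assume t: "t \<in> {0..S}"
  show "bounded_bilinear (\<lambda>x y. e t * c t x y)"
    by (rule bounded_linear_bounded_bilinear[OF bounded_linear_mult_right bounded_forms_bilinear[OF cb t]])
  show "\<bar>e t * c t x y\<bar> \<le> C * norm x * norm y" for x y
  proof -
    have "\<bar>e t * c t x y\<bar> = \<bar>e t\<bar> * \<bar>c t x y\<bar>" by (rule abs_mult)
    also have "\<dots> \<le> 1 * (C * norm x * norm y)"
      by (intro mult_mono assms t bounded_forms_le[OF cb]) auto
    finally show ?thesis by simp
  qed
qed

end

text \<open>Gaussian elimination by induction on the size: eliminating the last unknown leaves the
  Schur complement, which inherits positivity. Symmetry is not assumed, because the Galerkin matrix
  of \<open>E\<close> has none.\<close>

lemma positive_definite_solvable:
  fixes A :: "nat \<Rightarrow> nat \<Rightarrow> real"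
  assumes "\<And>c. \<exists>k<m. c k \<noteq> 0 \<Longrightarrow> (\<Sum>k<m. \<Sum>l<m. c k * c l * A k l) > 0"
  shows "\<exists>c. \<forall>l<m. (\<Sum>k<m. c k * A k l) = L l"
  using assms
proof (induction m arbitrary: A L)
  case (Suc m)
  define p where "p = A m m"
  have p: "p > 0"
    using Suc.prems[of "\<lambda>k. if k = m then 1 else 0"] by (simp add: p_def)
  \<comment> \<open>\<open>A'\<close> and \<open>L'\<close> are what remains of the matrix and the
    right-hand side once the last equation has been used to eliminate the last unknown.\<close>
  define A' where "A' = (\<lambda>k l. A k l - A k m * A m l / p)"
  define L' where "L' = (\<lambda>l. L l - L m * A m l / p)"
  have "\<exists>c. \<forall>l<m. (\<Sum>k<m. c k * A' k l) = L' l"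
  proof (rule Suc.IH)
    fix c :: "nat \<Rightarrow> real" assume nz: "\<exists>k<m. c k \<noteq> 0"
    define x where "x = (\<Sum>k<m. c k * A k m)"
    define y where "y = (\<Sum>l<m. c l * A m l)"
    \<comment> \<open>The last coordinate is chosen such that the terms in the square of x cancel:
      the quadratic form of \<open>A\<close> at the extended vector then equals that of
      \<open>A'\<close> at \<open>c\<close>.\<close>
    define z where "z = - x / p"
    define c' where "c' = c(m := z)"
    have nz': "\<exists>k<Suc m. c' k \<noteq> 0" using nz by (auto simp: c'_def)
    have "(\<Sum>k<m. \<Sum>l<m. c k * c l * A' k l) = (\<Sum>k<m. \<Sum>l<m. c k * c l * A k l - (c k * A k m) * (c l * A m l) / p)"
      by (intro sum.cong refl) (simp add: A'_def algebra_simps)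
    also have "\<dots> = (\<Sum>k<m. \<Sum>l<m. c k * c l * A k l) - x * y / p"
      by (simp add: sum_subtractf x_def y_def sum_product sum_divide_distrib)
    finally have 1: "(\<Sum>k<m. \<Sum>l<m. c k * c l * A' k l) = (\<Sum>k<m. \<Sum>l<m. c k * c l * A k l) - x * y / p" .
    have "(\<Sum>k<Suc m. \<Sum>l<Suc m. c' k * c' l * A k l) =
      (\<Sum>k<m. \<Sum>l<m. c k * c l * A k l) + (\<Sum>k<m. c k * z * A k m) + (\<Sum>l<m. z * c l * A m l) + z * z * p"
      by (simp add: c'_def p_def sum.distrib)
    also have "(\<Sum>k<m. c k * z * A k m) = z * x"
      by (simp add: x_def sum_distrib_left mult_ac)
    also have "(\<Sum>l<m. z * c l * A m l) = z * y"
      by (simp add: y_def sum_distrib_left mult_ac)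
    also have "(\<Sum>k<m. \<Sum>l<m. c k * c l * A k l) + z * x + z * y + z * z * p =
       (\<Sum>k<m. \<Sum>l<m. c k * c l * A k l) - x * y / p"
      using p by (simp add: z_def field_simps)
    finally show "(\<Sum>k<m. \<Sum>l<m. c k * c l * A' k l) > 0" using Suc.prems[OF nz'] 1 by simp
  qed
  then obtain c where c: "\<And>l. l < m \<Longrightarrow> (\<Sum>k<m. c k * A' k l) = L' l" by blast
  define x where "x = (\<Sum>k<m. c k * A k m)"
  \<comment> \<open>Back substitution: the last equation determines the last unknown.\<close>
  define c' where "c' = c(m := (L m - x) / p)"
  have "(\<Sum>k<Suc m. c' k * A k l) = L l" if "l < Suc m" for l
  proof -
    have s: "(\<Sum>k<Suc m. c' k * A k l) = (\<Sum>k<m. c k * A k l) + (L m - x) / p * A m l"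
      by (simp add: c'_def)
    show ?thesis
    proof (cases "l = m")
      case True
      then show ?thesis using s p by (simp add: x_def p_def)
    next
      case False
      then have l: "l < m" using that by simp
      have "(\<Sum>k<m. c k * A' k l) = (\<Sum>k<m. c k * A k l - c k * A k m * (A m l / p))"
        by (intro sum.cong refl) (simp add: A'_def algebra_simps)
      also have "\<dots> = (\<Sum>k<m. c k * A k l) - x * (A m l / p)"
        by (simp only: sum_subtractf x_def sum_distrib_right)
      finally have "(\<Sum>k<Suc m. c' k * A k l) = L' l + x * (A m l / p) + (L m - x) / p * A m l"
        using s c[OF l] by linarith
      also have "\<dots> = L l" by (simp add: L'_def diff_divide_distrib algebra_simps)
      finally show ?thesis .
    qed
  qed
  then show ?case by blast
qed simp

text \<open>
  The substitute for weak compactness: \<open>N\<close> plays the role of a squared norm, \<open>D\<close> of the squared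
  distance and \<open>mid\<close> of the midpoint, and \<open>W n\<close> nearly minimises \<open>N\<close> over \<open>F n\<close>.
\<close>

lemma nested_midpoint_Cauchy:
  fixes N :: "'e \<Rightarrow> real"
  assumes F: "\<And>n. F n \<noteq> {}" "decseq F"
    and mid: "\<And>n x y. x \<in> F n \<Longrightarrow> y \<in> F n \<Longrightarrow> mid x y \<in> F n"
    and par: "\<And>x y. x \<in> F 0 \<Longrightarrow> y \<in> F 0 \<Longrightarrow> D x y = 2 * N x + 2 * N y - 4 * N (mid x y)"
    and N: "\<And>x. 0 \<le> N x" "\<And>x. x \<in> F 0 \<Longrightarrow> N x \<le> K"
  obtains W where "\<And>n. W n \<in> F n" "\<And>e. e > 0 \<Longrightarrow> \<exists>n0. \<forall>m\<ge>n0. \<forall>n\<ge>n0. D (W m) (W n) < e"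
proof -
  define d where "d = (\<lambda>n. Inf (N ` F n))"
  have bdd: "bdd_below (N ` F n)" for n using N(1) by (auto intro: bdd_belowI[of _ 0])
  have sub: "F n \<subseteq> F m" if "m \<le> n" for m n using F(2) that by (rule decseqD)
  have le: "d n \<le> N x" if "x \<in> F n" for x n
    unfolding d_def by (rule cInf_lower[OF imageI[OF that] bdd])
  have inc: "incseq d"
    unfolding incseq_def d_def
  proof (intro allI impI cInf_superset_mono bdd image_mono sub)
    show "N ` F n \<noteq> {}" for n using F(1) by simp
  qed
  have dK: "d n \<le> K" for n
  proof -
    obtain x where x: "x \<in> F n" using F(1)[of n] by blast
    then have "x \<in> F 0" using sub[of 0 n] by auto
    then show ?thesis using le[OF x] N(2)[of x] by linarith
  qed
  from dK have "\<forall>i. d i \<le> K" by simp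
  from incseq_convergent[OF inc this] obtain l where l: "d \<longlonglongrightarrow> l" and dl: "\<forall>i. d i \<le> l" .
  have "\<exists>x. x \<in> F n \<and> N x < d n + 1 / Suc n" for n
  proof -
    have "Inf (N ` F n) < d n + 1 / Suc n" by (simp add: d_def)
    then obtain y where "y \<in> N ` F n" "y < d n + 1 / Suc n"
      using F(1)[of n] bdd cInf_less_iff[of "N ` F n"] by blast
    then show ?thesis by blast
  qed
  then obtain W where W: "\<And>n. W n \<in> F n" "\<And>n. N (W n) < d n + 1 / Suc n" by metis
  show thesis
  proof (rule that[OF W(1)])
    fix e :: real assume e: "e > 0"
    have "(\<lambda>n. 4 * (l - d n) + 4 * (1 / Suc n)) \<longlonglongrightarrow> 4 * (l - l) + 4 * 0"
      by (intro tendsto_intros l LIMSEQ_Suc[OF lim_1_over_n])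
    then have "eventually (\<lambda>n. 4 * (l - d n) + 4 * (1 / Suc n) < e) sequentially"
      by (rule order_tendstoD(2)) (use e in simp)
    \<comment> \<open>The midpoint of two late members still lies in \<open>F n0\<close>, so its
      value is at least \<open>d n0\<close>, while the values of the two members are at most l + 1 /
      Suc n0. The parallelogram law bounds their distance by exactly this expression.\<close>
    then obtain n0 where n0: "4 * (l - d n0) + 4 * (1 / Suc n0) < e"
      unfolding eventually_sequentially by blast
    have "D (W m) (W n) < e" if "m \<ge> n0" "n \<ge> n0" for m n
    proof -
      have W0: "W m \<in> F n0" "W n \<in> F n0" using W(1) sub that by blast+
      then have "W m \<in> F 0" "W n \<in> F 0" using sub[of 0 n0] by auto
      note D = par[OF this]
      have "d n0 \<le> N (mid (W m) (W n))" by (rule le[OF mid[OF W0]])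
      moreover have "N (W m) \<le> l + 1 / Suc n0" "N (W n) \<le> l + 1 / Suc n0"
      proof -
        have "N (W k) \<le> l + 1 / Suc n0" if "k \<ge> n0" for k
        proof -
          have "1 / real (Suc k) \<le> 1 / real (Suc n0)" using that by (intro divide_left_mono) auto
          then show ?thesis using W(2)[of k] dl[rule_format, of k] by linarith
        qed
        then show "N (W m) \<le> l + 1 / Suc n0" "N (W n) \<le> l + 1 / Suc n0" using that by auto
      qed
      moreover have "u < e" if "a \<le> z" "x \<le> l + q" "y \<le> l + q" "u = 2 * x + 2 * y - 4 * z" "4 * (l - a) + 4 * q < e"
        for u x y z a q :: real
        using that by argo
      ultimately show ?thesis using D n0 by blast
    qed
    then show "\<exists>n0. \<forall>m\<ge>n0. \<forall>n\<ge>n0. D (W m) (W n) < e" by blast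
  qed
qed

text \<open>On each of N + 1 cells of equal length the error is K times the length times the
  increment of m. These increments telescope, so the total error carries one factor of the cell
  length and vanishes under refinement.\<close>

lemma mesh_estimate:
  fixes H h m :: "real \<Rightarrow> real"
  assumes S: "0 \<le> S"
    and est: "\<And>s t. 0 \<le> s \<Longrightarrow> s \<le> t \<Longrightarrow> t \<le> S \<Longrightarrow> \<bar>H t - H s\<bar> \<le> (h t - h s) + K * (t - s) * (m t - m s)"
  shows "\<bar>H S - H 0\<bar> \<le> h S - h 0"
proof -
  have *: "\<bar>H S - H 0\<bar> \<le> (h S - h 0) + (K * S * (m S - m 0)) * (1 / Suc N)" for N
  proof -
    define d where "d = S / Suc N"
    have d: "0 \<le> d" "Suc N * d = S" using S by (auto simp: d_def)
    have "\<bar>H (k * d) - H 0\<bar> \<le> (h (k * d) - h 0) + K * d * (m (k * d) - m 0)" if "k \<le> Suc N" for k :: nat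
      using that
    proof (induction k)
      case (Suc k)
      have "Suc k * d \<le> Suc N * d" using Suc.prems d(1) by (intro mult_right_mono) auto
      then have le: "Suc k * d \<le> S" using d(2) by simp
      have diff: "Suc k * d - k * d = d" by (simp add: algebra_simps)
      have "\<bar>H (Suc k * d) - H (k * d)\<bar> \<le> (h (Suc k * d) - h (k * d)) + K * d * (m (Suc k * d) - m (k * d))"
        using est[of "k * d" "Suc k * d"] le d(1) diff by (simp add: mult_right_mono)
      moreover have "K * d * (m (Suc k * d) - m 0) = K * d * (m (Suc k * d) - m (k * d)) + K * d * (m (k * d) - m 0)"
        by (simp only: distrib_left[symmetric]) simp
      ultimately show ?case using Suc by linarith
    qed simp
    from this[of "Suc N"] have "\<bar>H S - H 0\<bar> \<le> (h S - h 0) + K * d * (m S - m 0)" unfolding d(2) by simp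
    then show ?thesis by (simp add: d_def mult_ac)
  qed
  have "(\<lambda>N. (h S - h 0) + (K * S * (m S - m 0)) * (1 / Suc N)) \<longlonglongrightarrow> (h S - h 0) + (K * S * (m S - m 0)) * 0"
    by (intro tendsto_intros LIMSEQ_Suc[OF lim_1_over_n])
  from LIMSEQ_le_const[OF this] * show ?thesis by auto
qed

lemma integral_Leb_diff_le:
  fixes f :: "real \<Rightarrow> 'x::{banach, second_countable_topology}"
  assumes f: "integrable (Leb S) f" and g: "integrable (Leb S) g"
    and st: "s \<le> t" "t \<le> S" and le: "\<And>r. r \<in> {0<..<S} \<Longrightarrow> s \<le> r \<Longrightarrow> r < t \<Longrightarrow> norm (f r) \<le> g r"
  shows "norm (integral\<^sup>L (Leb t) f - integral\<^sup>L (Leb s) f) \<le> integral\<^sup>L (Leb t) g - integral\<^sup>L (Leb s) g"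
proof -
  have sS: "s \<le> S" using st by simp
  have i: "integrable (Leb S) (\<lambda>r. indicator {..<a} r *\<^sub>R f r)" "integrable (Leb S) (\<lambda>r. indicator {..<a} r *\<^sub>R g r)" for a
    by (intro integrable_indicator_Leb f g; simp)+
  have "norm (\<integral>r. indicator {..<t} r *\<^sub>R f r - indicator {..<s} r *\<^sub>R f r \<partial>Leb S)
      \<le> (\<integral>r. norm (indicator {..<t} r *\<^sub>R f r - indicator {..<s} r *\<^sub>R f r) \<partial>Leb S)"
    by (rule integral_norm_bound)
  also have "\<dots> \<le> (\<integral>r. indicator {..<t} r *\<^sub>R g r - indicator {..<s} r *\<^sub>R g r \<partial>Leb S)"
  proof (rule integral_mono)
    show "norm (indicator {..<t} r *\<^sub>R f r - indicator {..<s} r *\<^sub>R f r) \<le> indicator {..<t} r *\<^sub>R g r - indicator {..<s} r *\<^sub>R g r"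
      if "r \<in> space (Leb S)" for r
      using le[of r] that st by (auto simp: indicator_def)
  qed (intro integrable_norm Bochner_Integration.integrable_diff i)+
  finally show ?thesis
    unfolding integral_Leb_sub[OF st(2)] integral_Leb_sub[OF sS]
    by (simp only: Bochner_Integration.integral_diff[OF i(1) i(1)] Bochner_Integration.integral_diff[OF i(2) i(2)])
qed

lemma integral_Leb_const: "0 \<le> t \<Longrightarrow> integral\<^sup>L (Leb t) (\<lambda>s. c :: real) = t * c"
  by (simp add: measure_restrict_space)

text \<open>
  The product rule with the time derivative of the form, which need not exist, replaced by its bound
  \<open>D\<close>: on each cell of a mesh the form is frozen at the left end point.
\<close>

lemma lipschitz_forms_by_parts:
  fixes c :: "real \<Rightarrow> 'a::{banach, second_countable_topology} \<Rightarrow> 'b::{banach, second_countable_topology} \<Rightarrow> real"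
  assumes c: "lipschitz_forms S C D c" and D: "0 \<le> D" and S: "0 \<le> S"
    and x: "primitive_on S x x'" "x' \<in> L2 S" and y: "primitive_on S y y'" "y' \<in> L2 S"
  shows "\<bar>c S (x S) (y S) - c 0 (x 0) (y 0) - (\<integral>t. c t (x' t) (y t) + c t (x t) (y' t) \<partial>Leb S)\<bar>
    \<le> D * (\<integral>t. norm (x t) * norm (y t) \<partial>Leb S)"
proof -
  note cb = lipschitz_forms_bounded[OF c] and cm = lipschitz_forms_measurable[OF c]
  have lip: "\<bar>c t a b - c s a b\<bar> \<le> D * \<bar>t - s\<bar> * norm a * norm b" if "s \<in> {0..S}" "t \<in> {0..S}" for s t a b
    using c that unfolding lipschitz_forms_def by blast
  have xc: "continuous_on {0..S} x" and yc: "continuous_on {0..S} y"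
    using x y by (auto intro: continuous_on_primitive)
  have x2: "x \<in> L2 S" and y2: "y \<in> L2 S" by (intro continuous_on_L2 xc yc)+
  obtain B1 where B1: "\<And>t. t \<in> {0..S} \<Longrightarrow> norm (x t) \<le> B1" using continuous_on_Icc_bounded[OF xc] by blast
  obtain B2 where B2: "\<And>t. t \<in> {0..S} \<Longrightarrow> norm (y t) \<le> B2" using continuous_on_Icc_bounded[OF yc] by blast
  define B where "B = max B1 B2"
  have B: "norm (x t) \<le> B" "norm (y t) \<le> B" if "t \<in> {0..S}" for t
    using B1[OF that] B2[OF that] by (auto simp: B_def)
  have B0: "0 \<le> B" using B(1)[of 0] S norm_ge_zero[of "x 0"] by (meson atLeastAtMost_iff order.trans order_refl)
  \<comment> \<open>\<open>\<kappa>\<close> is the derivative that the product rule predicts when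
    the time dependence of c is ignored, \<open>\<eta>\<close> is the density of the allowed error
    up to the factor D, and \<open>\<mu>\<close> dominates the variation of x and y.\<close>
  define \<kappa> where "\<kappa> = (\<lambda>t. c t (x' t) (y t) + c t (x t) (y' t))"
  define \<eta> where "\<eta> = (\<lambda>t. norm (x t) * norm (y t))"
  define \<mu> where "\<mu> = (\<lambda>t. norm (x' t) + norm (y' t))"
  have \<kappa>: "integrable (Leb S) \<kappa>"
    unfolding \<kappa>_def by (intro Bochner_Integration.integrable_add forms_integrable[OF cm] x y x2 y2)
  have \<eta>: "integrable (Leb S) \<eta>" unfolding \<eta>_def by (rule L2_norm_mult[OF x2 y2])
  have x'i: "integrable (Leb S) x'" and y'i: "integrable (Leb S) y'" by (intro L2_integrable x y)+
  then have \<mu>: "integrable (Leb S) \<mu>"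
    unfolding \<mu>_def by (intro Bochner_Integration.integrable_add integrable_norm)
  \<comment> \<open>\<open>H\<close> is, up to a constant, the defect of that product rule at time
    t. Its increment over [0,S] has to be bounded by that of \<open>h\<close>;
    \<open>mesh_estimate\<close> derives this from short intervals, on which an error of second
    order is tolerated.\<close>
  define H where "H = (\<lambda>t. c t (x t) (y t) - integral\<^sup>L (Leb t) \<kappa>)"
  define h where "h = (\<lambda>t. D * integral\<^sup>L (Leb t) \<eta>)"
  define m where "m = (\<lambda>t. integral\<^sup>L (Leb t) \<mu>)"
  have m_diff: "norm (x t - x s) + norm (y t - y s) \<le> m t - m s" if "0 \<le> s" "s \<le> t" "t \<le> S" for s t
  proof -
    have s: "s \<in> {0..S}" and t: "t \<in> {0..S}" and le: "s \<le> S" using that by auto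
    have "norm (x t - x s) \<le> integral\<^sup>L (Leb t) (\<lambda>t. norm (x' t)) - integral\<^sup>L (Leb s) (\<lambda>t. norm (x' t))"
      using integral_Leb_diff_le[OF x'i integrable_norm[OF x'i] that(2,3)]
      by (subst primitive_on_eq[OF x(1) t], subst primitive_on_eq[OF x(1) s]) simp
    moreover have "norm (y t - y s) \<le> integral\<^sup>L (Leb t) (\<lambda>t. norm (y' t)) - integral\<^sup>L (Leb s) (\<lambda>t. norm (y' t))"
      using integral_Leb_diff_le[OF y'i integrable_norm[OF y'i] that(2,3)]
      by (subst primitive_on_eq[OF y(1) t], subst primitive_on_eq[OF y(1) s]) simp
    moreover have "m r = integral\<^sup>L (Leb r) (\<lambda>t. norm (x' t)) + integral\<^sup>L (Leb r) (\<lambda>t. norm (y' t))" if "r \<le> S" for r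
      unfolding m_def \<mu>_def
      using Bochner_Integration.integral_add[OF integrable_norm[OF integrable_Leb_mono[OF x'i that]]
          integrable_norm[OF integrable_Leb_mono[OF y'i that]]] .
    ultimately show ?thesis using that(3) le by simp
  qed
  have "\<bar>H S - H 0\<bar> \<le> h S - h 0"
  proof (rule mesh_estimate[OF S, where m=m])
    fix s t assume st: "0 \<le> s" "s \<le> t" "t \<le> S"
    then have s: "s \<in> {0..S}" and t: "t \<in> {0..S}" and le: "s \<le> S" by auto
    define \<kappa>s where "\<kappa>s = (\<lambda>r. c s (x' r) (y r) + c s (x r) (y' r))"
    have prim: "primitive_on S (\<lambda>t. c s (x t) (y t)) \<kappa>s"
      unfolding \<kappa>s_def by (rule primitive_on_bilinear(3)[OF bounded_forms_bilinear[OF cb s] x(1) y(1)])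
    note \<kappa>s = primitive_on_integrable[OF prim]
    have 1: "c s (x t) (y t) - c s (x s) (y s) = integral\<^sup>L (Leb t) \<kappa>s - integral\<^sup>L (Leb s) \<kappa>s"
      by (subst primitive_on_eq[OF prim t], subst primitive_on_eq[OF prim s]) simp
    have "norm (integral\<^sup>L (Leb t) (\<lambda>r. \<kappa>s r - \<kappa> r) - integral\<^sup>L (Leb s) (\<lambda>r. \<kappa>s r - \<kappa> r))
      \<le> integral\<^sup>L (Leb t) (\<lambda>r. (D * (t - s) * B) * \<mu> r) - integral\<^sup>L (Leb s) (\<lambda>r. (D * (t - s) * B) * \<mu> r)"
    proof (rule integral_Leb_diff_le[OF _ _ st(2,3)])
      show "integrable (Leb S) (\<lambda>r. \<kappa>s r - \<kappa> r)" by (rule Bochner_Integration.integrable_diff[OF \<kappa>s \<kappa>])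
      show "integrable (Leb S) (\<lambda>r. (D * (t - s) * B) * \<mu> r)" using \<mu> by simp
      fix r assume r: "r \<in> {0<..<S}" "s \<le> r" "r < t"
      then have rS: "r \<in> {0..S}" by simp
      have p: "D * \<bar>s - r\<bar> * a * b \<le> D * (t - s) * (a * b)" if "0 \<le> a" "0 \<le> b" for a b
        using that r D unfolding mult.assoc by (intro mult_left_mono mult_right_mono mult_nonneg_nonneg) auto
      have "norm (\<kappa>s r - \<kappa> r) \<le> \<bar>c s (x' r) (y r) - c r (x' r) (y r)\<bar> + \<bar>c s (x r) (y' r) - c r (x r) (y' r)\<bar>"
        unfolding \<kappa>_def \<kappa>s_def by simp
      also have "\<dots> \<le> D * (t - s) * (norm (x' r) * norm (y r)) + D * (t - s) * (norm (x r) * norm (y' r))"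
        by (intro add_mono order_trans[OF lip[OF rS s] p]) auto
      also have "\<dots> \<le> D * (t - s) * (norm (x' r) * B) + D * (t - s) * (B * norm (y' r))"
        using D st B0 by (intro add_mono mult_left_mono mult_right_mono B rS mult_nonneg_nonneg) auto
      also have "\<dots> = (D * (t - s) * B) * \<mu> r" by (simp add: \<mu>_def algebra_simps)
      finally show "norm (\<kappa>s r - \<kappa> r) \<le> (D * (t - s) * B) * \<mu> r" .
    qed
    then have 2: "\<bar>(integral\<^sup>L (Leb t) \<kappa>s - integral\<^sup>L (Leb t) \<kappa>) - (integral\<^sup>L (Leb s) \<kappa>s - integral\<^sup>L (Leb s) \<kappa>)\<bar>
        \<le> D * (t - s) * B * (m t - m s)"
      using Bochner_Integration.integral_diff[OF integrable_Leb_mono[OF \<kappa>s st(3)] integrable_Leb_mono[OF \<kappa> st(3)]]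
        Bochner_Integration.integral_diff[OF integrable_Leb_mono[OF \<kappa>s le] integrable_Leb_mono[OF \<kappa> le]]
      by (simp add: m_def right_diff_distrib)
    \<comment> \<open>The freezing error contains \<eta> only at the right end of the cell. It is
      compared with the integral of \<eta>, since \<eta> varies on the cell by at most B times the
      increment of m.\<close>
    have "norm (integral\<^sup>L (Leb t) (\<lambda>r. \<eta> t - \<eta> r) - integral\<^sup>L (Leb s) (\<lambda>r. \<eta> t - \<eta> r))
      \<le> integral\<^sup>L (Leb t) (\<lambda>r. B * (m t - m s)) - integral\<^sup>L (Leb s) (\<lambda>r. B * (m t - m s))"
    proof (rule integral_Leb_diff_le[OF _ _ st(2,3)])
      show "integrable (Leb S) (\<lambda>r. \<eta> t - \<eta> r)" using \<eta> by simp
      fix r assume r: "r \<in> {0<..<S}" "s \<le> r" "r < t"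
      then have rS: "r \<in> {0..S}" by simp
      have "\<eta> t - \<eta> r = (norm (x t) - norm (x r)) * norm (y t) + norm (x r) * (norm (y t) - norm (y r))"
        by (simp add: \<eta>_def algebra_simps)
      then have "norm (\<eta> t - \<eta> r) \<le> \<bar>norm (x t) - norm (x r)\<bar> * norm (y t) + norm (x r) * \<bar>norm (y t) - norm (y r)\<bar>"
        using abs_triangle_ineq[of "(norm (x t) - norm (x r)) * norm (y t)" "norm (x r) * (norm (y t) - norm (y r))"]
        by (simp add: abs_mult)
      also have "\<dots> \<le> norm (x t - x r) * B + B * norm (y t - y r)"
        using B0 by (intro add_mono mult_mono norm_triangle_ineq3 B rS t) auto
      also have "\<dots> = B * (norm (x t - x r) + norm (y t - y r))" by (simp add: algebra_simps)
      also have "\<dots> \<le> B * (m t - m r)" using r st by (intro mult_left_mono m_diff B0) auto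
      also have "\<dots> \<le> B * (m t - m s)"
      proof -
        have "0 \<le> m r - m s" using r st by (intro order_trans[OF _ m_diff]) auto
        then show ?thesis using B0 by (intro mult_left_mono) auto
      qed
      finally show "norm (\<eta> t - \<eta> r) \<le> B * (m t - m s)" .
    qed simp
    moreover have "integral\<^sup>L (Leb r) (\<lambda>q. \<eta> t - \<eta> q) = r * \<eta> t - integral\<^sup>L (Leb r) \<eta>" if "0 \<le> r" "r \<le> S" for r
      using Bochner_Integration.integral_diff[OF integrable_Leb_const integrable_Leb_mono[OF \<eta> that(2)], of "\<eta> t"]
      by (simp only: integral_Leb_const[OF that(1)])
    ultimately have "\<bar>(t * \<eta> t - integral\<^sup>L (Leb t) \<eta>) - (s * \<eta> t - integral\<^sup>L (Leb s) \<eta>)\<bar>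
        \<le> t * (B * (m t - m s)) - s * (B * (m t - m s))"
      using st le by (simp only: integral_Leb_const order_trans[OF st(1,2)] real_norm_def)
    then have "(t - s) * \<eta> t \<le> (integral\<^sup>L (Leb t) \<eta> - integral\<^sup>L (Leb s) \<eta>) + B * (t - s) * (m t - m s)"
      by (simp add: algebra_simps abs_le_iff)
    from mult_left_mono[OF this D]
    have 3: "D * ((t - s) * \<eta> t) \<le> (h t - h s) + D * (t - s) * B * (m t - m s)"
      by (simp add: h_def algebra_simps)
    have 4: "\<bar>c t (x t) (y t) - c s (x t) (y t)\<bar> \<le> D * ((t - s) * \<eta> t)"
      using lip[OF s t, of "x t" "y t"] st by (simp add: \<eta>_def mult.assoc)
    have "H t - H s = (c t (x t) (y t) - c s (x t) (y t)) +
      ((integral\<^sup>L (Leb t) \<kappa>s - integral\<^sup>L (Leb t) \<kappa>) - (integral\<^sup>L (Leb s) \<kappa>s - integral\<^sup>L (Leb s) \<kappa>))"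
      unfolding H_def using 1 by simp
    then show "\<bar>H t - H s\<bar> \<le> (h t - h s) + (2 * D * B) * (t - s) * (m t - m s)"
      using 2 3 4 by (simp add: algebra_simps)
  qed
  then show ?thesis by (simp add: H_def h_def \<kappa>_def \<eta>_def)
qed

section \<open>Exponentially weighted integrals\<close>

definition wform :: "real \<Rightarrow> real \<Rightarrow> (real \<Rightarrow> 'a \<Rightarrow> 'b \<Rightarrow> real) \<Rightarrow> (real \<Rightarrow> 'a) \<Rightarrow> (real \<Rightarrow> 'b) \<Rightarrow> real" where
  "wform \<rho> S c f g = (\<integral>t. exp (- \<rho> * t) * c t (f t) (g t) \<partial>Leb S)"

definition wsq :: "real \<Rightarrow> real \<Rightarrow> (real \<Rightarrow> 'a::real_normed_vector) \<Rightarrow> real" where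
  "wsq \<rho> S f = (\<integral>t. exp (- \<rho> * t) * (norm (f t))\<^sup>2 \<partial>Leb S)"

definition wprod :: "real \<Rightarrow> real \<Rightarrow> (real \<Rightarrow> 'a::real_normed_vector) \<Rightarrow> (real \<Rightarrow> 'b::real_normed_vector) \<Rightarrow> real" where
  "wprod \<rho> S f g = (\<integral>t. exp (- \<rho> * t) * (norm (f t) * norm (g t)) \<partial>Leb S)"

lemma primitive_on_exp: "primitive_on S (\<lambda>t. exp (- \<rho> * t)) (\<lambda>t. - \<rho> * exp (- \<rho> * t))"
proof (rule primitive_on_deriv)
  show "((\<lambda>t. exp (- \<rho> * t)) has_real_derivative - \<rho> * exp (- \<rho> * t)) (at t)" for t
    by (auto intro!: derivative_eq_intros)
qed (intro continuous_intros)

lemma exp_weight_le: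
  fixes \<rho> t :: real
  shows "0 \<le> \<rho> \<Longrightarrow> 0 \<le> t \<Longrightarrow> exp (- \<rho> * t) \<le> 1"
  by simp

lemma exp_weight_measurable: "(\<lambda>t. exp (- \<rho> * t)) \<in> borel_measurable (Leb S)"
  by (rule borel_measurable_Leb) simp

lemma integrable_exp_weight:
  fixes h :: "real \<Rightarrow> real"
  assumes "integrable (Leb S) h" "0 \<le> \<rho>"
  shows "integrable (Leb S) (\<lambda>t. exp (- \<rho> * t) * h t)"
proof (rule integrable_norm_le[OF integrable_norm[OF assms(1)]])
  show "(\<lambda>t. exp (- \<rho> * t) * h t) \<in> borel_measurable (Leb S)"
    by (intro borel_measurable_times exp_weight_measurable borel_measurable_integrable assms)
  show "norm (exp (- \<rho> * t) * h t) \<le> norm (h t)" if "t \<in> space (Leb S)" for t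
    using exp_weight_le[OF assms(2), of t] that by (simp add: abs_mult mult_left_le_one_le)
qed

lemma weighted_measurable_forms:
  fixes c :: "real \<Rightarrow> 'a::{banach, second_countable_topology} \<Rightarrow> 'b::{banach, second_countable_topology} \<Rightarrow> real"
  assumes "measurable_forms S C c" "0 \<le> \<rho>"
  shows "measurable_forms S C (\<lambda>t x y. exp (- \<rho> * t) * c t x y)"
  by (rule forms_weighted[OF assms(1) _ exp_weight_measurable]) (use exp_weight_le[OF assms(2)] in simp)

lemma wsq_nonneg: "0 \<le> wsq \<rho> S f"
  unfolding wsq_def by (rule Bochner_Integration.integral_nonneg) simp

lemma wprod_nonneg: "0 \<le> wprod \<rho> S f g"
  unfolding wprod_def by (rule Bochner_Integration.integral_nonneg) simp

lemma wprod_self: "wprod \<rho> S f f = wsq \<rho> S f"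
  unfolding wsq_def wprod_def by (simp add: power2_eq_square)

context
  fixes \<rho> S :: real
  assumes \<rho>: "0 \<le> \<rho>"
begin

lemma wsq_integrable: "f \<in> L2 S \<Longrightarrow> integrable (Leb S) (\<lambda>t. exp (- \<rho> * t) * (norm (f t))\<^sup>2)"
  by (intro integrable_exp_weight \<rho> L2_sq)

lemma wprod_integrable: "f \<in> L2 S \<Longrightarrow> g \<in> L2 S \<Longrightarrow> integrable (Leb S) (\<lambda>t. exp (- \<rho> * t) * (norm (f t) * norm (g t)))"
  by (intro integrable_exp_weight \<rho> L2_norm_mult)

lemma wprod_young:
  assumes "f \<in> L2 S" "g \<in> L2 S" "\<delta> > 0"
  shows "wprod \<rho> S f g \<le> \<delta> * wsq \<rho> S f + wsq \<rho> S g / (4 * \<delta>)"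
proof -
  have "wprod \<rho> S f g \<le> (\<integral>t. \<delta> * (exp (- \<rho> * t) * (norm (f t))\<^sup>2) + (exp (- \<rho> * t) * (norm (g t))\<^sup>2) / (4 * \<delta>) \<partial>Leb S)"
    unfolding wprod_def
  proof (rule integral_mono[OF wprod_integrable[OF assms(1,2)]])
    show "integrable (Leb S) (\<lambda>t. \<delta> * (exp (- \<rho> * t) * (norm (f t))\<^sup>2) + (exp (- \<rho> * t) * (norm (g t))\<^sup>2) / (4 * \<delta>))"
      by (intro Bochner_Integration.integrable_add Bochner_Integration.integrable_mult_right
          Bochner_Integration.integrable_divide wsq_integrable assms)
    fix t
    have "exp (- \<rho> * t) * (norm (f t) * norm (g t)) \<le> exp (- \<rho> * t) * (\<delta> * (norm (f t))\<^sup>2 + (norm (g t))\<^sup>2 / (4 * \<delta>))"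
      by (rule mult_left_mono[OF young_mult[OF assms(3)]]) simp
    then show "exp (- \<rho> * t) * (norm (f t) * norm (g t)) \<le> \<delta> * (exp (- \<rho> * t) * (norm (f t))\<^sup>2) + (exp (- \<rho> * t) * (norm (g t))\<^sup>2) / (4 * \<delta>)"
      by (simp add: algebra_simps)
  qed
  also have "\<dots> = \<delta> * wsq \<rho> S f + wsq \<rho> S g / (4 * \<delta>)"
    unfolding wsq_def
    by (simp only: Bochner_Integration.integral_add[OF Bochner_Integration.integrable_mult_right[OF wsq_integrable[OF assms(1)]]
          Bochner_Integration.integrable_divide[OF wsq_integrable[OF assms(2)]]]
        Bochner_Integration.integral_mult_right_zero Bochner_Integration.integral_divide_zero)
  finally show ?thesis .
qed

text \<open>Young's inequality with parameter K / (4 \<epsilon>), arranged so that the second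
  factor, the one to be absorbed, receives exactly the coefficient \<epsilon>. The parameter must be
  positive, hence the separate case K = 0.\<close>

lemma wprod_scaled_young:
  assumes "f \<in> L2 S" "g \<in> L2 S" "\<epsilon> > 0" "0 \<le> K"
  shows "K * wprod \<rho> S f g \<le> \<epsilon> * wsq \<rho> S g + K\<^sup>2 / (4 * \<epsilon>) * wsq \<rho> S f"
proof (cases "K = 0")
  case True
  then show ?thesis using assms(3) wsq_nonneg[of \<rho> S g] by simp
next
  case False
  then have K: "K > 0" using assms by simp
  have "K * wprod \<rho> S f g \<le> K * (K / (4 * \<epsilon>) * wsq \<rho> S f + wsq \<rho> S g / (4 * (K / (4 * \<epsilon>))))"
    by (intro mult_left_mono wprod_young assms) (use K assms in auto)
  also have "\<dots> = \<epsilon> * wsq \<rho> S g + K\<^sup>2 / (4 * \<epsilon>) * wsq \<rho> S f"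
    using K assms by (simp add: field_simps power2_eq_square)
  finally show ?thesis .
qed

text \<open>The comparison function \<open>k\<close> may differ from \<open>g\<close> and take
  values in another space; with k = j o g this expresses that \<open>a2\<close> and
  \<open>b2\<close> are bounded by the H-norm of their second argument.\<close>

lemma wform_bound:
  fixes f :: "real \<Rightarrow> 'a::{banach, second_countable_topology}" and k :: "real \<Rightarrow> 'd::{banach, second_countable_topology}"
  assumes "f \<in> L2 S" "k \<in> L2 S" "0 \<le> C"
    and "\<And>t. t \<in> {0<..<S} \<Longrightarrow> \<bar>c t (f t) (g t)\<bar> \<le> C * norm (f t) * norm (k t)"
  shows "\<bar>wform \<rho> S c f g\<bar> \<le> C * wprod \<rho> S f k"
proof (cases "integrable (Leb S) (\<lambda>t. exp (- \<rho> * t) * c t (f t) (g t))")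
  case True
  have "\<bar>wform \<rho> S c f g\<bar> \<le> (\<integral>t. \<bar>exp (- \<rho> * t) * c t (f t) (g t)\<bar> \<partial>Leb S)"
    unfolding wform_def by (rule integral_abs_bound)
  also have "\<dots> \<le> (\<integral>t. C * (exp (- \<rho> * t) * (norm (f t) * norm (k t))) \<partial>Leb S)"
  proof (rule integral_mono)
    show "integrable (Leb S) (\<lambda>t. \<bar>exp (- \<rho> * t) * c t (f t) (g t)\<bar>)" by (rule integrable_abs[OF True])
    show "integrable (Leb S) (\<lambda>t. C * (exp (- \<rho> * t) * (norm (f t) * norm (k t))))"
      by (intro Bochner_Integration.integrable_mult_right wprod_integrable assms)
    fix t assume "t \<in> space (Leb S)"
    then have "\<bar>c t (f t) (g t)\<bar> \<le> C * norm (f t) * norm (k t)" by (intro assms(4)) simp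
    from mult_left_mono[OF this, of "exp (- \<rho> * t)"]
    show "\<bar>exp (- \<rho> * t) * c t (f t) (g t)\<bar> \<le> C * (exp (- \<rho> * t) * (norm (f t) * norm (k t)))"
      by (simp add: abs_mult mult_ac)
  qed
  also have "\<dots> = C * wprod \<rho> S f k" unfolding wprod_def by (rule Bochner_Integration.integral_mult_right_zero)
  finally show ?thesis .
next
  \<comment> \<open>A non-integrable integrand has integral 0 by convention, and the right-hand side
    is non-negative.\<close>
  case False
  from not_integrable_integral_eq[OF False] show ?thesis
    unfolding wform_def using wprod_nonneg[of \<rho> S f k] assms(3) by simp
qed

lemma wform_le:
  fixes f :: "real \<Rightarrow> 'a::{banach, second_countable_topology}" and g :: "real \<Rightarrow> 'b::{banach, second_countable_topology}"
  assumes "bounded_forms S C c" "f \<in> L2 S" "g \<in> L2 S"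
  shows "\<bar>wform \<rho> S c f g\<bar> \<le> C * wprod \<rho> S f g"
  by (rule wform_bound[OF assms(2,3) bounded_forms_nonneg[OF assms(1)]])
    (rule bounded_forms_le[OF assms(1)], simp)

text \<open>The weight is absorbed into the first function, z = e^(-\<rho> t) x, and the unweighted
  rule is applied to z and y. Differentiating the weight contributes the term with factor \<rho>,
  the source of everything that is gained from large \<rho>.\<close>

lemma wform_parts:
  fixes c :: "real \<Rightarrow> 'a::{banach, second_countable_topology} \<Rightarrow> 'b::{banach, second_countable_topology} \<Rightarrow> real"
  assumes c: "lipschitz_forms S C D c" and D: "0 \<le> D" and S: "0 \<le> S"
    and x: "primitive_on S x x'" "x' \<in> L2 S" and y: "primitive_on S y y'" "y' \<in> L2 S"
  shows "\<bar>exp (- \<rho> * S) * c S (x S) (y S) - c 0 (x 0) (y 0)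
      - (wform \<rho> S c x' y + wform \<rho> S c x y' - \<rho> * wform \<rho> S c x y)\<bar> \<le> D * wprod \<rho> S x y"
proof -
  let ?e = "\<lambda>t. exp (- \<rho> * t)"
  note cb = lipschitz_forms_bounded[OF c]
  note wm = weighted_measurable_forms[OF lipschitz_forms_measurable[OF c] \<rho>]
  have bil: "bounded_bilinear (c t)" if "t \<in> {0..S}" for t by (rule bounded_forms_bilinear[OF cb that])
  have x2: "x \<in> L2 S" and y2: "y \<in> L2 S"
    using x y by (auto intro: continuous_on_L2 continuous_on_primitive)
  define z where "z = (\<lambda>t. ?e t *\<^sub>R x t)"
  define z' where "z' = (\<lambda>t. (- \<rho> * ?e t) *\<^sub>R x t + ?e t *\<^sub>R x' t)"
  have z: "primitive_on S z z'"
    unfolding z_def z'_def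
    by (rule primitive_on_bilinear(3)[OF bounded_bilinear_scaleR primitive_on_exp x(1)])
  have e2: "(\<lambda>t. ?e t *\<^sub>R g t) \<in> L2 S" if "g \<in> L2 S" for g :: "real \<Rightarrow> 'a"
  proof (rule L2_dominated[OF that, where C=1])
    show "(\<lambda>t. ?e t *\<^sub>R g t) \<in> borel_measurable (Leb S)"
      by (intro borel_measurable_scaleR exp_weight_measurable L2_measurable[OF that])
    show "norm (?e t *\<^sub>R g t) \<le> 1 * norm (g t)" if "t \<in> {0<..<S}" for t
      using mult_right_mono[OF exp_weight_le[OF \<rho>, of t], of "norm (g t)"] that by simp
  qed
  have z'_alt: "z' = (\<lambda>t. (- \<rho>) *\<^sub>R (?e t *\<^sub>R x t) + ?e t *\<^sub>R x' t)"
    unfolding z'_def by simp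
  have z2: "z' \<in> L2 S"
    unfolding z'_alt by (intro L2_add L2_scaleR e2 x2 x)
  have "\<bar>c S (z S) (y S) - c 0 (z 0) (y 0) - (\<integral>t. c t (z' t) (y t) + c t (z t) (y' t) \<partial>Leb S)\<bar>
    \<le> D * (\<integral>t. norm (z t) * norm (y t) \<partial>Leb S)"
    by (rule lipschitz_forms_by_parts[OF c D S z z2 y])
  moreover have "(\<integral>t. norm (z t) * norm (y t) \<partial>Leb S) = wprod \<rho> S x y"
    unfolding z_def wprod_def by (simp add: mult.assoc)
  moreover have "c S (z S) (y S) = ?e S * c S (x S) (y S)"
    unfolding z_def using bounded_bilinear.scaleR_left[OF bil[of S]] S by simp
  moreover have "c 0 (z 0) (y 0) = c 0 (x 0) (y 0)"
    unfolding z_def by simp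
  moreover have "(\<integral>t. c t (z' t) (y t) + c t (z t) (y' t) \<partial>Leb S) =
     (\<integral>t. (?e t * c t (x' t) (y t) + ?e t * c t (x t) (y' t)) - \<rho> * (?e t * c t (x t) (y t)) \<partial>Leb S)"
  proof (rule Bochner_Integration.integral_cong[OF refl])
    fix t assume "t \<in> space (Leb S)"
    then have "t \<in> {0..S}" by simp
    then interpret bounded_bilinear "c t" by (rule bil)
    show "c t (z' t) (y t) + c t (z t) (y' t) = (?e t * c t (x' t) (y t) + ?e t * c t (x t) (y' t)) - \<rho> * (?e t * c t (x t) (y t))"
      unfolding z_def z'_def by (simp add: add_left diff_left scaleR_left)
  qed
  moreover have "\<dots> = wform \<rho> S c x' y + wform \<rho> S c x y' - \<rho> * wform \<rho> S c x y"
    unfolding wform_def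
    by (simp only: Bochner_Integration.integral_diff Bochner_Integration.integral_add Bochner_Integration.integral_mult_right_zero
        Bochner_Integration.integrable_add Bochner_Integration.integrable_mult_right
        forms_integrable[OF wm x(2) y2] forms_integrable[OF wm x2 y(2)] forms_integrable[OF wm x2 y2])
  ultimately show ?thesis by simp
qed

end

text \<open>The types carry only a norm, so a real inner product inducing it is supplied as a
  function. It will be the real part of the scalar product of V or H, and it gives the parallelogram
  law.\<close>

definition inner_like :: "('a::real_normed_vector \<Rightarrow> 'a \<Rightarrow> real) \<Rightarrow> bool" where
  "inner_like r \<longleftrightarrow> bounded_bilinear r \<and> (\<forall>x y. r x y = r y x) \<and> (\<forall>x. r x x = (norm x)\<^sup>2) \<and>
     (\<forall>x y. \<bar>r x y\<bar> \<le> norm x * norm y)"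

lemma
  assumes "inner_like r"
  shows inner_like_bilinear: "bounded_bilinear r"
    and inner_like_sym: "r x y = r y x"
    and inner_like_self: "r x x = (norm x)\<^sup>2"
    and inner_like_le: "\<bar>r x y\<bar> \<le> norm x * norm y"
  using assms unfolding inner_like_def by blast+

lemma inner_like_forms:
  fixes r :: "'a::real_normed_vector \<Rightarrow> 'a \<Rightarrow> real"
  assumes "inner_like r"
  shows "lipschitz_forms S 1 0 (\<lambda>t. r)"
  unfolding lipschitz_forms_def bounded_forms_def
  using inner_like_bilinear[OF assms] inner_like_le[OF assms] by simp

lemma inner_like_parallelogram:
  fixes r :: "'a::real_normed_vector \<Rightarrow> 'a \<Rightarrow> real" and x y :: 'a
  assumes "inner_like r"
  shows "(norm (x - y))\<^sup>2 = 2 * (norm x)\<^sup>2 + 2 * (norm y)\<^sup>2 - 4 * (norm ((1/2) *\<^sub>R (x + y)))\<^sup>2"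
proof -
  interpret bounded_bilinear r by (rule inner_like_bilinear[OF assms])
  have "4 * (norm ((1/2) *\<^sub>R (x + y)))\<^sup>2 = (norm (x + y))\<^sup>2"
    by (simp add: power_divide)
  then show ?thesis
    by (simp only: inner_like_self[OF assms, symmetric])
      (simp add: add_left add_right diff_left diff_right inner_like_sym[OF assms, of y x])
qed

lemma wform_cong:
  "(\<And>t. t \<in> {0<..<S} \<Longrightarrow> c t (f t) (g t) = c' t (f' t) (g' t)) \<Longrightarrow> wform \<rho> S c f g = wform \<rho> S c' f' g'"
  unfolding wform_def by (rule Bochner_Integration.integral_cong) auto

text \<open>The product rule for \<open>r u u\<close> equates the end value plus \<rho> times the
  weighted square of u with twice the weighted pairing of u and \<phi>; Young's inequality with
  parameter \<rho> / 4 spends half of the square. A primitive starting at 0 is thus smaller than its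
  derivative by a factor 2 / \<rho> in norm.\<close>

lemma weighted_hardy:
  fixes r :: "'a::{banach, second_countable_topology} \<Rightarrow> 'a \<Rightarrow> real" and u :: "real \<Rightarrow> 'a"
  assumes r: "inner_like r" and S: "0 \<le> S" and \<rho>: "0 < \<rho>"
    and u: "primitive_on S u \<phi>" "u 0 = 0" and \<phi>: "\<phi> \<in> L2 S"
  shows "exp (- \<rho> * S) * (norm (u S))\<^sup>2 + \<rho> / 2 * wsq \<rho> S u \<le> 2 / \<rho> * wsq \<rho> S \<phi>"
proof -
  have \<rho>0: "0 \<le> \<rho>" using \<rho> by simp
  have u2: "u \<in> L2 S" using u by (auto intro: continuous_on_L2 continuous_on_primitive)
  note rf = inner_like_forms[OF r, of S]
  have "\<bar>exp (- \<rho> * S) * r (u S) (u S) - r (u 0) (u 0)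
      - (wform \<rho> S (\<lambda>t. r) \<phi> u + wform \<rho> S (\<lambda>t. r) u \<phi> - \<rho> * wform \<rho> S (\<lambda>t. r) u u)\<bar> \<le> 0 * wprod \<rho> S u u"
    by (rule wform_parts[OF \<rho>0 rf order_refl S u(1) \<phi> u(1) \<phi>])
  then have "exp (- \<rho> * S) * (norm (u S))\<^sup>2 =
      wform \<rho> S (\<lambda>t. r) \<phi> u + wform \<rho> S (\<lambda>t. r) u \<phi> - \<rho> * wform \<rho> S (\<lambda>t. r) u u"
    using u(2) by (simp add: inner_like_self[OF r])
  moreover have "wform \<rho> S (\<lambda>t. r) \<phi> u = wform \<rho> S (\<lambda>t. r) u \<phi>"
    unfolding wform_def by (simp only: inner_like_sym[OF r])
  moreover have "\<rho> * wform \<rho> S (\<lambda>t. r) u u = \<rho> * wsq \<rho> S u"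
    unfolding wform_def wsq_def by (simp only: inner_like_self[OF r])
  moreover have "\<rho> / 4 * wsq \<rho> S u = (\<rho> * wsq \<rho> S u) / 4" "\<rho> / 2 * wsq \<rho> S u = (\<rho> * wsq \<rho> S u) / 2"
    by simp_all
  moreover have "\<bar>wform \<rho> S (\<lambda>t. r) u \<phi>\<bar> \<le> 1 * wprod \<rho> S u \<phi>"
    by (rule wform_le[OF \<rho>0 lipschitz_forms_bounded[OF rf] u2 \<phi>])
  moreover have "wprod \<rho> S u \<phi> \<le> \<rho> / 4 * wsq \<rho> S u + wsq \<rho> S \<phi> / (4 * (\<rho> / 4))"
    by (rule wprod_young[OF \<rho>0 u2 \<phi>]) (use \<rho> in simp)
  moreover have "wsq \<rho> S \<phi> / (4 * (\<rho> / 4)) = 1 / \<rho> * wsq \<rho> S \<phi>" by simp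
  moreover have "2 / \<rho> * wsq \<rho> S \<phi> = 2 * (1 / \<rho> * wsq \<rho> S \<phi>)" by simp
  ultimately show ?thesis by linarith
qed

section \<open>The energy estimate\<close>

abbreviation Prim :: "(real \<Rightarrow> 'x::{banach, second_countable_topology}) \<Rightarrow> real \<Rightarrow> 'x" where
  "Prim g \<equiv> \<lambda>t. integral\<^sup>L (Leb t) g"

lemma primitive_on_Prim: "integrable (Leb S) g \<Longrightarrow> primitive_on S (Prim g) g"
  unfolding primitive_on_def integral_Leb_0 by simp

lemma Prim_L2:
  assumes "g \<in> L2 S"
  shows "Prim g \<in> L2 S"
  by (rule continuous_on_L2[OF continuous_on_primitive[OF primitive_on_Prim[OF L2_integrable[OF assms]]]])

text \<open>The final time \<open>S\<close> is a parameter because the problem is solved again on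
  every [0,t] with the same constants. One \<open>M\<close> serves both for the bounds in V-norms
  and for those with the H-norm of the second argument.\<close>

locale damped_problem =
  fixes S M D \<alpha> :: real
    and rV :: "'v::{banach, second_countable_topology} \<Rightarrow> 'v \<Rightarrow> real"
    and rH :: "'h::{banach, second_countable_topology} \<Rightarrow> 'h \<Rightarrow> real"
    and j :: "'v \<Rightarrow> 'h"
    and a1 a2 b1 b2 :: "real \<Rightarrow> 'v \<Rightarrow> 'v \<Rightarrow> real"
  assumes S: "0 < S" and constants: "0 \<le> M" "0 \<le> D" "0 < \<alpha>"
    and rV: "inner_like rV" and rH: "inner_like rH" and j: "bounded_linear j"
    and a1: "lipschitz_forms S M D a1" and b1: "lipschitz_forms S M D b1"
    and a2: "measurable_forms S M a2" and b2: "measurable_forms S M b2"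
    and a2_le: "\<And>t x y. t \<in> {0..S} \<Longrightarrow> \<bar>a2 t x y\<bar> \<le> M * norm x * norm (j y)"
    and b2_le: "\<And>t x y. t \<in> {0..S} \<Longrightarrow> \<bar>b2 t x y\<bar> \<le> M * norm x * norm (j y)"
    and b1_sym: "\<And>t x y. t \<in> {0..S} \<Longrightarrow> b1 t x y = b1 t y x"
    and b1_coercive: "\<And>t x. t \<in> {0..S} \<Longrightarrow> \<alpha> * (norm x)\<^sup>2 \<le> b1 t x x"
begin

lemma S_nonneg: "0 \<le> S"
  using S by simp

lemma j_L2: "\<psi> \<in> L2 S \<Longrightarrow> (\<lambda>t. j (\<psi> t)) \<in> L2 S"
  by (rule L2_bounded_linear[OF j])

text \<open>The unknown is the acceleration: the velocity is \<open>u1 + Prim \<psi>\<close> and the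
  displacement \<open>u0 + t *\<^sub>R u1 + Prim (Prim \<psi>)\<close>. The contributions of the
  initial data are moved to \<open>Lf\<close>, so that \<open>E\<close> is bilinear and may be
  tested with the unknown itself.\<close>

definition E :: "real \<Rightarrow> (real \<Rightarrow> 'v) \<Rightarrow> (real \<Rightarrow> 'v) \<Rightarrow> real" where
  "E \<rho> \<psi> \<zeta> = wform \<rho> S (\<lambda>t x y. rH (j x) (j y)) \<psi> \<zeta> + wform \<rho> S b1 (Prim \<psi>) \<zeta> + wform \<rho> S b2 (Prim \<psi>) \<zeta>
     + wform \<rho> S a1 (Prim (Prim \<psi>)) \<zeta> + wform \<rho> S a2 (Prim (Prim \<psi>)) \<zeta>"

definition Lf :: "real \<Rightarrow> (real \<Rightarrow> 'h) \<Rightarrow> 'v \<Rightarrow> 'v \<Rightarrow> (real \<Rightarrow> 'v) \<Rightarrow> real" where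
  "Lf \<rho> f u0 u1 \<zeta> = wform \<rho> S (\<lambda>t x y. rH x (j y)) f \<zeta> - wform \<rho> S b1 (\<lambda>t. u1) \<zeta> - wform \<rho> S b2 (\<lambda>t. u1) \<zeta>
     - wform \<rho> S a1 (\<lambda>t. u0 + t *\<^sub>R u1) \<zeta> - wform \<rho> S a2 (\<lambda>t. u0 + t *\<^sub>R u1) \<zeta>"

text \<open>The squared norm in which the approximations converge. Each summand comes from an inner
  product, as the parallelogram law requires; the end value is included to obtain a limit of the
  velocity in V at time S.\<close>

definition Nsq :: "real \<Rightarrow> (real \<Rightarrow> 'v) \<Rightarrow> real" where
  "Nsq \<rho> \<psi> = wsq \<rho> S (\<lambda>t. j (\<psi> t)) + wsq \<rho> S (Prim \<psi>) + exp (- \<rho> * S) * (norm (Prim \<psi> S))\<^sup>2"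

text \<open>
  The form only controls \<open>\<psi>\<close> through its \<open>V\<close>-norm, which the energy does not contain; integrating by
  parts in time moves the estimate to the primitive of \<open>\<psi>\<close>.
\<close>

lemma wform_test_le:
  assumes \<rho>: "0 \<le> \<rho>" and c: "lipschitz_forms S M D c"
    and g: "primitive_on S g g'" "g' \<in> L2 S" and \<psi>: "\<psi> \<in> L2 S"
  shows "\<bar>wform \<rho> S c g \<psi>\<bar> \<le> M * exp (- \<rho> * S) * norm (g S) * norm (Prim \<psi> S)
    + M * wprod \<rho> S g' (Prim \<psi>) + (\<rho> * M + D) * wprod \<rho> S g (Prim \<psi>)"
proof -
  let ?\<phi> = "Prim \<psi>"
  note cb = lipschitz_forms_bounded[OF c]
  have \<phi>: "primitive_on S ?\<phi> \<psi>" by (rule primitive_on_Prim[OF L2_integrable[OF \<psi>]])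
  have \<phi>2: "?\<phi> \<in> L2 S" by (rule Prim_L2[OF \<psi>])
  have g2: "g \<in> L2 S" by (rule continuous_on_L2[OF continuous_on_primitive[OF g(1)]])
  have "c 0 (g 0) (?\<phi> 0) = 0"
    using bounded_bilinear.zero_right[OF bounded_forms_bilinear[OF cb, of 0]] S_nonneg
    unfolding integral_Leb_0 by simp
  then have "\<bar>exp (- \<rho> * S) * c S (g S) (?\<phi> S)
      - (wform \<rho> S c g' ?\<phi> + wform \<rho> S c g \<psi> - \<rho> * wform \<rho> S c g ?\<phi>)\<bar> \<le> D * wprod \<rho> S g ?\<phi>"
    using wform_parts[OF \<rho> c constants(2) S_nonneg g \<phi> \<psi>] by simp
  moreover have "\<bar>exp (- \<rho> * S) * c S (g S) (?\<phi> S)\<bar> \<le> M * exp (- \<rho> * S) * norm (g S) * norm (?\<phi> S)"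
  proof -
    have "\<bar>c S (g S) (?\<phi> S)\<bar> \<le> M * norm (g S) * norm (?\<phi> S)"
      by (rule bounded_forms_le[OF cb]) (use S in simp)
    from mult_left_mono[OF this, of "exp (- \<rho> * S)"] show ?thesis by (simp add: abs_mult mult_ac)
  qed
  moreover have "\<bar>wform \<rho> S c g' ?\<phi>\<bar> \<le> M * wprod \<rho> S g' ?\<phi>" by (rule wform_le[OF \<rho> cb g(2) \<phi>2])
  moreover have "\<bar>\<rho> * wform \<rho> S c g ?\<phi>\<bar> \<le> \<rho> * M * wprod \<rho> S g ?\<phi>"
    using mult_left_mono[OF wform_le[OF \<rho> cb g2 \<phi>2] \<rho>] \<rho> by (simp add: abs_mult mult.assoc)
  moreover have "(\<rho> * M + D) * wprod \<rho> S g ?\<phi> = \<rho> * M * wprod \<rho> S g ?\<phi> + D * wprod \<rho> S g ?\<phi>"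
    by (rule distrib_right)
  ultimately show ?thesis by linarith
qed

text \<open>The share 1/16 is calibrated for its uses: two such terms leave 7/8 of the H-term in
  \<open>E_coercive\<close>, and three, one of them with \<open>f\<close>, cost 3/16 in
  \<open>Lf_le\<close>.\<close>

lemma wform_j_le:
  fixes g :: "real \<Rightarrow> 'x::{banach, second_countable_topology}"
  assumes \<rho>: "0 \<le> \<rho>" and g: "g \<in> L2 S" and \<psi>: "\<psi> \<in> L2 S" and C: "0 \<le> C"
    and c: "\<And>t x y. t \<in> {0..S} \<Longrightarrow> \<bar>c t x y\<bar> \<le> C * norm x * norm (j y)"
  shows "\<bar>wform \<rho> S c g \<psi>\<bar> \<le> wsq \<rho> S (\<lambda>t. j (\<psi> t)) / 16 + 4 * C\<^sup>2 * wsq \<rho> S g"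
proof -
  have "\<bar>wform \<rho> S c g \<psi>\<bar> \<le> C * wprod \<rho> S g (\<lambda>t. j (\<psi> t))"
    by (rule wform_bound[OF \<rho> g j_L2[OF \<psi>] C]) (rule c, simp)
  also have "\<dots> \<le> 1 / 16 * wsq \<rho> S (\<lambda>t. j (\<psi> t)) + C\<^sup>2 / (4 * (1 / 16)) * wsq \<rho> S g"
    by (rule wprod_scaled_young[OF \<rho> g j_L2[OF \<psi>] _ C]) simp
  finally show ?thesis by simp
qed

text \<open>The \<open>b1\<close>-term supplies \<alpha> / 2 times the weighted end value and \<rho>
  \<alpha> / 2 times the weighted square of \<phi>. The threshold for \<rho> lists what the latter
  has to pay: 3 D for the Lipschitz errors of \<open>a1\<close> and \<open>b1\<close>, 3 M and 2 M^2
  / \<alpha> for \<open>a1\<close>, 20 M^2 for \<open>b2\<close> and \<open>a2\<close>, and 1 for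
  the square that is left over.\<close>

lemma E_coercive:
  assumes "1 \<le> \<rho>" and "2 * (1 + 3 * D + 3 * M + 2 * M\<^sup>2 / \<alpha> + 20 * M\<^sup>2) \<le> \<alpha> * \<rho>" and \<psi>: "\<psi> \<in> L2 S"
  shows "7 / 8 * wsq \<rho> S (\<lambda>t. j (\<psi> t)) + \<alpha> / 4 * (exp (- \<rho> * S) * (norm (Prim \<psi> S))\<^sup>2) + wsq \<rho> S (Prim \<psi>) \<le> E \<rho> \<psi> \<psi>"
proof -
  let ?\<phi> = "Prim \<psi>"
  let ?u = "Prim ?\<phi>"
  define e where "e = exp (- \<rho> * S)"
  define P where "P = wsq \<rho> S (\<lambda>t. j (\<psi> t))"
  define Q where "Q = wsq \<rho> S ?\<phi>"
  define R where "R = wsq \<rho> S ?u"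
  define Z where "Z = e * (norm (?\<phi> S))\<^sup>2"
  define Y where "Y = e * (norm (?u S))\<^sup>2"
  have \<rho>: "0 \<le> \<rho>" "0 < \<rho>" using assms(1) by auto
  have e: "0 < e" by (simp add: e_def)
  have nonneg: "0 \<le> P" "0 \<le> Q" "0 \<le> R" "0 \<le> Z" "0 \<le> Y"
    using e by (auto simp: P_def Q_def R_def Z_def Y_def wsq_nonneg)
  have \<phi>: "primitive_on S ?\<phi> \<psi>" by (rule primitive_on_Prim[OF L2_integrable[OF \<psi>]])
  have \<phi>2: "?\<phi> \<in> L2 S" by (rule Prim_L2[OF \<psi>])
  have u: "primitive_on S ?u ?\<phi>" by (rule primitive_on_Prim[OF L2_integrable[OF \<phi>2]])
  have u2: "?u \<in> L2 S" by (rule Prim_L2[OF \<phi>2])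
  have inv: "1 / \<rho> \<le> 1" using assms(1) by simp
  have hardy: "Y + \<rho> / 2 * R \<le> 2 / \<rho> * Q"
    using weighted_hardy[OF rV S_nonneg \<rho>(2) u integral_Leb_0 \<phi>2] by (simp add: Y_def R_def Q_def e_def)
  have Q2: "2 / \<rho> * Q \<le> 2 * Q" using mult_right_mono[OF inv nonneg(2)] by simp
  have \<rho>R: "0 \<le> \<rho> / 2 * R" "1 / 2 * R \<le> \<rho> / 2 * R"
    using \<rho> nonneg(3) mult_right_mono[OF assms(1) nonneg(3)] by simp_all
  \<comment> \<open>With \<rho> at least 1, the end value and the square of u are both dominated by
    the square of \<phi>.\<close>
  have Y: "Y \<le> 2 * Q" using hardy \<rho>R Q2 by linarith
  have R: "R \<le> 4 * Q" using hardy \<rho>R Q2 nonneg(5) by linarith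
  \<comment> \<open>The coefficient \<rho> M grows as fast as the good term \<rho> \<alpha> Q, so it
    could not be absorbed by increasing \<rho>; the factor 2 / \<rho> from
    \<open>weighted_hardy\<close> cancels this growth.\<close>
  have prod_u: "(\<rho> * M + D) * wprod \<rho> S ?u ?\<phi> \<le> (2 * M + 2 * D) * Q"
  proof -
    have "wprod \<rho> S ?u ?\<phi> \<le> \<rho> / 4 * R + Q / (4 * (\<rho> / 4))"
      unfolding R_def Q_def by (rule wprod_young[OF \<rho>(1) u2 \<phi>2]) (use \<rho> in simp)
    also have "\<dots> \<le> 2 / \<rho> * Q" using hardy nonneg(5) by simp
    finally have w: "wprod \<rho> S ?u ?\<phi> \<le> 2 / \<rho> * Q" .
    have "(\<rho> * M + D) * wprod \<rho> S ?u ?\<phi> \<le> (\<rho> * M + D) * (2 / \<rho> * Q)"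
      by (rule mult_left_mono[OF w]) (use \<rho> constants in simp)
    also have "\<dots> = 2 * M * Q + D * (2 / \<rho> * Q)" using \<rho> by (simp add: field_simps)
    also have "\<dots> \<le> 2 * M * Q + D * (2 * Q)" by (intro add_left_mono mult_left_mono Q2 constants)
    finally show ?thesis by (simp add: algebra_simps)
  qed
  have Ea1: "\<bar>wform \<rho> S a1 ?u \<psi>\<bar> \<le> \<alpha> / 4 * Z + (3 * M + 2 * D + 2 * M\<^sup>2 / \<alpha>) * Q"
  proof -
    have "\<bar>wform \<rho> S a1 ?u \<psi>\<bar> \<le> M * e * norm (?u S) * norm (?\<phi> S) + M * Q + (\<rho> * M + D) * wprod \<rho> S ?u ?\<phi>"
      using wform_test_le[OF \<rho>(1) a1 u \<phi>2 \<psi>] by (simp add: e_def Q_def wprod_self)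
    \<comment> \<open>Only half of the end-value term supplied by \<open>b1\<close> is spent here;
      the end value of u is again bounded by \<phi>.\<close>
    moreover have "M * e * norm (?u S) * norm (?\<phi> S) \<le> \<alpha> / 4 * Z + M\<^sup>2 / \<alpha> * Y"
    proof -
      have "norm (?\<phi> S) * (M * norm (?u S)) \<le> \<alpha> / 4 * (norm (?\<phi> S))\<^sup>2 + (M * norm (?u S))\<^sup>2 / (4 * (\<alpha> / 4))"
        by (rule young_mult) (use constants in simp)
      from mult_left_mono[OF this, of e] e show ?thesis
        by (simp add: Z_def Y_def algebra_simps power_mult_distrib)
    qed
    moreover have "M\<^sup>2 / \<alpha> * Y \<le> M\<^sup>2 / \<alpha> * (2 * Q)" by (intro mult_left_mono Y) (use constants in simp)
    ultimately show ?thesis using prod_u by (simp add: algebra_simps)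
  qed
  \<comment> \<open>By symmetry of \<open>b1\<close> the two product-rule terms coincide. Twice the
    tested term therefore equals the end value plus \<rho> times the form at (\<phi>,\<phi>), up to
    the Lipschitz error D Q.\<close>
  have Eb1: "\<alpha> * Z + \<rho> * \<alpha> * Q - D * Q \<le> 2 * wform \<rho> S b1 ?\<phi> \<psi>"
  proof -
    have "b1 0 (?\<phi> 0) (?\<phi> 0) = 0"
      using bounded_bilinear.zero_right[OF bounded_forms_bilinear[OF lipschitz_forms_bounded[OF b1], of 0]] S_nonneg
      unfolding integral_Leb_0 by simp
    moreover have "wform \<rho> S b1 \<psi> ?\<phi> = wform \<rho> S b1 ?\<phi> \<psi>"
      unfolding wform_def by (intro Bochner_Integration.integral_cong refl) (simp add: b1_sym)
    ultimately have "\<bar>e * b1 S (?\<phi> S) (?\<phi> S) - (2 * wform \<rho> S b1 ?\<phi> \<psi> - \<rho> * wform \<rho> S b1 ?\<phi> ?\<phi>)\<bar> \<le> D * Q"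
      using wform_parts[OF \<rho>(1) b1 constants(2) S_nonneg \<phi> \<psi> \<phi> \<psi>] by (simp add: e_def Q_def wprod_self)
    moreover have "\<alpha> * Z \<le> e * b1 S (?\<phi> S) (?\<phi> S)"
      using mult_left_mono[OF b1_coercive[of S "?\<phi> S"], of e] S e by (simp add: Z_def mult_ac)
    moreover have "\<rho> * \<alpha> * Q \<le> \<rho> * wform \<rho> S b1 ?\<phi> ?\<phi>"
    proof -
      have "\<alpha> * Q = (\<integral>t. \<alpha> * (exp (- \<rho> * t) * (norm (?\<phi> t))\<^sup>2) \<partial>Leb S)"
        unfolding Q_def wsq_def by simp
      also have "\<dots> \<le> wform \<rho> S b1 ?\<phi> ?\<phi>"
        unfolding wform_def
      proof (rule integral_mono)
        show "integrable (Leb S) (\<lambda>t. \<alpha> * (exp (- \<rho> * t) * (norm (?\<phi> t))\<^sup>2))"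
          by (intro Bochner_Integration.integrable_mult_right wsq_integrable[OF \<rho>(1) \<phi>2])
        show "integrable (Leb S) (\<lambda>t. exp (- \<rho> * t) * b1 t (?\<phi> t) (?\<phi> t))"
          by (rule forms_integrable[OF weighted_measurable_forms[OF lipschitz_forms_measurable[OF b1] \<rho>(1)] \<phi>2 \<phi>2])
        fix t assume "t \<in> space (Leb S)"
        then have "t \<in> {0..S}" by simp
        from mult_left_mono[OF b1_coercive[OF this, of "?\<phi> t"], of "exp (- \<rho> * t)"]
        show "\<alpha> * (exp (- \<rho> * t) * (norm (?\<phi> t))\<^sup>2) \<le> exp (- \<rho> * t) * b1 t (?\<phi> t) (?\<phi> t)"
          by (simp add: mult_ac)
      qed
      finally have "\<alpha> * Q \<le> wform \<rho> S b1 ?\<phi> ?\<phi>" .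
      from mult_left_mono[OF this \<rho>(1)] show ?thesis by (simp add: mult_ac)
    qed
    ultimately show ?thesis by linarith
  qed
  have Eb2: "\<bar>wform \<rho> S b2 ?\<phi> \<psi>\<bar> \<le> P / 16 + 4 * M\<^sup>2 * Q"
    unfolding P_def Q_def by (rule wform_j_le[OF \<rho>(1) \<phi>2 \<psi> constants(1) b2_le])
  have Ea2: "\<bar>wform \<rho> S a2 ?u \<psi>\<bar> \<le> P / 16 + 16 * M\<^sup>2 * Q"
  proof -
    have "\<bar>wform \<rho> S a2 ?u \<psi>\<bar> \<le> P / 16 + 4 * M\<^sup>2 * R"
      unfolding P_def R_def by (rule wform_j_le[OF \<rho>(1) u2 \<psi> constants(1) a2_le])
    also have "\<dots> \<le> P / 16 + 4 * M\<^sup>2 * (4 * Q)" by (intro add_left_mono mult_left_mono R) simp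
    finally show ?thesis by simp
  qed
  have EH: "wform \<rho> S (\<lambda>t x y. rH (j x) (j y)) \<psi> \<psi> = P"
    unfolding P_def wsq_def wform_def by (simp only: inner_like_self[OF rH])
  have "(2 * (1 + 3 * D + 3 * M + 2 * M\<^sup>2 / \<alpha> + 20 * M\<^sup>2)) * Q \<le> (\<alpha> * \<rho>) * Q"
    by (rule mult_right_mono[OF assms(2) nonneg(2)])
  moreover define m where "m = 2 * M\<^sup>2 / \<alpha>"
  ultimately have big: "2 * Q + 6 * (D * Q) + 6 * (M * Q) + 2 * (m * Q) + 40 * (M\<^sup>2 * Q) \<le> \<rho> * \<alpha> * Q"
    by (simp add: algebra_simps)
  have Ea1': "\<bar>wform \<rho> S a1 ?u \<psi>\<bar> \<le> \<alpha> * Z / 4 + 3 * (M * Q) + 2 * (D * Q) + m * Q"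
    using Ea1 unfolding m_def[symmetric] by (simp add: algebra_simps)
  have "0 \<le> D * Q" using constants nonneg by simp
  then have "7 / 8 * P + \<alpha> * Z / 4 + Q \<le> E \<rho> \<psi> \<psi>"
    unfolding E_def EH using Eb1 Eb2 Ea2 Ea1' big by (simp add: algebra_simps)
  then show ?thesis by (simp add: P_def Z_def Q_def e_def)
qed

text \<open>The data terms are treated like the corresponding terms of \<open>E\<close>, with
  smaller shares: \<open>b1\<close> and \<open>a1\<close> take \<alpha> / 32 and 1/8 each, the three
  terms bounded through H take 1/16 each. The remainder \<open>K\<close> depends on the data and on
  \<rho>, but not on \<psi>.\<close>

lemma Lf_le:
  assumes \<rho>: "0 \<le> \<rho>" and f: "f \<in> L2 S"
  obtains K where "\<And>\<psi>. \<psi> \<in> L2 S \<Longrightarrow> Lf \<rho> f u0 u1 \<psi> \<le> 3 / 16 * wsq \<rho> S (\<lambda>t. j (\<psi> t))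
    + \<alpha> / 16 * (exp (- \<rho> * S) * (norm (Prim \<psi> S))\<^sup>2) + 1 / 4 * wsq \<rho> S (Prim \<psi>) + K"
proof -
  have test: "\<exists>K. \<forall>\<psi>\<in>L2 S. \<bar>wform \<rho> S c g \<psi>\<bar> \<le>
      \<alpha> / 32 * (exp (- \<rho> * S) * (norm (Prim \<psi> S))\<^sup>2) + 1 / 8 * wsq \<rho> S (Prim \<psi>) + K"
    if c: "lipschitz_forms S M D c" and g: "primitive_on S g g'" "g' \<in> L2 S"
    for c :: "real \<Rightarrow> 'v \<Rightarrow> 'v \<Rightarrow> real" and g g' :: "real \<Rightarrow> 'v"
  proof (intro exI ballI)
    fix \<psi> :: "real \<Rightarrow> 'v" assume \<psi>: "\<psi> \<in> L2 S"
    have \<phi>2: "Prim \<psi> \<in> L2 S" by (rule Prim_L2[OF \<psi>])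
    have g2: "g \<in> L2 S" by (rule continuous_on_L2[OF continuous_on_primitive[OF g(1)]])
    have "M * wprod \<rho> S g' (Prim \<psi>) \<le> 1 / 16 * wsq \<rho> S (Prim \<psi>) + M\<^sup>2 / (4 * (1 / 16)) * wsq \<rho> S g'"
      by (rule wprod_scaled_young[OF \<rho> g(2) \<phi>2 _ constants(1)]) simp
    moreover have "(\<rho> * M + D) * wprod \<rho> S g (Prim \<psi>) \<le> 1 / 16 * wsq \<rho> S (Prim \<psi>) + (\<rho> * M + D)\<^sup>2 / (4 * (1 / 16)) * wsq \<rho> S g"
      by (rule wprod_scaled_young[OF \<rho> g2 \<phi>2]) (use \<rho> constants in simp_all)
    moreover have "M * exp (- \<rho> * S) * norm (g S) * norm (Prim \<psi> S)
      \<le> \<alpha> / 32 * (exp (- \<rho> * S) * (norm (Prim \<psi> S))\<^sup>2) + exp (- \<rho> * S) * ((M * norm (g S))\<^sup>2 / (4 * (\<alpha> / 32)))"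
    proof -
      have "norm (Prim \<psi> S) * (M * norm (g S)) \<le> \<alpha> / 32 * (norm (Prim \<psi> S))\<^sup>2 + (M * norm (g S))\<^sup>2 / (4 * (\<alpha> / 32))"
        by (rule young_mult) (use constants in simp)
      from mult_left_mono[OF this, of "exp (- \<rho> * S)"] show ?thesis by (simp add: algebra_simps)
    qed
    ultimately show "\<bar>wform \<rho> S c g \<psi>\<bar> \<le> \<alpha> / 32 * (exp (- \<rho> * S) * (norm (Prim \<psi> S))\<^sup>2) + 1 / 8 * wsq \<rho> S (Prim \<psi>)
      + (exp (- \<rho> * S) * ((M * norm (g S))\<^sup>2 / (4 * (\<alpha> / 32))) + M\<^sup>2 / (4 * (1 / 16)) * wsq \<rho> S g'
        + (\<rho> * M + D)\<^sup>2 / (4 * (1 / 16)) * wsq \<rho> S g)"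
      using wform_test_le[OF \<rho> c g \<psi>] by linarith
  qed
  let ?u = "\<lambda>t. u0 + t *\<^sub>R u1"
  have u: "primitive_on S ?u (\<lambda>t. u1)"
  proof -
    have "primitive_on S (\<lambda>t. t) (\<lambda>t. 1::real)" by (rule primitive_on_deriv) (auto intro!: derivative_eq_intros)
    from primitive_on_add[OF primitive_on_const[of S u0] primitive_on_linear[OF bounded_linear_scaleR_left[of u1] this]]
    show ?thesis by simp
  qed
  have u2: "?u \<in> L2 S" by (rule continuous_on_L2[OF continuous_on_primitive[OF u]])
  obtain K1 where K1: "\<And>\<psi>. \<psi> \<in> L2 S \<Longrightarrow> \<bar>wform \<rho> S b1 (\<lambda>t. u1) \<psi>\<bar> \<le>
      \<alpha> / 32 * (exp (- \<rho> * S) * (norm (Prim \<psi> S))\<^sup>2) + 1 / 8 * wsq \<rho> S (Prim \<psi>) + K1"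
    using test[OF b1 primitive_on_const L2_const] by blast
  obtain K2 where K2: "\<And>\<psi>. \<psi> \<in> L2 S \<Longrightarrow> \<bar>wform \<rho> S a1 ?u \<psi>\<bar> \<le>
      \<alpha> / 32 * (exp (- \<rho> * S) * (norm (Prim \<psi> S))\<^sup>2) + 1 / 8 * wsq \<rho> S (Prim \<psi>) + K2"
    using test[OF a1 u L2_const] by blast
  show thesis
  proof (rule that)
    fix \<psi> :: "real \<Rightarrow> 'v" assume \<psi>: "\<psi> \<in> L2 S"
    have "\<bar>wform \<rho> S b2 (\<lambda>t. u1) \<psi>\<bar> \<le> wsq \<rho> S (\<lambda>t. j (\<psi> t)) / 16 + 4 * M\<^sup>2 * wsq \<rho> S (\<lambda>t. u1)"
      by (rule wform_j_le[OF \<rho> L2_const \<psi> constants(1) b2_le])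
    moreover have "\<bar>wform \<rho> S a2 ?u \<psi>\<bar> \<le> wsq \<rho> S (\<lambda>t. j (\<psi> t)) / 16 + 4 * M\<^sup>2 * wsq \<rho> S ?u"
      by (rule wform_j_le[OF \<rho> u2 \<psi> constants(1) a2_le])
    moreover have "\<bar>wform \<rho> S (\<lambda>t x y. rH x (j y)) f \<psi>\<bar> \<le> wsq \<rho> S (\<lambda>t. j (\<psi> t)) / 16 + 4 * 1\<^sup>2 * wsq \<rho> S f"
      by (rule wform_j_le[OF \<rho> f \<psi>]) (use inner_like_le[OF rH] in auto)
    ultimately show "Lf \<rho> f u0 u1 \<psi> \<le> 3 / 16 * wsq \<rho> S (\<lambda>t. j (\<psi> t))
      + \<alpha> / 16 * (exp (- \<rho> * S) * (norm (Prim \<psi> S))\<^sup>2) + 1 / 4 * wsq \<rho> S (Prim \<psi>)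
      + (4 * M\<^sup>2 * wsq \<rho> S (\<lambda>t. u1) + 4 * M\<^sup>2 * wsq \<rho> S ?u + 4 * 1\<^sup>2 * wsq \<rho> S f + K1 + K2)"
      unfolding Lf_def using K1[OF \<psi>] K2[OF \<psi>] by linarith
  qed
qed

lemma energy:
  assumes f: "f \<in> L2 S"
  obtains \<rho> \<kappa> K where "0 \<le> \<rho>" "0 < \<kappa>" "\<And>\<psi>. \<psi> \<in> L2 S \<Longrightarrow> 0 \<le> E \<rho> \<psi> \<psi>"
    "\<And>\<psi>. \<psi> \<in> L2 S \<Longrightarrow> \<kappa> * Nsq \<rho> \<psi> \<le> E \<rho> \<psi> \<psi> - Lf \<rho> f u0 u1 \<psi> + K"
proof -
  define \<rho> where "\<rho> = max 1 (2 * (1 + 3 * D + 3 * M + 2 * M\<^sup>2 / \<alpha> + 20 * M\<^sup>2) / \<alpha>)"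
  have \<rho>1: "1 \<le> \<rho>" and \<rho>0: "0 \<le> \<rho>" by (auto simp: \<rho>_def)
  have "2 * (1 + 3 * D + 3 * M + 2 * M\<^sup>2 / \<alpha> + 20 * M\<^sup>2) / \<alpha> \<le> \<rho>" by (simp only: \<rho>_def max.cobounded2)
  then have \<rho>2: "2 * (1 + 3 * D + 3 * M + 2 * M\<^sup>2 / \<alpha> + 20 * M\<^sup>2) \<le> \<alpha> * \<rho>"
    using constants(3) by (simp only: pos_divide_le_eq mult.commute)
  note coer = E_coercive[OF \<rho>1 \<rho>2]
  obtain K where K: "\<And>\<psi>. \<psi> \<in> L2 S \<Longrightarrow> Lf \<rho> f u0 u1 \<psi> \<le> 3 / 16 * wsq \<rho> S (\<lambda>t. j (\<psi> t))
    + \<alpha> / 16 * (exp (- \<rho> * S) * (norm (Prim \<psi> S))\<^sup>2) + 1 / 4 * wsq \<rho> S (Prim \<psi>) + K"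
    using Lf_le[OF \<rho>0 f, of u0 u1] by blast
  \<comment> \<open>Once the shares taken by \<open>Lf\<close> are subtracted, the coefficients
    11/16, 3/4 and 3 \<alpha> / 16 remain; 1/2 and \<alpha> / 8 lie below them.\<close>
  define \<kappa> where "\<kappa> = min (1/2) (\<alpha> / 8)"
  have \<kappa>: "0 < \<kappa>" "\<kappa> \<le> 1/2" "\<kappa> \<le> \<alpha> / 8" using constants by (auto simp: \<kappa>_def)
  show thesis
  proof (rule that[OF \<rho>0 \<kappa>(1)])
    fix \<psi> :: "real \<Rightarrow> 'v" assume \<psi>: "\<psi> \<in> L2 S"
    define P where "P = wsq \<rho> S (\<lambda>t. j (\<psi> t))"
    define Q where "Q = wsq \<rho> S (Prim \<psi>)"
    define Z where "Z = exp (- \<rho> * S) * (norm (Prim \<psi> S))\<^sup>2"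
    have nn: "0 \<le> P" "0 \<le> Q" "0 \<le> Z" by (auto simp: P_def Q_def Z_def wsq_nonneg)
    have 1: "7 / 8 * P + \<alpha> / 4 * Z + Q \<le> E \<rho> \<psi> \<psi>" using coer[OF \<psi>] by (simp add: P_def Q_def Z_def)
    have 2: "Lf \<rho> f u0 u1 \<psi> \<le> 3 / 16 * P + \<alpha> / 16 * Z + 1 / 4 * Q + K"
      using K[OF \<psi>] by (simp add: P_def Q_def Z_def)
    have "0 \<le> \<alpha> * Z" using constants nn by simp
    then show "0 \<le> E \<rho> \<psi> \<psi>" using 1 nn by linarith
    have "\<kappa> * P \<le> 1/2 * P" "\<kappa> * Q \<le> 1/2 * Q" "\<kappa> * Z \<le> \<alpha> / 8 * Z"
      by (rule mult_right_mono[OF \<kappa>(2) nn(1)], rule mult_right_mono[OF \<kappa>(2) nn(2)], rule mult_right_mono[OF \<kappa>(3) nn(3)])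
    then have "\<kappa> * (P + Q + Z) \<le> 1/2 * P + 1/2 * Q + \<alpha> / 8 * Z" by (simp add: distrib_left)
    then show "\<kappa> * Nsq \<rho> \<psi> \<le> E \<rho> \<psi> \<psi> - Lf \<rho> f u0 u1 \<psi> + K"
      using 1 2 nn \<open>0 \<le> \<alpha> * Z\<close> unfolding Nsq_def P_def[symmetric] Q_def[symmetric] Z_def[symmetric]
      by linarith
  qed
qed

end

section \<open>Galerkin approximation\<close>

lemma Prim_add:
  assumes "integrable (Leb S) f" "integrable (Leb S) g" "t \<le> S"
  shows "Prim (\<lambda>s. f s + g s) t = Prim f t + Prim g t"
  by (rule Bochner_Integration.integral_add[OF integrable_Leb_mono[OF assms(1,3)] integrable_Leb_mono[OF assms(2,3)]])

lemma Prim_diff: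
  assumes "integrable (Leb S) f" "integrable (Leb S) g" "t \<le> S"
  shows "Prim (\<lambda>s. f s - g s) t = Prim f t - Prim g t"
  by (rule Bochner_Integration.integral_diff[OF integrable_Leb_mono[OF assms(1,3)] integrable_Leb_mono[OF assms(2,3)]])

lemma Prim_cong: "(\<And>s. s \<in> {0<..<t} \<Longrightarrow> f s = g s) \<Longrightarrow> Prim f t = Prim g t"
  by (rule Bochner_Integration.integral_cong) auto

lemma norm_Prim_le:
  assumes "integrable (Leb S) f" "t \<le> S"
  shows "norm (Prim f t) \<le> (\<integral>s. norm (f s) \<partial>Leb S)"
proof -
  have "norm (Prim f t) \<le> (\<integral>s. norm (indicator {..<t} s *\<^sub>R f s) \<partial>Leb S)"
    unfolding integral_Leb_sub[OF assms(2)] by (rule integral_norm_bound)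
  also have "\<dots> \<le> (\<integral>s. norm (f s) \<partial>Leb S)"
    by (rule integral_mono[OF integrable_norm[OF integrable_indicator_Leb[OF assms(1)]] integrable_norm[OF assms(1)]])
      (simp_all add: indicator_def)
  finally show ?thesis .
qed

lemma L2_norm: "f \<in> L2 S \<Longrightarrow> (\<lambda>t. norm (f t)) \<in> L2 S"
  unfolding L2_def by (auto intro: borel_measurable_norm)

text \<open>An instance of \<open>forms_integral_tendsto\<close> for the multiplication of reals,
  with the constant 1 as second argument.\<close>

lemma L2_tendsto_L1:
  assumes f: "\<And>n. f n \<in> L2 S" "g \<in> L2 S"
    and lim: "(\<lambda>n. \<integral>t. (norm (f n t - g t))\<^sup>2 \<partial>Leb S) \<longlonglongrightarrow> 0"
  shows "(\<lambda>n. \<integral>t. norm (f n t - g t) \<partial>Leb S) \<longlonglongrightarrow> 0"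
proof -
  have "lipschitz_forms S 1 0 (\<lambda>t x y. x * y :: real)"
    unfolding lipschitz_forms_def bounded_forms_def by (simp add: bounded_bilinear_mult abs_mult)
  note c = lipschitz_forms_measurable[OF this]
  have "(\<lambda>n. \<integral>t. norm (f n t - g t) * 1 \<partial>Leb S) \<longlonglongrightarrow> (\<integral>t. 0 * 1 \<partial>Leb S)"
  proof (rule forms_integral_tendsto[OF c])
    show "(\<lambda>t. norm (f n t - g t)) \<in> L2 S" for n
      by (rule L2_norm[OF L2_diff[OF f]])
  qed (use lim in \<open>simp_all add: L2_const\<close>)
  then show ?thesis by simp
qed

text \<open>Primitives differ by at most the L^1 distance of the functions, uniformly in the upper
  limit; squaring and integrating over a bounded interval preserves the convergence.\<close>

lemma L2_tendsto_Prim: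
  assumes f: "\<And>n. f n \<in> L2 S" "g \<in> L2 S"
    and lim: "(\<lambda>n. \<integral>t. (norm (f n t - g t))\<^sup>2 \<partial>Leb S) \<longlonglongrightarrow> 0"
  shows "t \<le> S \<Longrightarrow> (\<lambda>n. Prim (f n) t) \<longlonglongrightarrow> Prim g t"
    and "(\<lambda>n. \<integral>t. (norm (Prim (f n) t - Prim g t))\<^sup>2 \<partial>Leb S) \<longlonglongrightarrow> 0"
proof -
  define d where "d = (\<lambda>n. \<integral>t. norm (f n t - g t) \<partial>Leb S)"
  have d: "d \<longlonglongrightarrow> 0" unfolding d_def by (rule L2_tendsto_L1[OF f lim])
  have le: "norm (Prim (f n) t - Prim g t) \<le> d n" if "t \<le> S" for n t
    using norm_Prim_le[OF Bochner_Integration.integrable_diff[OF L2_integrable[OF f(1)] L2_integrable[OF f(2)]] that]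
    unfolding d_def Prim_diff[OF L2_integrable[OF f(1)] L2_integrable[OF f(2)] that] .
  show "(\<lambda>n. Prim (f n) t) \<longlonglongrightarrow> Prim g t" if "t \<le> S"
  proof (rule Lim_null[THEN iffD2], rule Lim_null_comparison[OF _ d])
    show "eventually (\<lambda>n. norm (Prim (f n) t - Prim g t) \<le> d n) sequentially" using le[OF that] by simp
  qed
  have d2: "(\<lambda>n. (d n)\<^sup>2 * measure (Leb S) {0<..<S}) \<longlonglongrightarrow> 0\<^sup>2 * measure (Leb S) {0<..<S}"
    by (intro tendsto_intros d)
  show "(\<lambda>n. \<integral>t. (norm (Prim (f n) t - Prim g t))\<^sup>2 \<partial>Leb S) \<longlonglongrightarrow> 0"
  proof (rule Lim_null_comparison)
    show "eventually (\<lambda>n. norm (\<integral>t. (norm (Prim (f n) t - Prim g t))\<^sup>2 \<partial>Leb S) \<le> (d n)\<^sup>2 * measure (Leb S) {0<..<S}) sequentially"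
    proof (rule always_eventually, rule allI)
      fix n
      have "(\<integral>t. (norm (Prim (f n) t - Prim g t))\<^sup>2 \<partial>Leb S) \<le> (\<integral>t. (d n)\<^sup>2 \<partial>Leb S)"
      proof (rule integral_mono)
        show "integrable (Leb S) (\<lambda>t. (norm (Prim (f n) t - Prim g t))\<^sup>2)"
          by (intro L2_sq L2_diff Prim_L2 f)
        show "(norm (Prim (f n) t - Prim g t))\<^sup>2 \<le> (d n)\<^sup>2" if "t \<in> space (Leb S)" for t
          by (rule power_mono[OF le]) (use that in auto)
      qed simp
      then show "norm (\<integral>t. (norm (Prim (f n) t - Prim g t))\<^sup>2 \<partial>Leb S) \<le> (d n)\<^sup>2 * measure (Leb S) {0<..<S}"
        by (simp add: mult.commute)
    qed
    show "(\<lambda>n. (d n)\<^sup>2 * measure (Leb S) {0<..<S}) \<longlonglongrightarrow> 0" using d2 by simp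
  qed
qed

lemma constant_forms:
  assumes "bounded_bilinear r" "0 \<le> C" "\<And>x y. \<bar>r x y\<bar> \<le> C * norm x * norm y"
  shows "measurable_forms S C (\<lambda>t. r)"
  using assms unfolding measurable_forms_def bounded_forms_def by simp

context
  fixes c :: "real \<Rightarrow> 'a::{banach, second_countable_topology} \<Rightarrow> 'b::{banach, second_countable_topology} \<Rightarrow> real"
    and S C \<rho> :: real
  assumes c: "measurable_forms S C c" and \<rho>: "0 \<le> \<rho>"
begin

lemma wform_add:
  "f \<in> L2 S \<Longrightarrow> f' \<in> L2 S \<Longrightarrow> g \<in> L2 S \<Longrightarrow> wform \<rho> S c (\<lambda>t. f t + f' t) g = wform \<rho> S c f g + wform \<rho> S c f' g"
  unfolding wform_def by (rule forms_integral_add[OF weighted_measurable_forms[OF c \<rho>]])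

lemma wform_scale: "wform \<rho> S c (\<lambda>t. r *\<^sub>R f t) g = r * wform \<rho> S c f g"
  unfolding wform_def by (rule forms_integral_scale[OF weighted_measurable_forms[OF c \<rho>]])

lemma wform_add_right:
  "f \<in> L2 S \<Longrightarrow> g \<in> L2 S \<Longrightarrow> g' \<in> L2 S \<Longrightarrow> wform \<rho> S c f (\<lambda>t. g t + g' t) = wform \<rho> S c f g + wform \<rho> S c f g'"
  unfolding wform_def by (rule forms_integral_add_right[OF weighted_measurable_forms[OF c \<rho>]])

lemma wform_scale_right: "wform \<rho> S c f (\<lambda>t. r *\<^sub>R g t) = r * wform \<rho> S c f g"
  unfolding wform_def by (rule forms_integral_scale_right[OF weighted_measurable_forms[OF c \<rho>]])

lemma wform_tendsto:
  assumes "\<And>n. f n \<in> L2 S" "f' \<in> L2 S" "g \<in> L2 S"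
    and "(\<lambda>n. \<integral>t. (norm (f n t - f' t))\<^sup>2 \<partial>Leb S) \<longlonglongrightarrow> 0"
  shows "(\<lambda>n. wform \<rho> S c (f n) g) \<longlonglongrightarrow> wform \<rho> S c f' g"
  unfolding wform_def by (rule forms_integral_tendsto[OF weighted_measurable_forms[OF c \<rho>] assms])

end

lemma wsq_parallelogram:
  fixes r :: "'a::{banach, second_countable_topology} \<Rightarrow> 'a \<Rightarrow> real" and f g :: "real \<Rightarrow> 'a"
  assumes r: "inner_like r" and \<rho>: "0 \<le> \<rho>" and f: "f \<in> L2 S" and g: "g \<in> L2 S"
  shows "wsq \<rho> S (\<lambda>t. f t - g t) = 2 * wsq \<rho> S f + 2 * wsq \<rho> S g - 4 * wsq \<rho> S (\<lambda>t. (1/2) *\<^sub>R (f t + g t))"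
proof -
  have "wsq \<rho> S (\<lambda>t. f t - g t) = (\<integral>t. 2 * (exp (- \<rho> * t) * (norm (f t))\<^sup>2) + 2 * (exp (- \<rho> * t) * (norm (g t))\<^sup>2)
      - 4 * (exp (- \<rho> * t) * (norm ((1/2) *\<^sub>R (f t + g t)))\<^sup>2) \<partial>Leb S)"
    unfolding wsq_def
  proof (rule Bochner_Integration.integral_cong[OF refl])
    show "exp (- \<rho> * t) * (norm (f t - g t))\<^sup>2 = 2 * (exp (- \<rho> * t) * (norm (f t))\<^sup>2) + 2 * (exp (- \<rho> * t) * (norm (g t))\<^sup>2)
      - 4 * (exp (- \<rho> * t) * (norm ((1/2) *\<^sub>R (f t + g t)))\<^sup>2)" for t
    proof -
      have "e * y = 2 * (e * p) + 2 * (e * q) - 4 * (e * m)" if "y = 2 * p + 2 * q - 4 * m" for e y p q m :: real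
        unfolding that by (simp add: algebra_simps)
      from this[OF inner_like_parallelogram[OF r]] show ?thesis .
    qed
  qed
  also have "\<dots> = 2 * wsq \<rho> S f + 2 * wsq \<rho> S g - 4 * wsq \<rho> S (\<lambda>t. (1/2) *\<^sub>R (f t + g t))"
    unfolding wsq_def
    by (simp only: Bochner_Integration.integral_diff Bochner_Integration.integral_add Bochner_Integration.integral_mult_right_zero
        Bochner_Integration.integrable_add Bochner_Integration.integrable_mult_right
        wsq_integrable[OF \<rho> f] wsq_integrable[OF \<rho> g] wsq_integrable[OF \<rho> L2_scaleR[OF L2_add[OF f g]]])
  finally show ?thesis .
qed

lemma integral_le_wsq:
  assumes \<rho>: "0 \<le> \<rho>" and f: "f \<in> L2 S"
  shows "(\<integral>t. (norm (f t))\<^sup>2 \<partial>Leb S) \<le> exp (\<rho> * S) * wsq \<rho> S f"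
proof -
  have "(\<integral>t. (norm (f t))\<^sup>2 \<partial>Leb S) \<le> (\<integral>t. exp (\<rho> * S) * (exp (- \<rho> * t) * (norm (f t))\<^sup>2) \<partial>Leb S)"
  proof (rule integral_mono[OF L2_sq[OF f]])
    show "integrable (Leb S) (\<lambda>t. exp (\<rho> * S) * (exp (- \<rho> * t) * (norm (f t))\<^sup>2))"
      by (intro Bochner_Integration.integrable_mult_right wsq_integrable[OF \<rho> f])
    fix t assume "t \<in> space (Leb S)"
    then have "\<rho> * t \<le> \<rho> * S" using \<rho> by (intro mult_left_mono) auto
    then have "1 \<le> exp (\<rho> * S) * exp (- \<rho> * t)" by (simp add: exp_add[symmetric])
    from mult_right_mono[OF this, of "(norm (f t))\<^sup>2"]
    show "(norm (f t))\<^sup>2 \<le> exp (\<rho> * S) * (exp (- \<rho> * t) * (norm (f t))\<^sup>2)" by (simp add: mult.assoc)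
  qed
  then show ?thesis by (simp add: wsq_def)
qed

section \<open>Linearity of the variational problem and its Galerkin solutions\<close>

context damped_problem
begin

lemma j_bound: obtains K where "0 \<le> K" "\<And>x. norm (j x) \<le> K * norm x"
proof -
  obtain K where "0 \<le> K" "\<forall>x. norm (j x) \<le> norm x * K" using bounded_linear.nonneg_bounded[OF j] by blast
  then show thesis by (intro that[of K]) (simp_all add: mult.commute)
qed

lemma rHj_forms: "\<exists>C. measurable_forms S C (\<lambda>t x y. rH x (j y))"
proof -
  obtain K where K: "0 \<le> K" "\<And>x. norm (j x) \<le> K * norm x" by (rule j_bound) blast
  have "measurable_forms S K (\<lambda>t x y. rH x (j y))"
  proof (rule constant_forms[OF _ K(1)])
    show "bounded_bilinear (\<lambda>x y. rH x (j y))"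
      by (rule bounded_bilinear.comp[OF inner_like_bilinear[OF rH] bounded_linear_ident j])
    show "\<bar>rH x (j y)\<bar> \<le> K * norm x * norm y" for x y
      using inner_like_le[OF rH, of x "j y"] mult_left_mono[OF K(2)[of y] norm_ge_zero[of x]] by (simp add: mult_ac)
  qed
  then show ?thesis by blast
qed

lemma rHjj_forms: "\<exists>C. measurable_forms S C (\<lambda>t x y. rH (j x) (j y))"
proof -
  obtain K where K: "0 \<le> K" "\<And>x. norm (j x) \<le> K * norm x" by (rule j_bound) blast
  have "measurable_forms S (K * K) (\<lambda>t x y. rH (j x) (j y))"
  proof (rule constant_forms)
    show "bounded_bilinear (\<lambda>x y. rH (j x) (j y))"
      by (rule bounded_bilinear.comp[OF inner_like_bilinear[OF rH] j j])
    show "\<bar>rH (j x) (j y)\<bar> \<le> K * K * norm x * norm y" for x y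
      using inner_like_le[OF rH, of "j x" "j y"] mult_mono[OF K(2)[of x] K(2)[of y]] K(1) by (simp add: mult_ac)
  qed (use K in simp)
  then show ?thesis by blast
qed

lemmas a1_forms = lipschitz_forms_measurable[OF a1] and b1_forms = lipschitz_forms_measurable[OF b1]

lemma E_add:
  assumes \<rho>: "0 \<le> \<rho>" and "\<psi> \<in> L2 S" "\<psi>' \<in> L2 S" "\<zeta> \<in> L2 S"
  shows "E \<rho> (\<lambda>t. \<psi> t + \<psi>' t) \<zeta> = E \<rho> \<psi> \<zeta> + E \<rho> \<psi>' \<zeta>"
proof -
  obtain C where C: "measurable_forms S C (\<lambda>t x y. rH (j x) (j y))" using rHjj_forms by blast
  have 1: "Prim (\<lambda>t. \<psi> t + \<psi>' t) t = Prim \<psi> t + Prim \<psi>' t" if "t \<in> {0<..<S}" for t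
    by (rule Prim_add[OF L2_integrable[OF assms(2)] L2_integrable[OF assms(3)]]) (use that in simp)
  have 2: "Prim (Prim (\<lambda>t. \<psi> t + \<psi>' t)) t = Prim (Prim \<psi>) t + Prim (Prim \<psi>') t" if "t \<in> {0<..<S}" for t
  proof -
    have "Prim (Prim (\<lambda>t. \<psi> t + \<psi>' t)) t = Prim (\<lambda>t. Prim \<psi> t + Prim \<psi>' t) t"
      by (rule Prim_cong, rule 1) (use that in simp)
    also have "\<dots> = Prim (Prim \<psi>) t + Prim (Prim \<psi>') t"
      by (rule Prim_add[OF L2_integrable[OF Prim_L2[OF assms(2)]] L2_integrable[OF Prim_L2[OF assms(3)]]]) (use that in simp)
    finally show ?thesis .
  qed
  have w1: "wform \<rho> S c (Prim (\<lambda>t. \<psi> t + \<psi>' t)) \<zeta> = wform \<rho> S c (\<lambda>t. Prim \<psi> t + Prim \<psi>' t) \<zeta>" for c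
    by (rule wform_cong) (simp only: 1)
  have w2: "wform \<rho> S c (Prim (Prim (\<lambda>t. \<psi> t + \<psi>' t))) \<zeta> = wform \<rho> S c (\<lambda>t. Prim (Prim \<psi>) t + Prim (Prim \<psi>') t) \<zeta>" for c
    by (rule wform_cong) (simp only: 2)
  show ?thesis
    unfolding E_def w1 w2 wform_add[OF C \<rho> assms(2-4)]
      wform_add[OF b1_forms \<rho> Prim_L2[OF assms(2)] Prim_L2[OF assms(3)] assms(4)]
      wform_add[OF b2 \<rho> Prim_L2[OF assms(2)] Prim_L2[OF assms(3)] assms(4)]
      wform_add[OF a1_forms \<rho> Prim_L2[OF Prim_L2[OF assms(2)]] Prim_L2[OF Prim_L2[OF assms(3)]] assms(4)]
      wform_add[OF a2 \<rho> Prim_L2[OF Prim_L2[OF assms(2)]] Prim_L2[OF Prim_L2[OF assms(3)]] assms(4)]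
    by (simp only: ac_simps)
qed

lemma E_scale:
  assumes \<rho>: "0 \<le> \<rho>"
  shows "E \<rho> (\<lambda>t. r *\<^sub>R \<psi> t) \<zeta> = r * E \<rho> \<psi> \<zeta>"
proof -
  obtain C where C: "measurable_forms S C (\<lambda>t x y. rH (j x) (j y))" using rHjj_forms by blast
  have 1: "Prim (\<lambda>t. r *\<^sub>R g t) = (\<lambda>t. r *\<^sub>R Prim g t)" for g :: "real \<Rightarrow> 'v" by simp
  show ?thesis
    unfolding E_def 1 wform_scale[OF C \<rho>] wform_scale[OF b1_forms \<rho>] wform_scale[OF b2 \<rho>]
      wform_scale[OF a1_forms \<rho>] wform_scale[OF a2 \<rho>]
    by (simp only: distrib_left)
qed

lemma E_add_right:
  assumes \<rho>: "0 \<le> \<rho>" and "\<psi> \<in> L2 S" "\<zeta> \<in> L2 S" "\<zeta>' \<in> L2 S"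
  shows "E \<rho> \<psi> (\<lambda>t. \<zeta> t + \<zeta>' t) = E \<rho> \<psi> \<zeta> + E \<rho> \<psi> \<zeta>'"
proof -
  obtain C where C: "measurable_forms S C (\<lambda>t x y. rH (j x) (j y))" using rHjj_forms by blast
  show ?thesis
    unfolding E_def wform_add_right[OF C \<rho> assms(2-4)]
      wform_add_right[OF b1_forms \<rho> Prim_L2[OF assms(2)] assms(3,4)]
      wform_add_right[OF b2 \<rho> Prim_L2[OF assms(2)] assms(3,4)]
      wform_add_right[OF a1_forms \<rho> Prim_L2[OF Prim_L2[OF assms(2)]] assms(3,4)]
      wform_add_right[OF a2 \<rho> Prim_L2[OF Prim_L2[OF assms(2)]] assms(3,4)]
    by (simp only: ac_simps)
qed

lemma E_scale_right:
  assumes \<rho>: "0 \<le> \<rho>"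
  shows "E \<rho> \<psi> (\<lambda>t. r *\<^sub>R \<zeta> t) = r * E \<rho> \<psi> \<zeta>"
proof -
  obtain C where C: "measurable_forms S C (\<lambda>t x y. rH (j x) (j y))" using rHjj_forms by blast
  show ?thesis
    unfolding E_def wform_scale_right[OF C \<rho>] wform_scale_right[OF b1_forms \<rho>] wform_scale_right[OF b2 \<rho>]
      wform_scale_right[OF a1_forms \<rho>] wform_scale_right[OF a2 \<rho>]
    by (simp only: distrib_left)
qed

lemma affine_L2: "(\<lambda>t. u0 + t *\<^sub>R u1 :: 'v) \<in> L2 S"
  by (intro continuous_on_L2 continuous_intros)

lemma Lf_add:
  assumes \<rho>: "0 \<le> \<rho>" and "f \<in> L2 S" "\<zeta> \<in> L2 S" "\<zeta>' \<in> L2 S"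
  shows "Lf \<rho> f u0 u1 (\<lambda>t. \<zeta> t + \<zeta>' t) = Lf \<rho> f u0 u1 \<zeta> + Lf \<rho> f u0 u1 \<zeta>'"
proof -
  obtain C where C: "measurable_forms S C (\<lambda>t x y. rH x (j y))" using rHj_forms by blast
  show ?thesis
    unfolding Lf_def wform_add_right[OF C \<rho> assms(2-4)]
      wform_add_right[OF b1_forms \<rho> L2_const assms(3,4)] wform_add_right[OF b2 \<rho> L2_const assms(3,4)]
      wform_add_right[OF a1_forms \<rho> affine_L2 assms(3,4)] wform_add_right[OF a2 \<rho> affine_L2 assms(3,4)]
    by simp
qed

lemma Lf_scale:
  assumes \<rho>: "0 \<le> \<rho>"
  shows "Lf \<rho> f u0 u1 (\<lambda>t. r *\<^sub>R \<zeta> t) = r * Lf \<rho> f u0 u1 \<zeta>"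
proof -
  obtain C where C: "measurable_forms S C (\<lambda>t x y. rH x (j y))" using rHj_forms by blast
  show ?thesis
    unfolding Lf_def wform_scale_right[OF C \<rho>] wform_scale_right[OF b1_forms \<rho>] wform_scale_right[OF b2 \<rho>]
      wform_scale_right[OF a1_forms \<rho>] wform_scale_right[OF a2 \<rho>]
    by (simp only: right_diff_distrib)
qed

context
  fixes \<zeta> :: "nat \<Rightarrow> real \<Rightarrow> 'v" and \<rho> :: real
  assumes \<zeta>: "\<And>l. \<zeta> l \<in> L2 S" and \<rho>: "0 \<le> \<rho>"
begin

lemma span_L2: "(\<lambda>t. \<Sum>k<m. c k *\<^sub>R \<zeta> k t) \<in> L2 S"
  by (intro L2_sum L2_scaleR \<zeta>) simp

lemma E_sum: "\<eta> \<in> L2 S \<Longrightarrow> E \<rho> (\<lambda>t. \<Sum>k<m. c k *\<^sub>R \<zeta> k t) \<eta> = (\<Sum>k<m. c k * E \<rho> (\<zeta> k) \<eta>)"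
proof (induction m)
  case 0
  then show ?case using E_scale[OF \<rho>, of 0 "\<lambda>t. 0" \<eta>] by simp
next
  case (Suc m)
  then show ?case
    using E_add[OF \<rho> span_L2[where m=m and c=c] L2_scaleR[OF \<zeta>[of m], of "c m"] Suc.prems] by (simp add: E_scale[OF \<rho>])
qed

lemma E_sum_right: "\<eta> \<in> L2 S \<Longrightarrow> E \<rho> \<eta> (\<lambda>t. \<Sum>k<m. c k *\<^sub>R \<zeta> k t) = (\<Sum>k<m. c k * E \<rho> \<eta> (\<zeta> k))"
proof (induction m)
  case 0
  then show ?case using E_scale_right[OF \<rho>, of \<eta> 0 "\<lambda>t. 0"] by simp
next
  case (Suc m)
  then show ?case
    using E_add_right[OF \<rho> Suc.prems span_L2[where m=m and c=c] L2_scaleR[OF \<zeta>[of m], of "c m"]] by (simp add: E_scale_right[OF \<rho>])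
qed

lemma Lf_sum: "f \<in> L2 S \<Longrightarrow> Lf \<rho> f u0 u1 (\<lambda>t. \<Sum>k<m. c k *\<^sub>R \<zeta> k t) = (\<Sum>k<m. c k * Lf \<rho> f u0 u1 (\<zeta> k))"
proof (induction m)
  case 0
  then show ?case using Lf_scale[OF \<rho>, of f u0 u1 0 "\<lambda>t. 0"] by simp
next
  case (Suc m)
  then show ?case
    using Lf_add[OF \<rho> Suc.prems span_L2[where m=m and c=c] L2_scaleR[OF \<zeta>[of m], of "c m"], of u0 u1] by (simp add: Lf_scale[OF \<rho>])
qed

text \<open>
  The regularisation by \<open>\<epsilon>\<close> times the identity makes the Galerkin matrix invertible although the test
  functions need not be linearly independent; the energy bound shows that it is harmless as \<open>\<epsilon> \<rightarrow> 0\<close>.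
\<close>

lemma galerkin:
  assumes f: "f \<in> L2 S" and pos: "\<And>\<psi>. \<psi> \<in> L2 S \<Longrightarrow> 0 \<le> E \<rho> \<psi> \<psi>"
    and energy: "\<And>\<psi>. \<psi> \<in> L2 S \<Longrightarrow> \<kappa> * Nsq \<rho> \<psi> \<le> E \<rho> \<psi> \<psi> - Lf \<rho> f u0 u1 \<psi> + K"
    and \<kappa>: "0 < \<kappa>" and \<eta>: "0 < \<eta>"
  shows "\<exists>\<psi>\<in>L2 S. \<kappa> * Nsq \<rho> \<psi> \<le> K \<and> (\<forall>l<m. \<bar>E \<rho> \<psi> (\<zeta> l) - Lf \<rho> f u0 u1 (\<zeta> l)\<bar> \<le> \<eta>)"
proof -
  have N0: "0 \<le> Nsq \<rho> \<psi>" for \<psi> by (simp add: Nsq_def wsq_nonneg)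
  \<comment> \<open>The residual of equation l will be \<epsilon> times the coefficient
    \<open>c l\<close>, and the energy bound gives \<epsilon> times the sum of squared coefficients
    at most K. The squared residual is then at most \<epsilon> K, hence at most \<eta> squared. The
    summand 1 covers K = 0.\<close>
  define \<epsilon> where "\<epsilon> = \<eta>\<^sup>2 / (\<bar>K\<bar> + 1)"
  have \<epsilon>: "0 < \<epsilon>" using \<eta> by (simp add: \<epsilon>_def add_nonneg_pos)
  have \<epsilon>K: "\<epsilon> * K \<le> \<eta>\<^sup>2"
  proof -
    have "\<epsilon> * K \<le> \<epsilon> * (\<bar>K\<bar> + 1)" using \<epsilon> by (intro mult_left_mono) auto
    also have "\<dots> = \<eta>\<^sup>2" by (simp add: \<epsilon>_def)
    finally show ?thesis .
  qed
  define A where "A = (\<lambda>k l. E \<rho> (\<zeta> k) (\<zeta> l) + (if k = l then \<epsilon> else 0))"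
  have quad: "(\<Sum>k<m. \<Sum>l<m. c k * c l * A k l) =
      E \<rho> (\<lambda>t. \<Sum>k<m. c k *\<^sub>R \<zeta> k t) (\<lambda>t. \<Sum>k<m. c k *\<^sub>R \<zeta> k t) + \<epsilon> * (\<Sum>k<m. (c k)\<^sup>2)" for c
  proof -
    have "(\<Sum>k<m. \<Sum>l<m. c k * c l * A k l) = (\<Sum>k<m. (\<Sum>l<m. c k * (c l * E \<rho> (\<zeta> k) (\<zeta> l))) + \<epsilon> * (c k)\<^sup>2)"
    proof (rule sum.cong[OF refl])
      fix k assume "k \<in> {..<m}"
      have "(\<Sum>l<m. c k * c l * A k l) = (\<Sum>l<m. c k * (c l * E \<rho> (\<zeta> k) (\<zeta> l)) + (if k = l then c k * c l * \<epsilon> else 0))"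
        by (rule sum.cong[OF refl]) (simp add: A_def algebra_simps)
      also have "\<dots> = (\<Sum>l<m. c k * (c l * E \<rho> (\<zeta> k) (\<zeta> l))) + \<epsilon> * (c k)\<^sup>2"
        using \<open>k \<in> {..<m}\<close> by (simp add: sum.distrib power2_eq_square mult_ac)
      finally show "(\<Sum>l<m. c k * c l * A k l) = (\<Sum>l<m. c k * (c l * E \<rho> (\<zeta> k) (\<zeta> l))) + \<epsilon> * (c k)\<^sup>2" .
    qed
    also have "\<dots> = (\<Sum>k<m. c k * (\<Sum>l<m. c l * E \<rho> (\<zeta> k) (\<zeta> l))) + \<epsilon> * (\<Sum>k<m. (c k)\<^sup>2)"
      by (simp only: sum.distrib sum_distrib_left)
    also have "(\<Sum>k<m. c k * (\<Sum>l<m. c l * E \<rho> (\<zeta> k) (\<zeta> l))) = E \<rho> (\<lambda>t. \<Sum>k<m. c k *\<^sub>R \<zeta> k t) (\<lambda>t. \<Sum>k<m. c k *\<^sub>R \<zeta> k t)"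
      unfolding E_sum[OF span_L2] by (intro sum.cong refl arg_cong2[where f="(*)"] E_sum_right[symmetric] \<zeta>)
    finally show ?thesis .
  qed
  have "\<exists>c. \<forall>l<m. (\<Sum>k<m. c k * A k l) = Lf \<rho> f u0 u1 (\<zeta> l)"
  proof (rule positive_definite_solvable)
    fix c :: "nat \<Rightarrow> real" assume "\<exists>k<m. c k \<noteq> 0"
    then have "0 < (\<Sum>k<m. (c k)\<^sup>2)" by (auto intro!: sum_pos2)
    then show "0 < (\<Sum>k<m. \<Sum>l<m. c k * c l * A k l)"
      unfolding quad using pos[OF span_L2[where m=m and c=c]] \<epsilon> by (simp add: add_nonneg_pos)
  qed
  then obtain c where c: "\<And>l. l < m \<Longrightarrow> (\<Sum>k<m. c k * A k l) = Lf \<rho> f u0 u1 (\<zeta> l)" by blast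
  define \<psi> where "\<psi> = (\<lambda>t. \<Sum>k<m. c k *\<^sub>R \<zeta> k t)"
  have \<psi>: "\<psi> \<in> L2 S" unfolding \<psi>_def by (rule span_L2)
  have eq: "E \<rho> \<psi> (\<zeta> l) + \<epsilon> * c l = Lf \<rho> f u0 u1 (\<zeta> l)" if l: "l < m" for l
  proof -
    have "(\<Sum>k<m. c k * A k l) = (\<Sum>k<m. c k * E \<rho> (\<zeta> k) (\<zeta> l) + (if k = l then \<epsilon> * c k else 0))"
      by (rule sum.cong[OF refl]) (simp add: A_def algebra_simps)
    also have "\<dots> = E \<rho> \<psi> (\<zeta> l) + \<epsilon> * c l"
      unfolding \<psi>_def E_sum[OF \<zeta>] using l by (simp add: sum.distrib)
    finally show ?thesis using c[OF l] by simp
  qed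
  \<comment> \<open>Multiplying equation l by its coefficient and summing over l amounts to testing
    with \<psi> itself; the energy inequality then bounds \<open>Nsq\<close> and the coefficients at
    the same time.\<close>
  have "E \<rho> \<psi> \<psi> + \<epsilon> * (\<Sum>k<m. (c k)\<^sup>2) = (\<Sum>l<m. c l * (E \<rho> \<psi> (\<zeta> l) + \<epsilon> * c l))"
    using E_sum_right[OF \<psi>, where m=m and c=c] unfolding \<psi>_def[symmetric]
    by (simp add: distrib_left sum.distrib sum_distrib_left power2_eq_square mult_ac)
  also have "\<dots> = (\<Sum>l<m. c l * Lf \<rho> f u0 u1 (\<zeta> l))" by (rule sum.cong[OF refl]) (simp add: eq)
  also have "\<dots> = Lf \<rho> f u0 u1 \<psi>" unfolding \<psi>_def by (rule Lf_sum[OF f, symmetric])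
  finally have tot: "\<kappa> * Nsq \<rho> \<psi> + \<epsilon> * (\<Sum>k<m. (c k)\<^sup>2) \<le> K" using energy[OF \<psi>] by linarith
  have "0 \<le> \<epsilon> * (\<Sum>k<m. (c k)\<^sup>2)" using \<epsilon> by (simp add: sum_nonneg)
  moreover have "\<bar>E \<rho> \<psi> (\<zeta> l) - Lf \<rho> f u0 u1 (\<zeta> l)\<bar> \<le> \<eta>" if l: "l < m" for l
  proof -
    have "(c l)\<^sup>2 \<le> (\<Sum>k<m. (c k)\<^sup>2)" using l by (intro member_le_sum) auto
    then have "\<epsilon> * (c l)\<^sup>2 \<le> \<epsilon> * (\<Sum>k<m. (c k)\<^sup>2)" using \<epsilon> by simp
    also have "\<dots> \<le> K" using tot N0[of \<psi>] \<kappa> mult_nonneg_nonneg[of \<kappa> "Nsq \<rho> \<psi>"] by linarith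
    finally have "\<epsilon> * (\<epsilon> * (c l)\<^sup>2) \<le> \<epsilon> * K" using \<epsilon> by simp
    then have "(\<epsilon> * c l)\<^sup>2 \<le> \<eta>\<^sup>2" using \<epsilon>K by (simp add: power2_eq_square mult_ac)
    then have "\<bar>\<epsilon> * c l\<bar> \<le> \<eta>" using \<eta> by (intro power2_le_imp_le[of "\<bar>\<epsilon> * c l\<bar>"]) auto
    then show ?thesis using eq[OF l] by linarith
  qed
  moreover have "\<kappa> * Nsq \<rho> \<psi> \<le> K" using tot calculation(1) by linarith
  ultimately show ?thesis using \<psi> by blast
qed

end

end

section \<open>Existence\<close>

text \<open>The factor e^(\<rho> t) cancels the weight, so such a test yields the plain integral
  over (0,r) against a fixed vector.\<close>

lemma wform_indicator_test:
  assumes "\<And>t. t \<in> {0..S} \<Longrightarrow> bounded_bilinear (c t)"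
  shows "wform \<rho> S c g (\<lambda>t. (exp (\<rho> * t) * indicator {..<r} t) *\<^sub>R x) = (\<integral>t. indicator {..<r} t * c t (g t) x \<partial>Leb S)"
  unfolding wform_def
proof (rule Bochner_Integration.integral_cong[OF refl])
  fix t assume "t \<in> space (Leb S)"
  then have "t \<in> {0..S}" by simp
  then interpret bounded_bilinear "c t" by (rule assms)
  show "exp (- \<rho> * t) * c t (g t) ((exp (\<rho> * t) * indicator {..<r} t) *\<^sub>R x) = indicator {..<r} t * c t (g t) x"
    by (simp add: scaleR_right mult.assoc[symmetric] exp_add[symmetric])
qed

context damped_problem
begin

lemma Nsq_nonneg: "0 \<le> Nsq \<rho> \<psi>"
  by (simp add: Nsq_def wsq_nonneg)

text \<open>Each summand of \<open>Nsq\<close> is the squared norm of a linear image of the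
  function: its composition with j, its primitive, or the end value of the primitive.\<close>

lemma Nsq_parallelogram:
  assumes \<rho>: "0 \<le> \<rho>" and f: "f \<in> L2 S" and g: "g \<in> L2 S"
  shows "Nsq \<rho> (\<lambda>t. f t - g t) = 2 * Nsq \<rho> f + 2 * Nsq \<rho> g - 4 * Nsq \<rho> (\<lambda>t. (1/2) *\<^sub>R (f t + g t))"
proof -
  interpret j: bounded_linear j by (rule j)
  have pd: "Prim (\<lambda>s. f s - g s) t = Prim f t - Prim g t" if "t \<le> S" for t
    by (rule Prim_diff[OF L2_integrable[OF f] L2_integrable[OF g] that])
  have pm: "Prim (\<lambda>s. (1/2) *\<^sub>R (f s + g s)) t = (1/2) *\<^sub>R (Prim f t + Prim g t)" if "t \<le> S" for t
    using Prim_add[OF L2_integrable[OF f] L2_integrable[OF g] that] by (simp del: scaleR_add_right)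
  have cong: "wsq \<rho> S h = wsq \<rho> S k" if "\<And>t. t \<in> {0<..<S} \<Longrightarrow> h t = k t" for h k :: "real \<Rightarrow> 'v"
    unfolding wsq_def by (rule Bochner_Integration.integral_cong) (auto simp: that)
  have 1: "wsq \<rho> S (\<lambda>t. j (f t - g t)) = 2 * wsq \<rho> S (\<lambda>t. j (f t)) + 2 * wsq \<rho> S (\<lambda>t. j (g t))
      - 4 * wsq \<rho> S (\<lambda>t. j ((1/2) *\<^sub>R (f t + g t)))"
    using wsq_parallelogram[OF rH \<rho> j_L2[OF f] j_L2[OF g]] by (simp only: j.diff j.add j.scaleR)
  have "wsq \<rho> S (Prim (\<lambda>t. f t - g t)) = wsq \<rho> S (\<lambda>t. Prim f t - Prim g t)"
    by (rule cong, rule pd) simp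
  also have "\<dots> = 2 * wsq \<rho> S (Prim f) + 2 * wsq \<rho> S (Prim g) - 4 * wsq \<rho> S (\<lambda>t. (1/2) *\<^sub>R (Prim f t + Prim g t))"
    by (rule wsq_parallelogram[OF rV \<rho> Prim_L2[OF f] Prim_L2[OF g]])
  also have "wsq \<rho> S (\<lambda>t. (1/2) *\<^sub>R (Prim f t + Prim g t)) = wsq \<rho> S (Prim (\<lambda>t. (1/2) *\<^sub>R (f t + g t)))"
    by (rule cong, rule pm[symmetric]) simp
  finally have 2: "wsq \<rho> S (Prim (\<lambda>t. f t - g t)) = 2 * wsq \<rho> S (Prim f) + 2 * wsq \<rho> S (Prim g)
      - 4 * wsq \<rho> S (Prim (\<lambda>t. (1/2) *\<^sub>R (f t + g t)))" .
  have 3: "(norm (Prim (\<lambda>t. f t - g t) S))\<^sup>2 = 2 * (norm (Prim f S))\<^sup>2 + 2 * (norm (Prim g S))\<^sup>2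
      - 4 * (norm (Prim (\<lambda>t. (1/2) *\<^sub>R (f t + g t)) S))\<^sup>2"
    unfolding pd[OF order_refl] pm[OF order_refl] by (rule inner_like_parallelogram[OF rV])
  show ?thesis unfolding Nsq_def 1 2 3 by (simp only: algebra_simps)
qed

text \<open>The tests depend on \<rho> because \<rho> is chosen by the energy estimate, while the
  tests used later contain e^(\<rho> t). The approximations converge only through their images under
  j, their primitives and their end values, so the limit consists of \<open>w\<close>,
  \<open>v\<close> and \<open>z\<close>, tied together by the two relations with
  \<open>Prim w\<close>.\<close>

lemma weak_solution:
  fixes \<zeta> :: "real \<Rightarrow> nat \<Rightarrow> real \<Rightarrow> 'v"
  assumes f: "f \<in> L2 S" and \<zeta>: "\<And>\<rho> l. \<zeta> \<rho> l \<in> L2 S"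
  obtains \<rho> w v z where "0 \<le> \<rho>" "w \<in> L2 S" "v \<in> L2 S"
    "AE t in Leb S. j (v t) = Prim w t" "j z = Prim w S"
    "\<And>l. wform \<rho> S (\<lambda>t x y. rH x (j y)) w (\<zeta> \<rho> l) + wform \<rho> S b1 v (\<zeta> \<rho> l) + wform \<rho> S b2 v (\<zeta> \<rho> l)
      + wform \<rho> S a1 (Prim v) (\<zeta> \<rho> l) + wform \<rho> S a2 (Prim v) (\<zeta> \<rho> l) = Lf \<rho> f u0 u1 (\<zeta> \<rho> l)"
proof -
  interpret j: bounded_linear j by (rule j)
  obtain \<rho> \<kappa> K where \<rho>: "0 \<le> \<rho>" and \<kappa>: "0 < \<kappa>" and pos: "\<And>\<psi>. \<psi> \<in> L2 S \<Longrightarrow> 0 \<le> E \<rho> \<psi> \<psi>"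
    and en: "\<And>\<psi>. \<psi> \<in> L2 S \<Longrightarrow> \<kappa> * Nsq \<rho> \<psi> \<le> E \<rho> \<psi> \<psi> - Lf \<rho> f u0 u1 \<psi> + K"
    using energy[OF f, of u0 u1] by blast
  let ?\<zeta> = "\<zeta> \<rho>"
  \<comment> \<open>\<open>F n\<close> collects the bounded approximate solutions of the first n
    equations, with tolerance 1 / Suc n. These sets are non-empty by \<open>galerkin\<close>,
    decreasing and closed under midpoints, as \<open>nested_midpoint_Cauchy\<close>
    requires.\<close>
  define F where "F = (\<lambda>n. {\<psi> \<in> L2 S. \<kappa> * Nsq \<rho> \<psi> \<le> K \<and> (\<forall>l<n. \<bar>E \<rho> \<psi> (?\<zeta> l) - Lf \<rho> f u0 u1 (?\<zeta> l)\<bar> \<le> 1 / Suc n)})"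
  have FL2: "\<psi> \<in> L2 S" if "\<psi> \<in> F n" for \<psi> n using that by (simp add: F_def)
  have FK: "\<kappa> * Nsq \<rho> \<psi> \<le> K" if "\<psi> \<in> F n" for \<psi> n using that by (simp add: F_def)
  have FE: "\<bar>E \<rho> \<psi> (?\<zeta> l) - Lf \<rho> f u0 u1 (?\<zeta> l)\<bar> \<le> 1 / Suc n" if "\<psi> \<in> F n" "l < n" for \<psi> n l
    using that by (simp add: F_def)
  obtain W where W: "\<And>n. W n \<in> F n"
    and Cau: "\<And>e. e > 0 \<Longrightarrow> \<exists>n0. \<forall>m\<ge>n0. \<forall>n\<ge>n0. Nsq \<rho> (\<lambda>t. W m t - W n t) < e"
  proof (rule nested_midpoint_Cauchy[where F=F and N="Nsq \<rho>" and K="K / \<kappa>"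
        and mid="\<lambda>x y t. (1/2) *\<^sub>R (x t + y t)" and D="\<lambda>x y. Nsq \<rho> (\<lambda>t. x t - y t)"])
    show "F n \<noteq> {}" for n
      using galerkin[of ?\<zeta>, OF \<zeta> \<rho> f pos en \<kappa>, of "1 / Suc n" n] unfolding F_def by auto
    show "decseq F"
    proof (rule decseq_SucI, rule subsetI)
      fix n \<psi> assume \<psi>: "\<psi> \<in> F (Suc n)"
      have "1 / real (Suc (Suc n)) \<le> 1 / real (Suc n)" by (intro divide_left_mono) auto
      then have "\<bar>E \<rho> \<psi> (?\<zeta> l) - Lf \<rho> f u0 u1 (?\<zeta> l)\<bar> \<le> 1 / Suc n" if "l < n" for l
        using FE[OF \<psi>, of l] that by linarith
      then show "\<psi> \<in> F n" using FL2[OF \<psi>] FK[OF \<psi>] by (simp add: F_def)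
    qed
    show par: "Nsq \<rho> (\<lambda>t. x t - y t) = 2 * Nsq \<rho> x + 2 * Nsq \<rho> y - 4 * Nsq \<rho> (\<lambda>t. (1/2) *\<^sub>R (x t + y t))"
      if "x \<in> F 0" "y \<in> F 0" for x y
      by (rule Nsq_parallelogram[OF \<rho> FL2[OF that(1)] FL2[OF that(2)]])
    show "0 \<le> Nsq \<rho> x" for x by (rule Nsq_nonneg)
    show "Nsq \<rho> x \<le> K / \<kappa>" if "x \<in> F 0" for x
      using FK[OF that] \<kappa> by (simp add: pos_le_divide_eq mult.commute)
    show "(\<lambda>t. (1/2) *\<^sub>R (x t + y t)) \<in> F n" if x: "x \<in> F n" and y: "y \<in> F n" for n x y
    proof -
      let ?m = "\<lambda>t. (1/2) *\<^sub>R (x t + y t)"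
      have m: "?m \<in> L2 S" by (intro L2_scaleR L2_add FL2[OF x] FL2[OF y])
      have "4 * Nsq \<rho> ?m \<le> 2 * Nsq \<rho> x + 2 * Nsq \<rho> y"
        using Nsq_parallelogram[OF \<rho> FL2[OF x] FL2[OF y]] Nsq_nonneg[of \<rho> "\<lambda>t. x t - y t"] by linarith
      then have "Nsq \<rho> ?m \<le> (Nsq \<rho> x + Nsq \<rho> y) / 2" by simp
      from mult_left_mono[OF this, of \<kappa>] have "\<kappa> * Nsq \<rho> ?m \<le> (\<kappa> * Nsq \<rho> x + \<kappa> * Nsq \<rho> y) / 2"
        using \<kappa> by (simp add: algebra_simps)
      then have 1: "\<kappa> * Nsq \<rho> ?m \<le> K" using FK[OF x] FK[OF y] by simp
      have "\<bar>E \<rho> ?m (?\<zeta> l) - Lf \<rho> f u0 u1 (?\<zeta> l)\<bar> \<le> 1 / Suc n" if l: "l < n" for l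
      proof -
        have eq: "E \<rho> ?m (?\<zeta> l) = (E \<rho> x (?\<zeta> l) + E \<rho> y (?\<zeta> l)) / 2"
          unfolding E_scale[OF \<rho>] E_add[OF \<rho> FL2[OF x] FL2[OF y] \<zeta>] by simp
        have avg: "\<bar>(p + q) / 2 - c\<bar> \<le> e" if "\<bar>p - c\<bar> \<le> e" "\<bar>q - c\<bar> \<le> e" for p q c e :: real
          unfolding add_divide_distrib using that by (intro abs_leI) linarith+
        show ?thesis unfolding eq by (rule avg[OF FE[OF x l] FE[OF y l]])
      qed
      then show ?thesis using m 1 by (simp only: F_def mem_Collect_eq) blast
    qed
  qed blast
  have WL2: "W n \<in> L2 S" for n by (rule FL2[OF W])
  have dL2: "(\<lambda>t. W m t - W n t) \<in> L2 S" for m n by (rule L2_diff[OF WL2 WL2])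
  have pd: "Prim (\<lambda>s. W m s - W n s) t = Prim (W m) t - Prim (W n) t" if "t \<le> S" for t m n
    by (rule Prim_diff[OF L2_integrable[OF WL2] L2_integrable[OF WL2] that])
  \<comment> \<open>The weight is at least e^(-\<rho> S) on the interval, so \<open>ex\<close>
    converts the weighted Cauchy property into unweighted ones for the three components.\<close>
  define ex where "ex = exp (\<rho> * S)"
  have ex: "0 < ex" "ex * exp (- \<rho> * S) = 1" by (simp_all add: ex_def exp_minus_inverse)
  have Cau_w: "\<exists>N. \<forall>m\<ge>N. \<forall>n\<ge>N. (\<integral>t. (norm (j (W m t) - j (W n t)))\<^sup>2 \<partial>Leb S) < e"
    and Cau_v: "\<exists>N. \<forall>m\<ge>N. \<forall>n\<ge>N. (\<integral>t. (norm (Prim (W m) t - Prim (W n) t))\<^sup>2 \<partial>Leb S) < e"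
    and Cau_z: "\<exists>N. \<forall>m\<ge>N. \<forall>n\<ge>N. (norm (Prim (W m) S - Prim (W n) S))\<^sup>2 < e" if e: "e > 0" for e
  proof -
    obtain N where N: "\<And>m n. m \<ge> N \<Longrightarrow> n \<ge> N \<Longrightarrow> Nsq \<rho> (\<lambda>t. W m t - W n t) < e / ex"
      using Cau[of "e / ex"] e ex by auto
    have bd: "ex * Nsq \<rho> (\<lambda>t. W m t - W n t) < e" if "m \<ge> N" "n \<ge> N" for m n
      using N[OF that] ex by (simp add: pos_less_divide_eq mult.commute)
    have le: "ex * wsq \<rho> S (\<lambda>t. j (W m t - W n t)) \<le> ex * Nsq \<rho> (\<lambda>t. W m t - W n t)"
      "ex * wsq \<rho> S (Prim (\<lambda>t. W m t - W n t)) \<le> ex * Nsq \<rho> (\<lambda>t. W m t - W n t)"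
      "ex * (exp (- \<rho> * S) * (norm (Prim (\<lambda>t. W m t - W n t) S))\<^sup>2) \<le> ex * Nsq \<rho> (\<lambda>t. W m t - W n t)" for m n
      using ex by (intro mult_left_mono; simp add: Nsq_def wsq_nonneg add_nonneg_nonneg)+
    show "\<exists>N. \<forall>m\<ge>N. \<forall>n\<ge>N. (\<integral>t. (norm (j (W m t) - j (W n t)))\<^sup>2 \<partial>Leb S) < e"
    proof (intro exI[of _ N] allI impI)
      fix m n assume mn: "N \<le> m" "N \<le> n"
      have "(\<integral>t. (norm (j (W m t - W n t)))\<^sup>2 \<partial>Leb S) \<le> ex * wsq \<rho> S (\<lambda>t. j (W m t - W n t))"
        unfolding ex_def by (rule integral_le_wsq[OF \<rho> j_L2[OF dL2]])
      then show "(\<integral>t. (norm (j (W m t) - j (W n t)))\<^sup>2 \<partial>Leb S) < e"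
        using le(1)[of m n] bd[OF mn] by (simp add: j.diff)
    qed
    show "\<exists>N. \<forall>m\<ge>N. \<forall>n\<ge>N. (\<integral>t. (norm (Prim (W m) t - Prim (W n) t))\<^sup>2 \<partial>Leb S) < e"
    proof (intro exI[of _ N] allI impI)
      fix m n assume mn: "N \<le> m" "N \<le> n"
      have "(\<integral>t. (norm (Prim (\<lambda>t. W m t - W n t) t))\<^sup>2 \<partial>Leb S) \<le> ex * wsq \<rho> S (Prim (\<lambda>t. W m t - W n t))"
        unfolding ex_def by (rule integral_le_wsq[OF \<rho> Prim_L2[OF dL2]])
      moreover have "(\<integral>t. (norm (Prim (\<lambda>t. W m t - W n t) t))\<^sup>2 \<partial>Leb S) = (\<integral>t. (norm (Prim (W m) t - Prim (W n) t))\<^sup>2 \<partial>Leb S)"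
      proof (rule Bochner_Integration.integral_cong[OF refl])
        fix t assume "t \<in> space (Leb S)"
        then have "t \<le> S" by simp
        then show "(norm (Prim (\<lambda>t. W m t - W n t) t))\<^sup>2 = (norm (Prim (W m) t - Prim (W n) t))\<^sup>2" by (simp only: pd)
      qed
      ultimately show "(\<integral>t. (norm (Prim (W m) t - Prim (W n) t))\<^sup>2 \<partial>Leb S) < e"
        using le(2)[of m n] bd[OF mn] by linarith
    qed
    show "\<exists>N. \<forall>m\<ge>N. \<forall>n\<ge>N. (norm (Prim (W m) S - Prim (W n) S))\<^sup>2 < e"
    proof (intro exI[of _ N] allI impI)
      fix m n assume mn: "N \<le> m" "N \<le> n"
      have "(norm (Prim (\<lambda>t. W m t - W n t) S))\<^sup>2 < e"
        using le(3)[of m n] bd[OF mn] unfolding mult.assoc[symmetric] ex(2) by simp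
      then show "(norm (Prim (W m) S - Prim (W n) S))\<^sup>2 < e" unfolding pd[OF order_refl] .
    qed
  qed
  obtain w r1 where w: "w \<in> L2 S" "(\<lambda>n. \<integral>t. (norm (j (W n t) - w t))\<^sup>2 \<partial>Leb S) \<longlonglongrightarrow> 0"
    and "strict_mono (r1 :: nat \<Rightarrow> nat)" "AE t in Leb S. (\<lambda>n. j (W (r1 n) t)) \<longlonglongrightarrow> w t"
    by (rule L2_complete[of "\<lambda>n t. j (W n t)" S, OF j_L2[OF WL2] Cau_w])
  obtain v r where v: "v \<in> L2 S" "(\<lambda>n. \<integral>t. (norm (Prim (W n) t - v t))\<^sup>2 \<partial>Leb S) \<longlonglongrightarrow> 0"
    and r: "strict_mono r" "AE t in Leb S. (\<lambda>n. Prim (W (r n)) t) \<longlonglongrightarrow> v t"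
    by (rule L2_complete[of "\<lambda>n t. Prim (W n) t" S, OF Prim_L2[OF WL2] Cau_v])
  have "Cauchy (\<lambda>n. Prim (W n) S)"
  proof (rule metric_CauchyI)
    fix e :: real assume e: "e > 0"
    then obtain N where N: "\<And>m n. m \<ge> N \<Longrightarrow> n \<ge> N \<Longrightarrow> (norm (Prim (W m) S - Prim (W n) S))\<^sup>2 < e\<^sup>2"
      using Cau_z[of "e\<^sup>2"] by auto
    have "dist (Prim (W m) S) (Prim (W n) S) < e" if "m \<ge> N" "n \<ge> N" for m n
      unfolding dist_norm by (rule power_less_imp_less_base[OF N[OF that]]) (use e in simp)
    then show "\<exists>N. \<forall>m\<ge>N. \<forall>n\<ge>N. dist (Prim (W m) S) (Prim (W n) S) < e" by blast
  qed
  then obtain z where z: "(\<lambda>n. Prim (W n) S) \<longlonglongrightarrow> z" by (auto simp: Cauchy_convergent_iff convergent_def)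
  have jPrim: "Prim (\<lambda>t. j (W n t)) t = j (Prim (W n) t)" if "t \<le> S" for n t
    by (rule integral_bounded_linear[OF j integrable_Leb_mono[OF L2_integrable[OF WL2] that]])
  \<comment> \<open>In H the primitives converge at every time, while in V pointwise convergence is
    known only almost everywhere along a subsequence. Comparing the two limits in H identifies j
    v.\<close>
  have lim_w: "(\<lambda>n. j (Prim (W n) t)) \<longlonglongrightarrow> Prim w t" if "t \<le> S" for t
    using L2_tendsto_Prim(1)[of "\<lambda>n t. j (W n t)", OF j_L2[OF WL2] w that] unfolding jPrim[OF that] .
  have jv: "AE t in Leb S. j (v t) = Prim w t"
    using r(2) AE_space
  proof eventually_elim
    case (elim t)
    then have "t \<le> S" by simp
    have "(\<lambda>n. j (Prim (W (r n)) t)) \<longlonglongrightarrow> Prim w t"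
      using LIMSEQ_subseq_LIMSEQ[OF lim_w[OF \<open>t \<le> S\<close>] r(1)] by (simp only: comp_def)
    moreover have "(\<lambda>n. j (Prim (W (r n)) t)) \<longlonglongrightarrow> j (v t)" by (rule j.tendsto[OF elim(1)])
    ultimately show ?case by (rule LIMSEQ_unique[rotated])
  qed
  have jz: "j z = Prim w S"
    by (rule LIMSEQ_unique[OF j.tendsto[OF z] lim_w[OF order_refl]])
  obtain C where C: "measurable_forms S C (\<lambda>t x y. rH x (j y))" using rHj_forms by blast
  have PL2: "Prim (W n) \<in> L2 S" for n by (rule Prim_L2[OF WL2])
  note PP = L2_tendsto_Prim(2)[of "\<lambda>n. Prim (W n)", OF PL2 v]
  have eq: "wform \<rho> S (\<lambda>t x y. rH x (j y)) w (?\<zeta> l) + wform \<rho> S b1 v (?\<zeta> l) + wform \<rho> S b2 v (?\<zeta> l)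
      + wform \<rho> S a1 (Prim v) (?\<zeta> l) + wform \<rho> S a2 (Prim v) (?\<zeta> l) = Lf \<rho> f u0 u1 (?\<zeta> l)" for l
  proof (rule LIMSEQ_unique)
    have "(\<lambda>n. wform \<rho> S (\<lambda>t x y. rH x (j y)) (\<lambda>t. j (W n t)) (?\<zeta> l) + wform \<rho> S b1 (Prim (W n)) (?\<zeta> l) + wform \<rho> S b2 (Prim (W n)) (?\<zeta> l)
      + wform \<rho> S a1 (Prim (Prim (W n))) (?\<zeta> l) + wform \<rho> S a2 (Prim (Prim (W n))) (?\<zeta> l))
      \<longlonglongrightarrow> wform \<rho> S (\<lambda>t x y. rH x (j y)) w (?\<zeta> l) + wform \<rho> S b1 v (?\<zeta> l) + wform \<rho> S b2 v (?\<zeta> l)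
      + wform \<rho> S a1 (Prim v) (?\<zeta> l) + wform \<rho> S a2 (Prim v) (?\<zeta> l)"
      by (intro tendsto_add
          wform_tendsto[OF C \<rho> j_L2[OF WL2] w(1) \<zeta> w(2)]
          wform_tendsto[OF b1_forms \<rho> PL2 v(1) \<zeta> v(2)] wform_tendsto[OF b2 \<rho> PL2 v(1) \<zeta> v(2)]
          wform_tendsto[OF a1_forms \<rho> Prim_L2[OF PL2] Prim_L2[OF v(1)] \<zeta> PP]
          wform_tendsto[OF a2 \<rho> Prim_L2[OF PL2] Prim_L2[OF v(1)] \<zeta> PP])
    \<comment> \<open>The form \<open>rH (j x) (j y)\<close> at \<open>W n\<close> is
      \<open>rH x (j y)\<close> at j o \<open>W n\<close>; the second reading passes to the limit,
      since no convergence of \<open>W n\<close> in V is available.\<close>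
    then show "(\<lambda>n. E \<rho> (W n) (?\<zeta> l)) \<longlonglongrightarrow> wform \<rho> S (\<lambda>t x y. rH x (j y)) w (?\<zeta> l) + wform \<rho> S b1 v (?\<zeta> l) + wform \<rho> S b2 v (?\<zeta> l)
      + wform \<rho> S a1 (Prim v) (?\<zeta> l) + wform \<rho> S a2 (Prim v) (?\<zeta> l)"
      by (simp only: E_def wform_def)
    show "(\<lambda>n. E \<rho> (W n) (?\<zeta> l)) \<longlonglongrightarrow> Lf \<rho> f u0 u1 (?\<zeta> l)"
    proof (rule Lim_null[THEN iffD2], rule Lim_null_comparison)
      \<comment> \<open>Equation l belongs to the constraints of \<open>F n\<close> as soon as n >
        l.\<close>
      show "eventually (\<lambda>n. norm (E \<rho> (W n) (?\<zeta> l) - Lf \<rho> f u0 u1 (?\<zeta> l)) \<le> 1 / Suc n) sequentially"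
        using eventually_gt_at_top[of l] by eventually_elim (use FE[OF W] in simp)
      show "(\<lambda>n. 1 / Suc n) \<longlonglongrightarrow> 0" by (rule LIMSEQ_Suc[OF lim_1_over_n])
    qed
  qed
  show thesis by (rule that[OF \<rho> w(1) v(1) jv jz eq])
qed

text \<open>Countably many tests suffice: rational r and vectors x from a countable dense set. For
  fixed x, continuity of the primitive passes from rational to all r, so the residual vanishes
  almost everywhere; the countably many null sets are united, and density of the vectors completes
  the argument.\<close>

theorem existence:
  assumes f: "f \<in> L2 S"
  obtains v w z where "v \<in> L2 S" "w \<in> L2 S" "AE t in Leb S. j (v t) = j u1 + Prim w t" "j z = j u1 + Prim w S"
    "AE t in Leb S. \<forall>x. rH (w t) (j x) + b1 t (v t) x + b2 t (v t) x
        + a1 t (u0 + Prim v t) x + a2 t (u0 + Prim v t) x = rH (f t) (j x)"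
proof -
  interpret j: bounded_linear j by (rule j)
  obtain X :: "'v set" where X: "countable X" "\<And>U. open U \<Longrightarrow> U \<noteq> {} \<Longrightarrow> \<exists>x\<in>X. x \<in> U"
    by (rule countable_dense_setE) blast
  have Xne: "X \<noteq> {}" using X(2)[of UNIV] by auto
  \<comment> \<open>The index l codes a pair: its first component enumerates the rational r, its
    second the vector x.\<close>
  define \<zeta> where "\<zeta> = (\<lambda>\<rho> l t. (exp (\<rho> * t) * indicator {..<from_nat_into \<rat> (fst (prod_decode l))} t) *\<^sub>R from_nat_into X (snd (prod_decode l)))"
  have \<zeta>: "\<zeta> \<rho> l \<in> L2 S" for \<rho> l
  proof (rule L2_bounded)
    show "\<zeta> \<rho> l \<in> borel_measurable (Leb S)" unfolding \<zeta>_def by (rule borel_measurable_Leb) simp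
    fix t assume t: "t \<in> {0<..<S}"
    have "\<rho> * t \<le> \<bar>\<rho>\<bar> * S"
      using t by (intro mult_mono) auto
    then have "exp (\<rho> * t) * norm x \<le> exp (\<bar>\<rho>\<bar> * S) * norm x" for x :: 'v by (intro mult_right_mono) auto
    then show "norm (\<zeta> \<rho> l t) \<le> exp (\<bar>\<rho>\<bar> * S) * norm (from_nat_into X (snd (prod_decode l)))"
      by (simp add: \<zeta>_def indicator_def)
  qed
  obtain \<rho> w v0 z0 where \<rho>: "0 \<le> \<rho>" and w: "w \<in> L2 S" and v0: "v0 \<in> L2 S"
    and jv0: "AE t in Leb S. j (v0 t) = Prim w t" and jz0: "j z0 = Prim w S"
    and weak: "\<And>l. wform \<rho> S (\<lambda>t x y. rH x (j y)) w (\<zeta> \<rho> l) + wform \<rho> S b1 v0 (\<zeta> \<rho> l) + wform \<rho> S b2 v0 (\<zeta> \<rho> l)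
      + wform \<rho> S a1 (Prim v0) (\<zeta> \<rho> l) + wform \<rho> S a2 (Prim v0) (\<zeta> \<rho> l) = Lf \<rho> f u0 u1 (\<zeta> \<rho> l)"
    using weak_solution[where \<zeta>=\<zeta> and ?u0.0=u0 and ?u1.0=u1, OF f \<zeta>] by blast
  \<comment> \<open>The affine part that carries the initial data, moved to the right-hand side in
    \<open>Lf\<close>, is added back.\<close>
  define v where "v = (\<lambda>t. v0 t + u1)"
  define u where "u = (\<lambda>t. Prim v0 t + (u0 + t *\<^sub>R u1))"
  have v: "v \<in> L2 S" unfolding v_def by (intro L2_add v0 L2_const)
  have u: "u \<in> L2 S" unfolding u_def by (intro L2_add Prim_L2[OF v0] affine_L2)
  have u_eq: "u0 + Prim v t = u t" if "0 \<le> t" "t \<le> S" for t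
    unfolding v_def u_def Prim_add[OF L2_integrable[OF v0] integrable_Leb_const that(2)]
    using that(1) by (simp add: measure_restrict_space)
  obtain C where C: "measurable_forms S C (\<lambda>t x y. rH x (j y))" using rHj_forms by blast
  \<comment> \<open>\<open>G x t\<close> is the residual of the equation at time t, paired with
    x.\<close>
  define G where "G = (\<lambda>x t. rH (w t) (j x) + b1 t (v t) x + b2 t (v t) x + a1 t (u t) x + a2 t (u t) x - rH (f t) (j x))"
  have ints: "integrable (Leb S) (\<lambda>t. rH (w t) (j x))" "integrable (Leb S) (\<lambda>t. b1 t (v t) x)" "integrable (Leb S) (\<lambda>t. b2 t (v t) x)"
    "integrable (Leb S) (\<lambda>t. a1 t (u t) x)" "integrable (Leb S) (\<lambda>t. a2 t (u t) x)" "integrable (Leb S) (\<lambda>t. rH (f t) (j x))" for x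
    using forms_integrable[OF C w L2_const] forms_integrable[OF b1_forms v L2_const] forms_integrable[OF b2 v L2_const]
      forms_integrable[OF a1_forms u L2_const] forms_integrable[OF a2 u L2_const] forms_integrable[OF C f L2_const] .
  have G: "integrable (Leb S) (G x)" for x
    unfolding G_def by (intro Bochner_Integration.integrable_add Bochner_Integration.integrable_diff ints)
  have rat: "Prim (G x) r = 0" if r: "r \<in> \<rat>" "r \<le> S" and x: "x \<in> X" for r x
  proof -
    obtain p q where p: "r = from_nat_into \<rat> p" and q: "x = from_nat_into X q"
      using from_nat_into_surj[OF countable_rat r(1)] from_nat_into_surj[OF X(1) x] by metis
    let ?\<zeta> = "\<zeta> \<rho> (prod_encode (p, q))"
    have \<zeta>pq: "?\<zeta> = (\<lambda>t. (exp (\<rho> * t) * indicator {..<r} t) *\<^sub>R x)" unfolding \<zeta>_def p q by simp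
    let ?I = "\<lambda>h. \<integral>t. indicator {..<r} t * h t \<partial>Leb S"
    note bil = bounded_forms_bilinear[OF measurable_forms_bounded]
    let ?T = "\<lambda>t. (exp (\<rho> * t) * indicator {..<r} t) *\<^sub>R x"
    have ind: "wform \<rho> S (\<lambda>t x y. rH x (j y)) h ?T = ?I (\<lambda>t. rH (h t) (j x))" "wform \<rho> S b1 g ?T = ?I (\<lambda>t. b1 t (g t) x)"
      "wform \<rho> S b2 g ?T = ?I (\<lambda>t. b2 t (g t) x)" "wform \<rho> S a1 g ?T = ?I (\<lambda>t. a1 t (g t) x)"
      "wform \<rho> S a2 g ?T = ?I (\<lambda>t. a2 t (g t) x)" for g h
      by (rule wform_indicator_test, erule bil[OF C], rule wform_indicator_test, erule bil[OF b1_forms],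
          rule wform_indicator_test, erule bil[OF b2], rule wform_indicator_test, erule bil[OF a1_forms],
          rule wform_indicator_test, erule bil[OF a2])
    have "wform \<rho> S b1 v ?\<zeta> = wform \<rho> S b1 v0 ?\<zeta> + wform \<rho> S b1 (\<lambda>t. u1) ?\<zeta>"
      "wform \<rho> S b2 v ?\<zeta> = wform \<rho> S b2 v0 ?\<zeta> + wform \<rho> S b2 (\<lambda>t. u1) ?\<zeta>"
      "wform \<rho> S a1 u ?\<zeta> = wform \<rho> S a1 (Prim v0) ?\<zeta> + wform \<rho> S a1 (\<lambda>t. u0 + t *\<^sub>R u1) ?\<zeta>"
      "wform \<rho> S a2 u ?\<zeta> = wform \<rho> S a2 (Prim v0) ?\<zeta> + wform \<rho> S a2 (\<lambda>t. u0 + t *\<^sub>R u1) ?\<zeta>"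
      unfolding v_def u_def
      by (rule wform_add[OF b1_forms \<rho> v0 L2_const \<zeta>], rule wform_add[OF b2 \<rho> v0 L2_const \<zeta>],
          rule wform_add[OF a1_forms \<rho> Prim_L2[OF v0] affine_L2 \<zeta>], rule wform_add[OF a2 \<rho> Prim_L2[OF v0] affine_L2 \<zeta>])
    then have "wform \<rho> S (\<lambda>t x y. rH x (j y)) w ?\<zeta> + wform \<rho> S b1 v ?\<zeta> + wform \<rho> S b2 v ?\<zeta> + wform \<rho> S a1 u ?\<zeta> + wform \<rho> S a2 u ?\<zeta>
      - wform \<rho> S (\<lambda>t x y. rH x (j y)) f ?\<zeta> = 0"
      using weak[of "prod_encode (p, q)"] unfolding Lf_def by linarith
    then have "?I (\<lambda>t. rH (w t) (j x)) + ?I (\<lambda>t. b1 t (v t) x) + ?I (\<lambda>t. b2 t (v t) x) + ?I (\<lambda>t. a1 t (u t) x) + ?I (\<lambda>t. a2 t (u t) x)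
      - ?I (\<lambda>t. rH (f t) (j x)) = 0"
      unfolding \<zeta>pq ind .
    moreover have iI: "integrable (Leb S) (\<lambda>t. indicator {..<r} t * h t)" if "integrable (Leb S) h" for h :: "real \<Rightarrow> real"
      using integrable_indicator_Leb[OF that, of "{..<r}"] by simp
    moreover have "Prim (G x) r = ?I (\<lambda>t. rH (w t) (j x)) + ?I (\<lambda>t. b1 t (v t) x) + ?I (\<lambda>t. b2 t (v t) x) + ?I (\<lambda>t. a1 t (u t) x) + ?I (\<lambda>t. a2 t (u t) x)
      - ?I (\<lambda>t. rH (f t) (j x))"
    proof -
      have "Prim (G x) r = (\<integral>t. indicator {..<r} t * rH (w t) (j x) + indicator {..<r} t * b1 t (v t) x + indicator {..<r} t * b2 t (v t) x
          + indicator {..<r} t * a1 t (u t) x + indicator {..<r} t * a2 t (u t) x - indicator {..<r} t * rH (f t) (j x) \<partial>Leb S)"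
        unfolding integral_Leb_sub[OF r(2)] G_def real_scaleR_def by (simp only: distrib_left right_diff_distrib)
      also have "\<dots> = ?I (\<lambda>t. rH (w t) (j x)) + ?I (\<lambda>t. b1 t (v t) x) + ?I (\<lambda>t. b2 t (v t) x) + ?I (\<lambda>t. a1 t (u t) x) + ?I (\<lambda>t. a2 t (u t) x)
      - ?I (\<lambda>t. rH (f t) (j x))"
        by (simp only: Bochner_Integration.integral_diff Bochner_Integration.integral_add Bochner_Integration.integrable_add iI[OF ints(1)]
            iI[OF ints(2)] iI[OF ints(3)] iI[OF ints(4)] iI[OF ints(5)] iI[OF ints(6)])
      finally show ?thesis .
    qed
    ultimately show ?thesis by simp
  qed
  have zero: "Prim (G x) t = 0" if x: "x \<in> X" and t: "t \<in> {0..S}" for x t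
  proof -
    have "continuous_on {0..S} (Prim (G x))" by (rule continuous_on_primitive[OF primitive_on_Prim[OF G]])
    then have "closed {s \<in> {0..S}. Prim (G x) s = 0}"
      by (rule continuous_closed_preimage_constant) simp
    moreover have "{0<..<S} \<inter> \<rat> \<subseteq> {s \<in> {0..S}. Prim (G x) s = 0}" using rat[OF _ _ x] by auto
    ultimately have "closure ({0<..<S} \<inter> \<rat>) \<subseteq> {s \<in> {0..S}. Prim (G x) s = 0}" by (rule closure_minimal[rotated])
    moreover have "{0<..<S} \<subseteq> closure ({0<..<S} \<inter> \<rat>)"
      using open_Int_closure_subset[of "{0<..<S}" "\<rat>"] Rats_closure_real by simp
    from closure_mono[OF this] have "{0..S} \<subseteq> closure ({0<..<S} \<inter> \<rat>)" using S by simp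
    ultimately show ?thesis using t by blast
  qed
  have "AE t in Leb S. G x t = 0" if "x \<in> X" for x
    by (rule integral_zero_imp_AE_zero[OF G zero[OF that]])
  then have "AE t in Leb S. \<forall>x\<in>X. G x t = 0" by (rule AE_ball_countable'[OF _ X(1)])
  \<comment> \<open>Outside one null set, common to all x, the residual is continuous in x and
    vanishes on a dense set, hence everywhere.\<close>
  then have AE_G: "AE t in Leb S. \<forall>x. G x t = 0"
    using AE_space
  proof eventually_elim
    case (elim t)
    then have t: "t \<in> {0..S}" by simp
    note bil = bounded_bilinear.continuous_on[OF bounded_forms_bilinear[OF measurable_forms_bounded t] continuous_on_const continuous_on_id]
    have "continuous_on UNIV (\<lambda>x. G x t)"
      unfolding G_def by (intro continuous_on_add continuous_on_diff bil[OF C] bil[OF b1_forms] bil[OF b2] bil[OF a1_forms] bil[OF a2])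
    then have "closed {x. G x t = 0}" using continuous_closed_preimage_constant[of UNIV "\<lambda>x. G x t" 0] by simp
    then have op: "open (- {x. G x t = 0})" by (rule open_Compl)
    show ?case
    proof (rule ccontr)
      assume "\<not> ?thesis"
      then have "- {x. G x t = 0} \<noteq> {}" by auto
      then show False using X(2)[OF op] elim(1) by auto
    qed
  qed
  show thesis
  proof (rule that[OF v w])
    show "AE t in Leb S. j (v t) = j u1 + Prim w t"
      using jv0 by eventually_elim (simp add: v_def j.add)
    show "j (z0 + u1) = j u1 + Prim w S" using jz0 by (simp add: j.add)
    show "AE t in Leb S. \<forall>x. rH (w t) (j x) + b1 t (v t) x + b2 t (v t) x
        + a1 t (u0 + Prim v t) x + a2 t (u0 + Prim v t) x = rH (f t) (j x)"
      using AE_G AE_space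
    proof eventually_elim
      case (elim t)
      then have "u0 + Prim v t = u t" by (intro u_eq) auto
      then show ?case using elim(1) by (simp add: G_def)
    qed
  qed
qed

end

section \<open>Uniqueness\<close>

lemma wsq_zero_imp_AE_zero:
  assumes \<rho>: "0 \<le> \<rho>" and f: "f \<in> L2 S" and zero: "wsq \<rho> S f \<le> 0"
  shows "AE t in Leb S. f t = 0"
proof -
  have "wsq \<rho> S f = 0" using zero wsq_nonneg[of \<rho> S f] by simp
  then have "AE t in Leb S. exp (- \<rho> * t) * (norm (f t))\<^sup>2 = 0"
    unfolding wsq_def by (subst (asm) integral_nonneg_eq_0_iff_AE[OF wsq_integrable[OF \<rho> f]]) auto
  then show ?thesis by eventually_elim simp
qed

context damped_problem
begin

text \<open>The equation holds for all x at almost every t, so x = v(t) is admissible. Since j v is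
  the primitive of w, the first term is half a weighted derivative and yields \<rho> B / 2 and half
  the end value; \<open>b1\<close> gives \<alpha> Q by coercivity, and the rest is absorbed. The end
  value is recorded because solutions on different intervals are compared through it.\<close>

lemma homogeneous_zero:
  assumes v: "v \<in> L2 S" and w: "w \<in> L2 S" and jv: "AE t in Leb S. j (v t) = Prim w t"
    and eq: "AE t in Leb S. \<forall>x. rH (w t) (j x) + b1 t (v t) x + b2 t (v t) x
        + a1 t (Prim v t) x + a2 t (Prim v t) x = 0"
  shows "AE t in Leb S. v t = 0" and "Prim w S = 0"
proof -
  \<comment> \<open>The bound 2 M^2 / \<alpha> absorbs the H-part of the \<open>b2\<close>-term into
    \<rho> B / 2; 8 M / \<alpha> makes the primitive of v so small that the terms with
    \<open>a1\<close> and \<open>a2\<close> cost at most half of \<alpha> Q; 1 ensures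
    positivity.\<close>
  define \<rho> where "\<rho> = max 1 (max (2 * M\<^sup>2 / \<alpha>) (8 * M / \<alpha>))"
  have \<rho>1: "1 \<le> \<rho>" and \<rho>2: "2 * M\<^sup>2 / \<alpha> \<le> \<rho>" and \<rho>3: "8 * M / \<alpha> \<le> \<rho>"
    unfolding \<rho>_def by (simp_all only: max.cobounded1 max.cobounded2 le_max_iff_disj order_refl simp_thms)
  have \<rho>: "0 \<le> \<rho>" "0 < \<rho>" using \<rho>1 by auto
  let ?u = "Prim v" and ?h = "Prim w"
  have u2: "?u \<in> L2 S" and h2: "?h \<in> L2 S" by (rule Prim_L2[OF v], rule Prim_L2[OF w])
  define Q where "Q = wsq \<rho> S v"
  define R where "R = wsq \<rho> S ?u"
  define B where "B = wsq \<rho> S ?h"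
  have nonneg: "0 \<le> Q" "0 \<le> R" "0 \<le> B" by (simp_all add: Q_def R_def B_def wsq_nonneg)
  obtain C where C: "measurable_forms S C (\<lambda>t x y. rH x (j y))" using rHj_forms by blast
  note bm = weighted_measurable_forms[OF _ \<rho>(1)]
  note ints = forms_integrable[OF bm[OF C] w v] forms_integrable[OF bm[OF b1_forms] v v] forms_integrable[OF bm[OF b2] v v]
    forms_integrable[OF bm[OF a1_forms] u2 v] forms_integrable[OF bm[OF a2] u2 v]
  have sum0: "wform \<rho> S (\<lambda>t x y. rH x (j y)) w v + wform \<rho> S b1 v v + wform \<rho> S b2 v v + wform \<rho> S a1 ?u v + wform \<rho> S a2 ?u v = 0"
  proof -
    let ?F = "\<lambda>t. exp (- \<rho> * t) * rH (w t) (j (v t)) + exp (- \<rho> * t) * b1 t (v t) (v t) + exp (- \<rho> * t) * b2 t (v t) (v t)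
      + exp (- \<rho> * t) * a1 t (?u t) (v t) + exp (- \<rho> * t) * a2 t (?u t) (v t)"
    have "AE t in Leb S. ?F t = 0"
      using eq
    proof eventually_elim
      case (elim t)
      have "?F t = exp (- \<rho> * t) * (rH (w t) (j (v t)) + b1 t (v t) (v t) + b2 t (v t) (v t) + a1 t (?u t) (v t) + a2 t (?u t) (v t))"
        by (simp only: distrib_left)
      then show ?case using elim by simp
    qed
    then have "integral\<^sup>L (Leb S) ?F = 0" by (rule integral_eq_zero_AE)
    then show ?thesis
      unfolding wform_def by (simp only: Bochner_Integration.integral_add Bochner_Integration.integrable_add ints)
  qed
  have wh: "wform \<rho> S (\<lambda>t x y. rH x (j y)) w v = wform \<rho> S (\<lambda>t. rH) ?h w"
    unfolding wform_def
  proof (rule integral_cong_AE)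
    show "(\<lambda>t. exp (- \<rho> * t) * rH (w t) (j (v t))) \<in> borel_measurable (Leb S)" using ints(1) by (rule borel_measurable_integrable)
    show "(\<lambda>t. exp (- \<rho> * t) * rH (Prim w t) (w t)) \<in> borel_measurable (Leb S)"
      by (rule borel_measurable_integrable[OF forms_integrable[OF bm[OF lipschitz_forms_measurable[OF inner_like_forms[OF rH]]] h2 w]])
    show "AE t in Leb S. exp (- \<rho> * t) * rH (w t) (j (v t)) = exp (- \<rho> * t) * rH (Prim w t) (w t)"
      using jv by eventually_elim (simp add: inner_like_sym[OF rH])
  qed
  have wjv: "wsq \<rho> S (\<lambda>t. j (v t)) = B"
    unfolding B_def wsq_def
    by (rule integral_cong_AE[OF borel_measurable_integrable[OF wsq_integrable[OF \<rho>(1) j_L2[OF v]]]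
          borel_measurable_integrable[OF wsq_integrable[OF \<rho>(1) h2]]])
      (use jv in eventually_elim, simp)
  have h: "primitive_on S ?h w" by (rule primitive_on_Prim[OF L2_integrable[OF w]])
  have u: "primitive_on S ?u v" by (rule primitive_on_Prim[OF L2_integrable[OF v]])
  have hh: "exp (- \<rho> * S) * (norm (?h S))\<^sup>2 + \<rho> * B = 2 * wform \<rho> S (\<lambda>t. rH) ?h w"
  proof -
    have "\<bar>exp (- \<rho> * S) * rH (?h S) (?h S) - rH (?h 0) (?h 0)
      - (wform \<rho> S (\<lambda>t. rH) w ?h + wform \<rho> S (\<lambda>t. rH) ?h w - \<rho> * wform \<rho> S (\<lambda>t. rH) ?h ?h)\<bar> \<le> 0 * wprod \<rho> S ?h ?h"
      by (rule wform_parts[OF \<rho>(1) inner_like_forms[OF rH] order_refl S_nonneg h w h w])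
    moreover have "wform \<rho> S (\<lambda>t. rH) w ?h = wform \<rho> S (\<lambda>t. rH) ?h w"
      unfolding wform_def by (simp only: inner_like_sym[OF rH])
    moreover have "wform \<rho> S (\<lambda>t. rH) ?h ?h = B"
      unfolding wform_def B_def wsq_def by (simp only: inner_like_self[OF rH])
    ultimately show ?thesis unfolding integral_Leb_0 by (simp add: inner_like_self[OF rH])
  qed
  have b1v: "\<alpha> * Q \<le> wform \<rho> S b1 v v"
  proof -
    have "\<alpha> * Q = (\<integral>t. \<alpha> * (exp (- \<rho> * t) * (norm (v t))\<^sup>2) \<partial>Leb S)"
      unfolding Q_def wsq_def by simp
    also have "\<dots> \<le> wform \<rho> S b1 v v"
      unfolding wform_def
    proof (rule integral_mono[OF _ ints(2)])
      show "integrable (Leb S) (\<lambda>t. \<alpha> * (exp (- \<rho> * t) * (norm (v t))\<^sup>2))"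
        by (intro Bochner_Integration.integrable_mult_right wsq_integrable[OF \<rho>(1) v])
      fix t assume "t \<in> space (Leb S)"
      then have "t \<in> {0..S}" by simp
      from mult_left_mono[OF b1_coercive[OF this, of "v t"], of "exp (- \<rho> * t)"]
      show "\<alpha> * (exp (- \<rho> * t) * (norm (v t))\<^sup>2) \<le> exp (- \<rho> * t) * b1 t (v t) (v t)"
        by (simp add: mult_ac)
    qed
    finally show ?thesis .
  qed
  have b2v: "\<bar>wform \<rho> S b2 v v\<bar> \<le> \<alpha> / 4 * Q + M\<^sup>2 / \<alpha> * B"
  proof -
    have "\<bar>wform \<rho> S b2 v v\<bar> \<le> M * wprod \<rho> S v (\<lambda>t. j (v t))"
      by (rule wform_bound[OF \<rho>(1) v j_L2[OF v] constants(1)]) (rule b2_le, simp)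
    also have "wprod \<rho> S v (\<lambda>t. j (v t)) = wprod \<rho> S (\<lambda>t. j (v t)) v"
      unfolding wprod_def by (simp only: mult.commute[of "norm (v _)"])
    also have "M * \<dots> \<le> \<alpha> / 4 * wsq \<rho> S v + M\<^sup>2 / (4 * (\<alpha> / 4)) * wsq \<rho> S (\<lambda>t. j (v t))"
      by (rule wprod_scaled_young[OF \<rho>(1) j_L2[OF v] v _ constants(1)]) (use constants in simp)
    finally show ?thesis unfolding wjv Q_def by simp
  qed
  have av: "\<bar>wform \<rho> S c ?u v\<bar> \<le> \<alpha> / 8 * Q + 2 * M\<^sup>2 / \<alpha> * R" if "measurable_forms S M c" for c
  proof -
    have "\<bar>wform \<rho> S c ?u v\<bar> \<le> M * wprod \<rho> S ?u v"
      by (rule wform_le[OF \<rho>(1) measurable_forms_bounded[OF that] u2 v])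
    also have "\<dots> \<le> \<alpha> / 8 * wsq \<rho> S v + M\<^sup>2 / (4 * (\<alpha> / 8)) * wsq \<rho> S ?u"
      by (rule wprod_scaled_young[OF \<rho>(1) u2 v _ constants(1)]) (use constants in simp)
    finally show ?thesis unfolding Q_def R_def by simp
  qed
  \<comment> \<open>\<open>weighted_hardy\<close> bounds \<rho>^2 R by 4 Q, and \<alpha> \<rho>
    \<ge> 8 M turns this into 16 M^2 R \<le> \<alpha>^2 Q.\<close>
  have R: "4 * M\<^sup>2 / \<alpha> * R \<le> \<alpha> / 4 * Q"
  proof -
    have "exp (- \<rho> * S) * (norm (?u S))\<^sup>2 + \<rho> / 2 * R \<le> 2 / \<rho> * Q"
      unfolding R_def Q_def by (rule weighted_hardy[OF rV S_nonneg \<rho>(2) u integral_Leb_0 v])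
    then have "\<rho> / 2 * R \<le> 2 / \<rho> * Q" by (smt (verit) exp_gt_zero mult_nonneg_nonneg zero_le_power2)
    then have "\<rho>\<^sup>2 * R \<le> 4 * Q" using \<rho> by (simp add: field_simps power2_eq_square)
    then have RQ: "\<alpha>\<^sup>2 * (\<rho>\<^sup>2 * R) \<le> \<alpha>\<^sup>2 * (4 * Q)" by (intro mult_left_mono) simp_all
    have "(8 * M)\<^sup>2 \<le> (\<alpha> * \<rho>)\<^sup>2"
      using \<rho>3 constants by (intro power_mono) (simp_all add: field_simps)
    then have "(64 * M\<^sup>2) * R \<le> (\<alpha>\<^sup>2 * \<rho>\<^sup>2) * R" by (intro mult_right_mono nonneg) (simp add: power_mult_distrib)
    also have "\<dots> = \<alpha>\<^sup>2 * (\<rho>\<^sup>2 * R)" by (rule mult.assoc)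
    also note RQ
    finally have "(64 * M\<^sup>2) * R \<le> \<alpha>\<^sup>2 * (4 * Q)" .
    then have "16 * (M\<^sup>2 * R) \<le> \<alpha>\<^sup>2 * Q" by (simp add: mult_ac)
    from divide_right_mono[OF this, of "4 * \<alpha>"] have "16 * (M\<^sup>2 * R) / (4 * \<alpha>) \<le> \<alpha>\<^sup>2 * Q / (4 * \<alpha>)"
      using constants by simp
    moreover have "16 * (M\<^sup>2 * R) / (4 * \<alpha>) = 4 * M\<^sup>2 / \<alpha> * R" "\<alpha>\<^sup>2 * Q / (4 * \<alpha>) = \<alpha> / 4 * Q"
      using constants by (simp_all add: power2_eq_square)
    ultimately show ?thesis by simp
  qed
  have B2: "M\<^sup>2 / \<alpha> * B \<le> \<rho> * B / 2"
    using mult_right_mono[OF \<rho>2 nonneg(3)] by (simp add: mult_ac)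
  define m where "m = 2 * M\<^sup>2 / \<alpha> * R"
  have m: "2 * m \<le> \<alpha> / 4 * Q" using R by (simp add: m_def)
  define hS where "hS = exp (- \<rho> * S) * (norm (?h S))\<^sup>2"
  have "hS / 2 + \<alpha> / 4 * Q \<le> 0"
    using sum0 wh hh[folded hS_def] b1v b2v av[OF a1_forms, folded m_def] av[OF a2, folded m_def] B2 m by linarith
  moreover have "0 \<le> hS" by (simp add: hS_def)
  moreover have "0 \<le> \<alpha> / 4 * Q" using constants nonneg by simp
  ultimately have "hS = 0" "\<alpha> / 4 * Q = 0" by linarith+
  then show "Prim w S = 0" and "AE t in Leb S. v t = 0"
    using wsq_zero_imp_AE_zero[OF \<rho>(1) v] constants by (auto simp: hS_def Q_def)
qed

text \<open>The initial data cancel in the difference of two solutions, which therefore solves the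
  homogeneous problem.\<close>

theorem uniqueness:
  assumes L2: "v1 \<in> L2 S" "w1 \<in> L2 S" "v2 \<in> L2 S" "w2 \<in> L2 S"
    and jv: "AE t in Leb S. j (v1 t) = j u1 + Prim w1 t" "AE t in Leb S. j (v2 t) = j u1 + Prim w2 t"
    and eq: "AE t in Leb S. \<forall>x. rH (w1 t) (j x) + b1 t (v1 t) x + b2 t (v1 t) x
        + a1 t (u0 + Prim v1 t) x + a2 t (u0 + Prim v1 t) x = rH (f t) (j x)"
      "AE t in Leb S. \<forall>x. rH (w2 t) (j x) + b1 t (v2 t) x + b2 t (v2 t) x
        + a1 t (u0 + Prim v2 t) x + a2 t (u0 + Prim v2 t) x = rH (f t) (j x)"
  shows "AE t in Leb S. v1 t = v2 t" and "Prim w1 S = Prim w2 S"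
proof -
  interpret j: bounded_linear j by (rule j)
  let ?v = "\<lambda>t. v1 t - v2 t" and ?w = "\<lambda>t. w1 t - w2 t"
  have v: "?v \<in> L2 S" and w: "?w \<in> L2 S" by (intro L2_diff L2)+
  have Pv: "Prim ?v t = (u0 + Prim v1 t) - (u0 + Prim v2 t)" if "t \<le> S" for t
    using Prim_diff[OF L2_integrable[OF L2(1)] L2_integrable[OF L2(3)] that] by simp
  have Pw: "Prim ?w t = Prim w1 t - Prim w2 t" if "t \<le> S" for t
    by (rule Prim_diff[OF L2_integrable[OF L2(2)] L2_integrable[OF L2(4)] that])
  have "AE t in Leb S. j (?v t) = Prim ?w t"
    using jv AE_space
  proof eventually_elim
    case (elim t)
    then have "t \<le> S" by simp
    then show ?case using elim by (simp only: j.diff Pw) simp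
  qed
  moreover have "AE t in Leb S. \<forall>x. rH (?w t) (j x) + b1 t (?v t) x + b2 t (?v t) x
        + a1 t (Prim ?v t) x + a2 t (Prim ?v t) x = 0"
    using eq AE_space
  proof eventually_elim
    case (elim t)
    then have tS: "t \<le> S" and t: "t \<in> {0..S}" by simp_all
    note bil = bounded_bilinear.diff_left[OF bounded_forms_bilinear[OF measurable_forms_bounded t]]
    note diffs = bounded_bilinear.diff_left[OF inner_like_bilinear[OF rH]] bil[OF b1_forms] bil[OF b2] bil[OF a1_forms] bil[OF a2]
    show ?case
      unfolding Pv[OF tS] diffs
    proof
      fix x
      show "rH (w1 t) (j x) - rH (w2 t) (j x) + (b1 t (v1 t) x - b1 t (v2 t) x) + (b2 t (v1 t) x - b2 t (v2 t) x)
        + (a1 t (u0 + Prim v1 t) x - a1 t (u0 + Prim v2 t) x) + (a2 t (u0 + Prim v1 t) x - a2 t (u0 + Prim v2 t) x) = 0"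
        using elim(1)[THEN spec, of x] elim(2)[THEN spec, of x] by linarith
    qed
  qed
  ultimately have "AE t in Leb S. ?v t = 0" "Prim ?w S = 0"
    using homogeneous_zero[OF v w] by blast+
  then show "AE t in Leb S. v1 t = v2 t" "Prim w1 S = Prim w2 S"
    unfolding Pw[OF order_refl] by simp_all
qed

end

section \<open>Weak derivatives\<close>

text \<open>The recursion passes from f to \<open>deriv f\<close>, so closure under sums, products
  and affine substitutions follows by induction over all functions at once;
  \<open>differentiable_upto_imp_funpow\<close> returns to the iterates that
  \<open>test_function\<close> speaks of.\<close>

primrec differentiable_upto :: "nat \<Rightarrow> (real \<Rightarrow> real) \<Rightarrow> bool" where
  "differentiable_upto 0 f \<longleftrightarrow> (\<forall>x. f field_differentiable at x)"
| "differentiable_upto (Suc k) f \<longleftrightarrow> (\<forall>x. f field_differentiable at x) \<and> differentiable_upto k (deriv f)"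

lemma differentiable_upto_imp_funpow:
  "differentiable_upto k f \<Longrightarrow> (deriv ^^ k) f field_differentiable at x"
  by (induction k arbitrary: f) (simp_all add: funpow_Suc_right del: funpow.simps)

lemma differentiable_upto_field: "differentiable_upto k f \<Longrightarrow> f field_differentiable at x"
  by (cases k) auto

lemma differentiable_upto_mono: "differentiable_upto (Suc k) f \<Longrightarrow> differentiable_upto k f"
  by (induction k arbitrary: f) auto

lemma differentiable_upto_add:
  "differentiable_upto k f \<Longrightarrow> differentiable_upto k g \<Longrightarrow> differentiable_upto k (\<lambda>x. f x + g x)"
proof (induction k arbitrary: f g)
  case (Suc k)
  have "deriv (\<lambda>x. f x + g x) = (\<lambda>x. deriv f x + deriv g x)"
    using Suc.prems by (intro ext deriv_add) auto
  then show ?case using Suc by (auto intro: field_differentiable_add)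
qed (auto intro: field_differentiable_add)

lemma differentiable_upto_mult:
  "differentiable_upto k f \<Longrightarrow> differentiable_upto k g \<Longrightarrow> differentiable_upto k (\<lambda>x. f x * g x)"
proof (induction k arbitrary: f g)
  case (Suc k)
  have "deriv (\<lambda>x. f x * g x) = (\<lambda>x. f x * deriv g x + deriv f x * g x)"
    using Suc.prems by (intro ext deriv_mult) auto
  moreover have "differentiable_upto k (\<lambda>x. f x * deriv g x + deriv f x * g x)"
    using Suc.prems by (intro differentiable_upto_add Suc.IH differentiable_upto_mono[of k f] differentiable_upto_mono[of k g]) auto
  ultimately show ?case using Suc.prems by (auto intro: field_differentiable_mult)
qed (auto intro: field_differentiable_mult)

lemma differentiable_upto_affine:
  "differentiable_upto k f \<Longrightarrow> differentiable_upto k (\<lambda>x. c * f (a * x + b))"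
proof (induction k arbitrary: f c)
  have d: "((\<lambda>x. c * f (a * x + b)) has_field_derivative (c * a) * deriv f (a * x + b)) (at x)"
    if "\<And>x. f field_differentiable at x" for f c x
    using field_differentiable_derivI[OF that, of "a * x + b"]
    by (auto intro!: derivative_eq_intros DERIV_chain2[where f=f])
  {
    case 0
    then show ?case using d[of f c] by (auto simp: field_differentiable_def)
  next
    case (Suc k)
    have fd: "\<And>x. f field_differentiable at x" using Suc.prems by simp
    have "deriv (\<lambda>x. c * f (a * x + b)) = (\<lambda>x. (c * a) * deriv f (a * x + b))"
      by (intro ext DERIV_imp_deriv d fd)
    moreover have "differentiable_upto k (\<lambda>x. (c * a) * deriv f (a * x + b))"
      using Suc.prems by (intro Suc.IH) simp
    ultimately show ?case using d[OF fd, of c] by (auto simp: field_differentiable_def)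
  }
qed

text \<open>The family of all p(1/x) e^(-1/x) contains e^(-1/x) itself and is closed under
  differentiation, so smoothness needs no formula for higher derivatives.\<close>

definition flat :: "real poly \<Rightarrow> real \<Rightarrow> real" where
  "flat p x = (if x > 0 then poly p (1 / x) * exp (- 1 / x) else 0)"

lemma poly_times_exp_tendsto_0:
  "((\<lambda>y. poly p y * exp (- y)) \<longlongrightarrow> (0::real)) at_top"
proof -
  have "((\<lambda>y. \<Sum>i\<le>degree p. coeff p i * (y ^ i / exp y)) \<longlongrightarrow> (\<Sum>i\<le>degree p. coeff p i * 0)) at_top"
    by (intro tendsto_intros tendsto_power_div_exp_0)
  then show ?thesis
    by (simp add: poly_altdef exp_minus sum_divide_distrib field_simps)
qed

text \<open>With y = 1/x the derivative of p(y) e^(-y) is (p - p')(y) y^2 e^(-y), whence the factor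
  \<open>[:0, 0, 1:]\<close>. At 0 the difference quotient from the right is again a polynomial in y
  times e^(-y), and it tends to 0.\<close>

lemma flat_has_derivative:
  "(flat p has_field_derivative flat ((p - pderiv p) * [:0, 0, 1:]) x) (at x)"
proof -
  consider "x > 0" | "x < 0" | "x = 0" by linarith
  then show ?thesis
  proof cases
    case 1
    have "((\<lambda>x. poly p (1 / x) * exp (- 1 / x)) has_field_derivative
       poly p (1 / x) * (exp (- 1 / x) * (1 / x\<^sup>2)) + (poly (pderiv p) (1 / x) * (- 1 / x\<^sup>2)) * exp (- 1 / x)) (at x)"
      using 1 by (auto intro!: derivative_eq_intros DERIV_chain2[OF poly_DERIV] simp: power2_eq_square)
    then have "(flat p has_field_derivative
       poly p (1 / x) * (exp (- 1 / x) * (1 / x\<^sup>2)) + (poly (pderiv p) (1 / x) * (- 1 / x\<^sup>2)) * exp (- 1 / x)) (at x)"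
      by (rule has_field_derivative_transform_within_open[where S="{0<..}"]) (use 1 in \<open>auto simp: flat_def\<close>)
    then show ?thesis using 1 by (simp add: flat_def algebra_simps power2_eq_square)
  next
    case 2
    have "((\<lambda>x. 0) has_field_derivative 0) (at x)" by simp
    then have "(flat p has_field_derivative 0) (at x)"
      by (rule has_field_derivative_transform_within_open[where S="{..<0}"]) (use 2 in \<open>auto simp: flat_def\<close>)
    then show ?thesis using 2 by (simp add: flat_def)
  next
    case 3
    have "((\<lambda>h. (flat p (0 + h) - flat p 0) / h) \<longlongrightarrow> 0) (at 0)"
    proof (rule filterlim_split_at)
      have "((\<lambda>h. 0) \<longlongrightarrow> (0::real)) (at_left 0)" by simp
      then show "((\<lambda>h. (flat p (0 + h) - flat p 0) / h) \<longlongrightarrow> 0) (at_left 0)"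
        by (rule Lim_transform_eventually) (auto simp: flat_def eventually_at_filter)
      have "((\<lambda>h. poly (p * [:0, 1:]) (inverse h) * exp (- inverse h)) \<longlongrightarrow> (0::real)) (at_right 0)"
        by (rule filterlim_compose[OF poly_times_exp_tendsto_0 filterlim_inverse_at_top_right])
      then show "((\<lambda>h. (flat p (0 + h) - flat p 0) / h) \<longlongrightarrow> 0) (at_right 0)"
      proof (rule Lim_transform_eventually)
        show "eventually (\<lambda>h. poly (p * [:0, 1:]) (inverse h) * exp (- inverse h) = (flat p (0 + h) - flat p 0) / h) (at_right 0)"
          using eventually_at_right_less by eventually_elim (simp add: flat_def field_simps)
      qed
    qed
    then show ?thesis using 3 by (simp add: DERIV_def flat_def)
  qed
qed

lemma deriv_flat: "deriv (flat p) = flat ((p - pderiv p) * [:0, 0, 1:])"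
  by (intro ext DERIV_imp_deriv flat_has_derivative)

lemma differentiable_upto_flat: "differentiable_upto k (flat p)"
  by (induction k arbitrary: p) (auto simp: deriv_flat field_differentiable_def intro: flat_has_derivative)

definition bump :: "real \<Rightarrow> real" where
  "bump x = flat 1 x * flat 1 (1 - x)"

lemma differentiable_upto_bump: "differentiable_upto k bump"
proof -
  have "differentiable_upto k (\<lambda>x. flat 1 x * (1 * flat 1 ((-1) * x + 1)))"
    by (intro differentiable_upto_mult differentiable_upto_affine differentiable_upto_flat)
  then show ?thesis unfolding bump_def by (simp add: algebra_simps)
qed

lemma bump_nonneg: "0 \<le> bump x"
  by (simp add: bump_def flat_def)

lemma bump_eq_0: "x \<notin> {0<..<1} \<Longrightarrow> bump x = 0"
  by (auto simp: bump_def flat_def)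

lemma bump_pos: "x \<in> {0<..<1} \<Longrightarrow> 0 < bump x"
  by (auto simp: bump_def flat_def)

lemma continuous_on_bump: "continuous_on A bump"
  using differentiable_upto_field[OF differentiable_upto_bump[of 0]]
  by (meson continuous_at_imp_continuous_on field_differentiable_imp_continuous_at)

text \<open>The step is the primitive of \<open>bump\<close>, divided by its total integral; the
  mean value theorem shows that this integral is positive.\<close>

lemma smooth_step_exists:
  obtains \<sigma> where "\<And>k. differentiable_upto k \<sigma>" "\<And>x. x \<le> 0 \<Longrightarrow> \<sigma> x = 0" "\<And>x. 1 \<le> x \<Longrightarrow> \<sigma> x = (1::real)"
    "\<And>x. 0 \<le> deriv \<sigma> x" "\<And>x. x \<notin> {0<..<1} \<Longrightarrow> deriv \<sigma> x = 0"
proof -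
  \<comment> \<open>The lower limit -1 leaves room to the left of 0: differentiation of the integral
    covers all x > -1, and on the negative half-line the function is constantly 0.\<close>
  define B where "B = (\<lambda>x. integral {-1..x} bump)"
  have dB: "(B has_real_derivative bump x) (at x)" for x
  proof (cases "x > -1")
    case True
    have "((\<lambda>u. integral {-1..u} bump) has_vector_derivative bump x) (at x within {-1..x + 1})"
      by (rule integral_has_vector_derivative[OF continuous_on_bump]) (use True in simp)
    then have "((\<lambda>u. integral {-1..u} bump) has_vector_derivative bump x) (at x)"
      using True by (subst (asm) at_within_interior) auto
    then show ?thesis by (simp add: B_def has_real_derivative_iff_has_vector_derivative)
  next
    case False
    have "((\<lambda>u. 0) has_real_derivative bump x) (at x)"
      using False bump_eq_0[of x] by simp
    then show ?thesis
    proof (rule has_field_derivative_transform_within_open[where S="{..<0}"])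
      fix y :: real assume "y \<in> {..<0}"
      then have "integral {-1..y} bump = integral {-1..y} (\<lambda>x. 0)"
        by (intro integral_cong bump_eq_0) auto
      then show "0 = B y" by (simp add: B_def)
    qed (use False in auto)
  qed
  have B0: "B x = 0" if "x \<le> 0" for x
  proof -
    have "integral {-1..x} bump = integral {-1..x} (\<lambda>x. 0)"
      using that by (intro integral_cong bump_eq_0) auto
    then show ?thesis by (simp add: B_def)
  qed
  have "\<exists>z>0. z < 1 \<and> B 1 - B 0 = (1 - 0) * bump z"
    by (rule MVT2) (use dB in auto)
  then have B1: "0 < B 1" using bump_pos B0[of 0] by auto
  have Bx: "B x = B 1" if "1 \<le> x" for x
  proof (cases "x = 1")
    case False
    then have "\<exists>z>1. z < x \<and> B x - B 1 = (x - 1) * bump z"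
      using that by (intro MVT2) (use dB in auto)
    then show ?thesis using bump_eq_0 by auto
  qed simp
  define \<sigma> where "\<sigma> = (\<lambda>x. B x / B 1)"
  have d\<sigma>: "(\<sigma> has_real_derivative bump x / B 1) (at x)" for x
    unfolding \<sigma>_def by (rule DERIV_cdivide[OF dB])
  have deriv: "deriv \<sigma> = (\<lambda>x. bump x / B 1)" by (intro ext DERIV_imp_deriv d\<sigma>)
  have "differentiable_upto k (\<lambda>x. (1 / B 1) * bump (1 * x + 0))" for k
    by (rule differentiable_upto_affine[OF differentiable_upto_bump])
  then have "differentiable_upto k (deriv \<sigma>)" for k unfolding deriv by simp
  moreover have "\<sigma> field_differentiable at x" for x using d\<sigma> unfolding field_differentiable_def by blast
  ultimately have "differentiable_upto (Suc k) \<sigma>" for k unfolding differentiable_upto.simps by blast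
  note smooth = differentiable_upto_mono[OF this]
  show thesis
  proof (rule that[OF smooth])
    show "\<sigma> x = 0" if "x \<le> 0" for x using B0[OF that] by (simp add: \<sigma>_def)
    show "\<sigma> x = 1" if "1 \<le> x" for x using Bx[OF that] B1 by (simp add: \<sigma>_def)
    show "0 \<le> deriv \<sigma> x" for x using bump_nonneg[of x] B1 by (simp add: deriv)
    show "deriv \<sigma> x = 0" if "x \<notin> {0<..<1}" for x using bump_eq_0[OF that] by (simp add: deriv)
  qed
qed

section \<open>Weak derivatives and primitives\<close>

lemma test_function_primitive:
  assumes "test_function T \<phi>"
  shows "primitive_on T \<phi> (deriv \<phi>)" "\<phi> 0 = 0" "\<phi> T = 0"
proof -
  have d0: "\<phi> field_differentiable at x" and d1: "deriv \<phi> field_differentiable at x" for x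
    using assms[unfolded test_function_def, THEN conjunct1, rule_format, of 0 x]
      assms[unfolded test_function_def, THEN conjunct1, rule_format, of 1 x] by simp_all
  show "primitive_on T \<phi> (deriv \<phi>)"
  proof (rule primitive_on_deriv)
    show "(\<phi> has_real_derivative deriv \<phi> t) (at t)" for t by (rule field_differentiable_derivI[OF d0])
    show "continuous_on UNIV (deriv \<phi>)"
      by (intro continuous_at_imp_continuous_on ballI field_differentiable_imp_continuous_at d1)
  qed
  have "\<phi> x = 0" if "x \<notin> {0<..<T}" for x
  proof (rule ccontr)
    assume "\<phi> x \<noteq> 0"
    then have "x \<in> closure {t. \<phi> t \<noteq> 0}" using closure_subset[of "{t. \<phi> t \<noteq> 0}"] by blast
    then show False using assms that unfolding test_function_def by blast
  qed
  then show "\<phi> 0 = 0" "\<phi> T = 0" by simp_all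
qed

text \<open>The product rule for \<phi> u, whose values at both ends vanish.\<close>

lemma primitive_on_imp_weak_derivative:
  assumes T: "0 \<le> T" and u: "primitive_on T u g"
  shows "weak_derivative T u g"
  unfolding weak_derivative_def
proof (intro allI impI)
  fix \<phi> assume \<phi>: "test_function T \<phi>"
  note p = primitive_on_bilinear[OF bounded_bilinear_scaleR test_function_primitive(1)[OF \<phi>] u]
  have "\<phi> T *\<^sub>R u T = \<phi> 0 *\<^sub>R u 0 + (\<integral>t. deriv \<phi> t *\<^sub>R u t + \<phi> t *\<^sub>R g t \<partial>Leb T)"
    by (rule primitive_on_eq[OF p(3)]) (use T in simp)
  then have "0 = (\<integral>t. deriv \<phi> t *\<^sub>R u t + \<phi> t *\<^sub>R g t \<partial>Leb T)"
    using test_function_primitive(2,3)[OF \<phi>] by simp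
  also have "\<dots> = (\<integral>t. deriv \<phi> t *\<^sub>R u t \<partial>Leb T) + (\<integral>t. \<phi> t *\<^sub>R g t \<partial>Leb T)"
    by (rule Bochner_Integration.integral_add[OF p(1,2)])
  finally show "(\<integral>t. deriv \<phi> t *\<^sub>R u t \<partial>Leb T) = - (\<integral>t. \<phi> t *\<^sub>R g t \<partial>Leb T)"
    by (simp add: eq_neg_iff_add_eq_0)
qed

text \<open>The tests are smoothed indicators of (s,t), differences of two steps. Their derivatives
  are one-sided approximate identities at s and t, so in the limit the weak identity expresses u(s)
  - u(t) through the integral of g over (s,t). Continuity of u provides this limit and later the end
  points.\<close>

lemma weak_derivative_imp_primitive_on:
  fixes u g :: "real \<Rightarrow> 'x::{banach, second_countable_topology}"
  assumes T: "0 < T" and u: "continuous_on {0..T} u" and g: "integrable (Leb T) g" and weak: "weak_derivative T u g"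
  shows "primitive_on T u g"
proof -
  obtain \<sigma> where smooth: "\<And>k. differentiable_upto k \<sigma>" and \<sigma>0: "\<And>x. x \<le> 0 \<Longrightarrow> \<sigma> x = 0" and \<sigma>1: "\<And>x. 1 \<le> x \<Longrightarrow> \<sigma> x = (1::real)"
    and d\<sigma>: "\<And>x. 0 \<le> deriv \<sigma> x" "\<And>x. x \<notin> {0<..<1} \<Longrightarrow> deriv \<sigma> x = 0"
    by (rule smooth_step_exists) blast
  have D\<sigma>: "(\<sigma> has_real_derivative deriv \<sigma> x) (at x)" for x
    by (rule field_differentiable_derivI[OF differentiable_upto_field[OF smooth]])
  have c\<sigma>': "continuous_on A (\<lambda>x. deriv \<sigma> (f x))" if "continuous_on A f" for A and f :: "real \<Rightarrow> real"
  proof (rule continuous_on_compose2[OF _ that subset_UNIV])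
    show "continuous_on UNIV (deriv \<sigma>)"
      using smooth[of 1] by (intro continuous_at_imp_continuous_on ballI field_differentiable_imp_continuous_at) simp
  qed
  have mono: "\<sigma> x \<le> \<sigma> y" if "x \<le> y" for x y
    by (rule DERIV_nonneg_imp_nondecreasing[OF that]) (use D\<sigma> d\<sigma>(1) in blast)
  have \<sigma>01: "0 \<le> \<sigma> x" "\<sigma> x \<le> 1" for x
    using mono[of "min x 0" x] \<sigma>0[of "min x 0"] mono[of x "max x 1"] \<sigma>1[of "max x 1"] by simp_all
  \<comment> \<open>\<open>\<kappa> k c\<close> is the derivative of the step of width 1 / Suc k
    that starts at c: non-negative, supported in [c, c + 1 / Suc k] and, if this interval lies in
    (0,T], of integral 1.\<close>
  define \<kappa> where "\<kappa> = (\<lambda>k c x. real (Suc k) * deriv \<sigma> (real (Suc k) * (x - c)))"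
  have D\<kappa>: "((\<lambda>x. \<sigma> (real (Suc k) * (x - c))) has_real_derivative \<kappa> k c x) (at x)" for k c x
    unfolding \<kappa>_def by (rule DERIV_cong[OF DERIV_chain2[OF D\<sigma>]]) (auto intro!: derivative_eq_intros)
  have \<kappa>c: "continuous_on A (\<kappa> k c)" for A k c
    unfolding \<kappa>_def by (intro continuous_intros c\<sigma>')
  have \<kappa>i: "integrable (Leb T) (\<kappa> k c)" for k c by (rule L2_integrable[OF continuous_on_L2[OF \<kappa>c]])
  have \<kappa>u: "integrable (Leb T) (\<lambda>x. \<kappa> k c x *\<^sub>R u x)" for k c
    by (rule L2_integrable[OF continuous_on_L2]) (intro continuous_intros \<kappa>c u)
  have \<kappa>nn: "0 \<le> \<kappa> k c x" for k c x unfolding \<kappa>_def using d\<sigma>(1) by simp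
  have \<kappa>0: "\<kappa> k c x = 0" if "x \<le> c \<or> c + 1 / Suc k \<le> x" for k c x
  proof -
    have "real (Suc k) * (x - c) \<notin> {0<..<1}"
    proof (cases "x \<le> c")
      case True
      then show ?thesis by (simp add: mult_nonneg_nonpos not_less)
    next
      case False
      then have "1 / Suc k \<le> x - c" using that by simp
      then have "1 \<le> real (Suc k) * (x - c)" by (simp add: field_simps)
      then show ?thesis by simp
    qed
    then show ?thesis unfolding \<kappa>_def using d\<sigma>(2) by simp
  qed
  have \<kappa>1: "(\<integral>x. \<kappa> k c x \<partial>Leb T) = 1" if "0 < c" "c + 1 / Suc k \<le> T" for k c
  proof -
    have "primitive_on T (\<lambda>x. \<sigma> (real (Suc k) * (x - c))) (\<kappa> k c)"
      by (rule primitive_on_deriv[OF D\<kappa> \<kappa>c])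
    from primitive_on_eq[OF this, of T]
    have "\<sigma> (real (Suc k) * (T - c)) = \<sigma> (real (Suc k) * (0 - c)) + (\<integral>x. \<kappa> k c x \<partial>Leb T)" using T by simp
    moreover have "\<sigma> (real (Suc k) * (0 - c)) = 0" using that by (intro \<sigma>0) (simp add: mult_nonneg_nonpos)
    moreover have "\<sigma> (real (Suc k) * (T - c)) = 1"
    proof (rule \<sigma>1)
      have "1 / Suc k \<le> T - c" using that by simp
      then show "1 \<le> real (Suc k) * (T - c)" by (simp add: field_simps)
    qed
    ultimately show ?thesis by simp
  qed
  have small: "eventually (\<lambda>k. 1 / real (Suc k) < e) sequentially" if "e > 0" for e
    using order_tendstoD(2)[OF LIMSEQ_Suc[OF lim_1_over_n] that] .
  have approx: "(\<lambda>k. \<integral>x. \<kappa> k c x *\<^sub>R u x \<partial>Leb T) \<longlonglongrightarrow> u c" if c: "0 < c" "c < T" for c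
  proof (rule tendstoI)
    fix e :: real assume e: "e > 0"
    have "c \<in> {0..T}" using c by simp
    then obtain d where d: "d > 0" "\<And>x. x \<in> {0..T} \<Longrightarrow> dist x c < d \<Longrightarrow> dist (u x) (u c) < e / 2"
      using u e unfolding continuous_on_iff by (meson half_gt_zero)
    have Tc: "0 < T - c" using c by simp
    show "eventually (\<lambda>k. dist (\<integral>x. \<kappa> k c x *\<^sub>R u x \<partial>Leb T) (u c) < e) sequentially"
      using small[OF d(1)] small[OF Tc]
    proof eventually_elim
      case (elim k)
      note k = elim
      have one: "(\<integral>x. \<kappa> k c x \<partial>Leb T) = 1" by (rule \<kappa>1) (use c k in auto)
      have "(\<integral>x. \<kappa> k c x *\<^sub>R u x \<partial>Leb T) - u c = (\<integral>x. \<kappa> k c x *\<^sub>R u x \<partial>Leb T) - (\<integral>x. \<kappa> k c x *\<^sub>R u c \<partial>Leb T)"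
        using \<kappa>i one by simp
      also have "\<dots> = (\<integral>x. \<kappa> k c x *\<^sub>R u x - \<kappa> k c x *\<^sub>R u c \<partial>Leb T)"
        by (rule Bochner_Integration.integral_diff[OF \<kappa>u, symmetric]) (use \<kappa>i in simp)
      finally have "norm ((\<integral>x. \<kappa> k c x *\<^sub>R u x \<partial>Leb T) - u c) \<le> (\<integral>x. norm (\<kappa> k c x *\<^sub>R u x - \<kappa> k c x *\<^sub>R u c) \<partial>Leb T)"
        by simp
      also have "\<dots> \<le> (\<integral>x. \<kappa> k c x * (e / 2) \<partial>Leb T)"
      proof (rule integral_mono)
        show "integrable (Leb T) (\<lambda>x. norm (\<kappa> k c x *\<^sub>R u x - \<kappa> k c x *\<^sub>R u c))"
          by (intro integrable_norm Bochner_Integration.integrable_diff \<kappa>u) (use \<kappa>i in simp)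
        fix x assume x: "x \<in> space (Leb T)"
        show "norm (\<kappa> k c x *\<^sub>R u x - \<kappa> k c x *\<^sub>R u c) \<le> \<kappa> k c x * (e / 2)"
        proof (cases "x \<le> c \<or> c + 1 / Suc k \<le> x")
          case True
          then show ?thesis using \<kappa>0[OF True] by simp
        next
          case False
          then have "dist x c < d" using k by (simp add: dist_real_def)
          then have "norm (u x - u c) \<le> e / 2" using d(2)[of x] x by (simp add: dist_norm)
          from mult_left_mono[OF this \<kappa>nn] show ?thesis using \<kappa>nn[of k c x]
            by (simp only: scaleR_diff_right[symmetric] norm_scaleR abs_of_nonneg)
        qed
      qed (use \<kappa>i in simp)
      also have "\<dots> = e / 2" using one by simp
      finally show "dist (\<integral>x. \<kappa> k c x *\<^sub>R u x \<partial>Leb T) (u c) < e" using e by (simp add: dist_norm)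
    qed
  qed
  \<comment> \<open>The same sequence of integrals is evaluated in two ways: directly through u and,
    by the weak identity, through g.\<close>
  have diff: "u s - u t = - (Prim g t - Prim g s)" if st: "0 < s" "s < t" "t < T" for s t
  proof (rule LIMSEQ_unique)
    define \<phi> where "\<phi> = (\<lambda>k x. \<sigma> (real (Suc k) * (x - s)) - \<sigma> (real (Suc k) * (x - t)))"
    have d\<phi>: "deriv (\<phi> k) = (\<lambda>x. \<kappa> k s x - \<kappa> k t x)" for k
      unfolding \<phi>_def by (intro ext DERIV_imp_deriv DERIV_diff D\<kappa>)
    have Tt: "0 < T - t" using st by simp
    \<comment> \<open>The second step ends at t + 1 / Suc k, which has to lie below T; hence the
      restriction to large k.\<close>
    have test: "eventually (\<lambda>k. test_function T (\<phi> k)) sequentially"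
      using small[OF Tt]
    proof eventually_elim
      case k: (elim k)
      have "differentiable_upto m (\<lambda>x. 1 * \<sigma> (real (Suc k) * x + (- real (Suc k) * s)) + (-1) * \<sigma> (real (Suc k) * x + (- real (Suc k) * t)))" for m
        by (intro differentiable_upto_add differentiable_upto_affine smooth)
      moreover have "(\<lambda>x. 1 * \<sigma> (real (Suc k) * x + (- real (Suc k) * s)) + (-1) * \<sigma> (real (Suc k) * x + (- real (Suc k) * t))) = \<phi> k"
        by (simp add: \<phi>_def right_diff_distrib del: of_nat_Suc)
      ultimately have "(deriv ^^ m) (\<phi> k) field_differentiable at x" for m x
        by (intro differentiable_upto_imp_funpow) simp
      moreover have "closure {x. \<phi> k x \<noteq> 0} \<subseteq> {s..t + 1 / Suc k}"
      proof (rule closure_minimal)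
        show "{x. \<phi> k x \<noteq> 0} \<subseteq> {s..t + 1 / Suc k}"
        proof (rule subsetI, rule ccontr)
          fix x assume "x \<in> {x. \<phi> k x \<noteq> 0}" and "x \<notin> {s..t + 1 / Suc k}"
          then have nz: "\<phi> k x \<noteq> 0" and "x < s \<or> t + 1 / Suc k < x" by auto
          then show False
          proof (elim disjE)
            assume "x < s"
            then have "real (Suc k) * (x - s) \<le> 0" "real (Suc k) * (x - t) \<le> 0"
              using st by (simp_all add: mult_nonneg_nonpos del: of_nat_Suc)
            then show False using nz \<sigma>0 by (simp add: \<phi>_def)
          next
            assume "t + 1 / Suc k < x"
            then have "1 / Suc k \<le> x - t" "1 / Suc k \<le> x - s" using st by auto
            then have "1 \<le> real (Suc k) * (x - s)" "1 \<le> real (Suc k) * (x - t)" by (simp_all add: field_simps)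
            then show False using nz \<sigma>1 by (simp add: \<phi>_def)
          qed
        qed
      qed simp
      moreover have "{s..t + 1 / Suc k} \<subseteq> {0<..<T}" using st k by auto
      ultimately show "test_function T (\<phi> k)" unfolding test_function_def by blast
    qed
    have "(\<lambda>k. (\<integral>x. \<kappa> k s x *\<^sub>R u x \<partial>Leb T) - (\<integral>x. \<kappa> k t x *\<^sub>R u x \<partial>Leb T)) \<longlonglongrightarrow> u s - u t"
      by (intro tendsto_diff approx) (use st in auto)
    moreover have "(\<integral>x. \<kappa> k s x *\<^sub>R u x \<partial>Leb T) - (\<integral>x. \<kappa> k t x *\<^sub>R u x \<partial>Leb T) = (\<integral>x. deriv (\<phi> k) x *\<^sub>R u x \<partial>Leb T)" for k
      unfolding d\<phi> scaleR_diff_left by (rule Bochner_Integration.integral_diff[OF \<kappa>u \<kappa>u, symmetric])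
    ultimately show "(\<lambda>k. \<integral>x. deriv (\<phi> k) x *\<^sub>R u x \<partial>Leb T) \<longlonglongrightarrow> u s - u t" by (simp only:)
    have \<phi>m: "\<phi> k \<in> borel_measurable (Leb T)" for k
    proof (rule continuous_on_borel_measurable_Leb)
      have "(\<phi> k has_real_derivative (\<kappa> k s x - \<kappa> k t x)) (at x)" for x
        unfolding \<phi>_def by (rule DERIV_diff[OF D\<kappa> D\<kappa>])
      from DERIV_isCont[OF this] show "continuous_on {0..T} (\<phi> k)" by (simp add: continuous_at_imp_continuous_on)
    qed
    have ind: "(\<integral>x. (indicator {..<t} x - indicator {..<s} x) *\<^sub>R g x \<partial>Leb T) = Prim g t - Prim g s"
    proof -
      have i: "integrable (Leb T) (\<lambda>x. indicator {..<r} x *\<^sub>R g x)" for r by (rule integrable_indicator_Leb[OF g]) simp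
      have tT: "t \<le> T" and sT: "s \<le> T" using st by simp_all
      show ?thesis
        by (simp only: scaleR_diff_left Bochner_Integration.integral_diff[OF i i]
            integral_Leb_sub[OF tT, of g] integral_Leb_sub[OF sT, of g])
    qed
    have "(\<lambda>k. \<integral>x. \<phi> k x *\<^sub>R g x \<partial>Leb T) \<longlonglongrightarrow> (\<integral>x. (indicator {..<t} x - indicator {..<s} x) *\<^sub>R g x \<partial>Leb T)"
    proof (rule integral_dominated_convergence[where w="\<lambda>x. norm (g x)"])
      show "(\<lambda>x. (indicator {..<t} x - indicator {..<s} x) *\<^sub>R g x) \<in> borel_measurable (Leb T)"
        unfolding scaleR_diff_left
        by (intro borel_measurable_diff borel_measurable_integrable integrable_indicator_Leb[OF g]) simp_all
      show "(\<lambda>x. \<phi> k x *\<^sub>R g x) \<in> borel_measurable (Leb T)" for k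
        by (intro borel_measurable_scaleR \<phi>m borel_measurable_integrable g)
      show "integrable (Leb T) (\<lambda>x. norm (g x))" by (rule integrable_norm[OF g])
      show "AE x in Leb T. norm (\<phi> k x *\<^sub>R g x) \<le> norm (g x)" for k
      proof (rule AE_I2)
        fix x
        have "\<bar>\<phi> k x\<bar> \<le> 1" unfolding \<phi>_def using \<sigma>01[of "real (Suc k) * (x - s)"] \<sigma>01[of "real (Suc k) * (x - t)"] by linarith
        from mult_right_mono[OF this norm_ge_zero[of "g x"]] show "norm (\<phi> k x *\<^sub>R g x) \<le> norm (g x)" by simp
      qed
      \<comment> \<open>At x = c the step is 0 for every k while the right-hand side is 1, so this
        single point is excluded.\<close>
      have lim: "eventually (\<lambda>k. \<sigma> (real (Suc k) * (x - c)) = 1 - indicator {..<c} x) sequentially" if "x \<noteq> c" for x c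
      proof (cases "x < c")
        case True
        then have "real (Suc k) * (x - c) \<le> 0" for k by (simp add: mult_nonneg_nonpos del: of_nat_Suc)
        then show ?thesis using \<sigma>0 True by simp
      next
        case False
        then have "0 < x - c" using that by simp
        from small[OF this] show ?thesis
        proof eventually_elim
          case (elim k)
          then have "1 \<le> real (Suc k) * (x - c)" by (simp add: field_simps)
          then show ?case using \<sigma>1 False by simp
        qed
      qed
      show "AE x in Leb T. (\<lambda>k. \<phi> k x *\<^sub>R g x) \<longlonglongrightarrow> (indicator {..<t} x - indicator {..<s} x) *\<^sub>R g x"
        using AE_Leb_neq[of s T] AE_Leb_neq[of t T]
      proof eventually_elim
        case (elim x)
        have "eventually (\<lambda>k. \<phi> k x *\<^sub>R g x = (indicator {..<t} x - indicator {..<s} x) *\<^sub>R g x) sequentially"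
          using lim[OF elim(1)] lim[OF elim(2)] by eventually_elim (simp add: \<phi>_def)
        then show ?case by (rule tendsto_eventually)
      qed
    qed
    then have "(\<lambda>k. - (\<integral>x. \<phi> k x *\<^sub>R g x \<partial>Leb T)) \<longlonglongrightarrow> - (Prim g t - Prim g s)"
      unfolding ind by (rule tendsto_minus)
    then show "(\<lambda>k. \<integral>x. deriv (\<phi> k) x *\<^sub>R u x \<partial>Leb T) \<longlonglongrightarrow> - (Prim g t - Prim g s)"
    proof (rule Lim_transform_eventually)
      show "eventually (\<lambda>k. - (\<integral>x. \<phi> k x *\<^sub>R g x \<partial>Leb T) = (\<integral>x. deriv (\<phi> k) x *\<^sub>R u x \<partial>Leb T)) sequentially"
        using test by eventually_elim (use weak in \<open>simp add: weak_derivative_def\<close>)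
    qed
  qed
  \<comment> \<open>By \<open>diff\<close> the function \<open>h\<close> is constant on the open
    interval, and by continuity on the closed one; T / 2 is merely a reference point.\<close>
  define h where "h = (\<lambda>x. u x - Prim g x)"
  have h: "continuous_on {0..T} h"
    unfolding h_def by (intro continuous_on_diff u continuous_on_primitive[OF primitive_on_Prim[OF g]])
  have const: "h x = h (T / 2)" if "x \<in> {0<..<T}" for x
  proof -
    consider "x < T / 2" | "x = T / 2" | "T / 2 < x" by linarith
    then show ?thesis
    proof cases
      case 1
      then show ?thesis using diff[of x "T / 2"] that T by (simp add: h_def algebra_simps)
    next
      case 2
      show ?thesis by (simp only: 2)
    next
      case 3
      then show ?thesis using diff[of "T / 2" x] that T by (simp add: h_def algebra_simps)
    qed
  qed
  have cl: "closure {0<..<T} = {0..T}" using T by simp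
  have hc: "h x = h (T / 2)" if "x \<in> {0..T}" for x
  proof -
    have "x \<in> closure {0<..<T}" using that unfolding cl .
    with continuous_constant_on_closure[OF h[folded cl] const] show ?thesis by blast
  qed
  have "u t = u 0 + Prim g t" if t: "t \<in> {0..T}" for t
  proof -
    have "h t = h 0" by (rule trans[OF hc[OF t] hc[symmetric]]) (use T in simp)
    then show ?thesis unfolding h_def integral_Leb_0 by (simp add: algebra_simps)
  qed
  then show ?thesis using g unfolding primitive_on_def by blast
qed

section \<open>Reduction to real forms\<close>

lemma scaleR_one_eq_iff: "a *\<^sub>R (1::'a::real_normed_field) = b *\<^sub>R 1 \<longleftrightarrow> a = b"
  by simp

text \<open>The axiom \<open>add_kconj\<close> describes \<open>kre\<close> only through real
  multiples of 1, so identities for \<open>kre\<close> are proved for these multiples and the factor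
  1 is cancelled.\<close>

lemma kre_add: "kre (x + y) = kre x + kre (y::'k::real_or_complex_field)"
proof -
  have "(2 * kre (x + y)) *\<^sub>R (1::'k) = (2 * kre x) *\<^sub>R 1 + (2 * kre y) *\<^sub>R 1"
    unfolding add_kconj[symmetric] by (simp add: kconj_add algebra_simps)
  then show ?thesis unfolding scaleR_left_distrib[symmetric] scaleR_one_eq_iff by simp
qed

lemma kconj_scaleR: "kconj (r *\<^sub>R x) = r *\<^sub>R kconj (x::'k::real_or_complex_field)"
  using kconj_mult[of "r *\<^sub>R 1" x] by (simp add: kconj_scaleR_one)

lemma kre_scaleR: "kre (r *\<^sub>R x) = r * kre (x::'k::real_or_complex_field)"
proof -
  have "(2 * kre (r *\<^sub>R x)) *\<^sub>R (1::'k) = r *\<^sub>R ((2 * kre x) *\<^sub>R 1)"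
    unfolding add_kconj[symmetric] by (simp add: kconj_scaleR scaleR_add_right)
  then show ?thesis unfolding scaleR_scaleR scaleR_one_eq_iff by simp
qed

lemma kre_of_real: "kre (of_real r :: 'k::real_or_complex_field) = r"
proof -
  have "(2 * kre (of_real r :: 'k)) *\<^sub>R (1::'k) = (2 * r) *\<^sub>R 1"
    unfolding add_kconj[symmetric] by (simp add: scaleR_conv_of_real)
  then show ?thesis unfolding scaleR_one_eq_iff by simp
qed

lemma abs_kre_le: "\<bar>kre x\<bar> \<le> norm (x::'k::real_or_complex_field)"
proof -
  have "2 * \<bar>kre x\<bar> = norm ((2 * kre x) *\<^sub>R (1::'k))" by simp
  also have "\<dots> \<le> norm x + norm (kconj x)" unfolding add_kconj[symmetric] by (rule norm_triangle_ineq)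
  finally show ?thesis by simp
qed

lemma bounded_linear_kre: "bounded_linear (kre :: 'k::real_or_complex_field \<Rightarrow> real)"
  by (rule bounded_linear_intro[where K=1]) (simp_all add: kre_add kre_scaleR abs_kre_le)

lemma kconj_kconj: "kconj (kconj x) = (x::'k::real_or_complex_field)"
proof (cases "x = 0")
  case False
  then have "kconj x \<noteq> 0" using norm_kconj[of x] by (metis norm_eq_zero)
  moreover have "kconj x * kconj (kconj x) = kconj x * x"
    using mult_kconj[of "kconj x"] mult_kconj[of x] by (simp add: mult.commute)
  ultimately show ?thesis by simp
qed simp

lemma kre_kconj: "kre (kconj x) = kre (x::'k::real_or_complex_field)"
proof -
  have "(2 * kre (kconj x)) *\<^sub>R (1::'k) = (2 * kre x) *\<^sub>R 1"
    unfolding add_kconj[symmetric] by (simp add: kconj_kconj)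
  then show ?thesis unfolding scaleR_one_eq_iff by simp
qed

lemma (in separable_hilbert) inner_like_kre_ip: "inner_like (\<lambda>x y. kre (ip x y))"
proof -
  have sym: "kre (ip x y) = kre (ip y x)" for x y
    by (subst ip_commute) (rule kre_kconj)
  have le: "\<bar>kre (ip x y)\<bar> \<le> norm x * norm y" for x y
    using abs_kre_le[of "ip x y"] norm_ip_le[of x y] by linarith
  have add: "kre (ip (x + y) z) = kre (ip x z) + kre (ip y z)" for x y z
    by (simp only: ip_add_left kre_add)
  have scale: "kre (ip (r *\<^sub>R x) z) = r * kre (ip x z)" for r x z
    using ip_scale_left[of "of_real r" x z] by (simp add: sc_of_real kre_scaleR scaleR_conv_of_real[symmetric])
  have "bounded_bilinear (\<lambda>x y. kre (ip x y))"
  proof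
    show "kre (ip (a + a') b) = kre (ip a b) + kre (ip a' b)" for a a' b by (rule add)
    show "kre (ip a (b + b')) = kre (ip a b) + kre (ip a b')" for a b b' by (simp only: sym[of a] add)
    show "kre (ip (r *\<^sub>R a) b) = r *\<^sub>R kre (ip a b)" for r a b by (simp only: scale real_scaleR_def)
    show "kre (ip a (r *\<^sub>R b)) = r *\<^sub>R kre (ip a b)" for r a b by (simp only: sym[of a] scale real_scaleR_def)
    show "\<exists>K. \<forall>a b. norm (kre (ip a b)) \<le> norm a * norm b * K" by (rule exI[of _ 1]) (simp add: le)
  qed
  moreover have "kre (ip x x) = (norm x)\<^sup>2" for x by (simp only: ip_self kre_of_real)
  ultimately show ?thesis unfolding inner_like_def using sym le by blast
qed

lemma (in separable_hilbert) bounded_bilinear_kre_sesquilinear: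
  assumes s: "sesquilinear sc c" and le: "\<And>u v. norm (c u v) \<le> K * norm u * norm v"
  shows "bounded_bilinear (\<lambda>u v. kre (c u v))"
proof
  show "kre (c (a + a') b) = kre (c a b) + kre (c a' b)" "kre (c a (b + b')) = kre (c a b) + kre (c a b')" for a a' b b'
    using s unfolding sesquilinear_def by (simp_all add: kre_add)
  show "kre (c (r *\<^sub>R a) b) = r *\<^sub>R kre (c a b)" for r a b
  proof -
    have "c (sc (of_real r) a) b = of_real r * c a b" using s unfolding sesquilinear_def by blast
    then show ?thesis by (simp add: sc_of_real kre_scaleR scaleR_conv_of_real[symmetric])
  qed
  show "kre (c a (r *\<^sub>R b)) = r *\<^sub>R kre (c a b)" for r a b
  proof -
    have "c a (sc (of_real r) b) = kconj (of_real r) * c a b" using s unfolding sesquilinear_def by blast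
    then show ?thesis by (simp add: sc_of_real kre_scaleR scaleR_conv_of_real[symmetric])
  qed
  show "\<exists>K. \<forall>a b. norm (kre (c a b)) \<le> norm a * norm b * K"
  proof (intro exI allI)
    show "norm (kre (c a b)) \<le> norm a * norm b * K" for a b
      using abs_kre_le[of "c a b"] le[of a b] by (simp add: mult_ac)
  qed
qed

text \<open>The pieces are closed intervals, so the pieces match at the common end points.\<close>

lemma lipschitz_of_pieces:
  fixes g :: "real \<Rightarrow> 'x::real_normed_vector"
  assumes step: "\<And>i. i < n \<Longrightarrow> \<tau> i < \<tau> (Suc i)"
    and piece: "\<And>i s t. i \<in> {1..n} \<Longrightarrow> s \<in> {\<tau> (i - 1)..\<tau> i} \<Longrightarrow> t \<in> {\<tau> (i - 1)..\<tau> i} \<Longrightarrow> norm (g t - g s) \<le> L * \<bar>t - s\<bar>"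
  shows "m \<le> n \<Longrightarrow> \<tau> 0 \<le> s \<Longrightarrow> s \<le> t \<Longrightarrow> t \<le> \<tau> m \<Longrightarrow> 0 < m \<Longrightarrow> norm (g t - g s) \<le> L * (t - s)"
proof (induction m arbitrary: s t)
  case (Suc m)
  have p: "norm (g t' - g s') \<le> L * (t' - s')" if "\<tau> m \<le> s'" "s' \<le> t'" "t' \<le> \<tau> (Suc m)" for s' t'
    using piece[of "Suc m" s' t'] Suc.prems that by simp
  show ?case
  proof (cases "\<tau> m \<le> s")
    case True
    then show ?thesis using p Suc.prems by blast
  next
    case False
    then have m: "0 < m" using Suc.prems by (cases m) auto
    note IH = Suc.IH[OF _ _ _ _ m]
    show ?thesis
    proof (cases "t \<le> \<tau> m")
      case True
      then show ?thesis using IH[of s t] Suc.prems by simp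
    next
      case t: False
      have "norm (g t - g s) \<le> norm (g t - g (\<tau> m)) + norm (g (\<tau> m) - g s)"
        using norm_triangle_ineq[of "g t - g (\<tau> m)" "g (\<tau> m) - g s"] by simp
      also have "\<dots> \<le> L * (t - \<tau> m) + L * (\<tau> m - s)"
        using p[of "\<tau> m" t] IH[of s "\<tau> m"] t False Suc.prems by (intro add_mono) auto
      also have "\<dots> = L * (t - s)" by (simp add: algebra_simps)
      finally show ?thesis .
    qed
  qed
qed simp

lemma (in dense_hilbert_embedding) bounded_linear_j: "bounded_linear j"
proof -
  obtain C where C: "norm (j v) \<le> C * norm v" for v using j_bounded by blast
  have add: "j (x + y) = j x + j y" and scale: "j (scV k x) = scH k (j x)" for x y k
    using j_linear by (auto simp: Vector_Spaces.linear_iff)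
  show ?thesis
    by (rule bounded_linear_intro[where K=C])
      (use C add scale[of "of_real _"] in \<open>simp_all add: V.sc_of_real H.sc_of_real mult.commute\<close>)
qed

text \<open>Evaluation at \<phi>(x) x gives the square of the norm of \<phi>(x), which is its own
  real part. A real identity for all test vectors therefore implies the identity in the
  antidual.\<close>

lemma (in separable_hilbert) kre_zero_imp_zero:
  assumes "\<And>k x. \<phi> (sc k x) = kconj k * \<phi> x" and "\<And>x. kre (\<phi> x) = 0"
  shows "\<phi> x = (0 :: 'k)"
proof -
  have "\<phi> (sc (\<phi> x) x) = of_real ((norm (\<phi> x))\<^sup>2)"
    unfolding assms(1) using mult_kconj[of "\<phi> x"] by (simp add: mult.commute scaleR_conv_of_real)
  then have "(norm (\<phi> x))\<^sup>2 = kre (\<phi> (sc (\<phi> x) x))" by (simp only: kre_of_real)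
  then show ?thesis using assms(2) by simp
qed

lemma measurable_Icc_imp_Leb:
  fixes g :: "real \<Rightarrow> 'k::real_or_complex_field"
  assumes "g \<in> borel_measurable (lebesgue_on {0..T})" "S \<le> T"
  shows "(\<lambda>t. kre (g t)) \<in> borel_measurable (Leb S)"
proof -
  have "restrict_space (lebesgue_on {0..T}) {0<..<S} = Leb S"
    using assms(2) by (subst restrict_restrict_space) (auto intro!: arg_cong2[where f=restrict_space])
  then have "g \<in> borel_measurable (Leb S)" using measurable_restrict_space1[OF assms(1), of "{0<..<S}"] by simp
  then show ?thesis
    by (rule measurable_compose[OF _ borel_measurable_continuous_onI[OF linear_continuous_on[OF bounded_linear_kre]]])
qed

theorem theorem4p1:
  fixes scV :: "'k::real_or_complex_field \<Rightarrow> 'v::{banach, second_countable_topology} \<Rightarrow> 'v"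
    and ipV :: "'v \<Rightarrow> 'v \<Rightarrow> 'k"
    and scH :: "'k \<Rightarrow> 'h::{banach, second_countable_topology} \<Rightarrow> 'h"
    and ipH :: "'h \<Rightarrow> 'h \<Rightarrow> 'k"
    and j :: "'v \<Rightarrow> 'h"
    and T M Mdot \<alpha> :: real
    and n :: nat and \<tau> :: "nat \<Rightarrow> real"
    and a a1 a2 b b1 b2 :: "real \<Rightarrow> 'v \<Rightarrow> 'v \<Rightarrow> 'k"
    and f :: "real \<Rightarrow> 'h" and u0 u1 :: 'v
  assumes T: "T > 0"
    and embedding: "dense_hilbert_embedding scV ipV scH ipH j"
    and forms: "\<And>c. c \<in> {a1, a2, b1, b2} \<Longrightarrow> nonaut_form scV T c"
    and a_sum: "\<And>t u v. t \<in> {0..T} \<Longrightarrow> a t u v = a1 t u v + a2 t u v"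
    and b_sum: "\<And>t u v. t \<in> {0..T} \<Longrightarrow> b t u v = b1 t u v + b2 t u v"
    and V_bounded: "\<And>c. c \<in> {a, b} \<Longrightarrow> V_bounded_form scV T c"
    and quasi_coercive: "\<And>c. c \<in> {a, b} \<Longrightarrow> quasi_coercive_form j T c"
    and constants: "M \<ge> 0" "Mdot \<ge> 0" "\<alpha> > 0"
    and partition: "\<tau> 0 = 0" "\<And>i. i < n \<Longrightarrow> \<tau> i < \<tau> (Suc i)" "\<tau> n = T"
    and cond_a: "\<And>c t u v. c \<in> {a1, b1} \<Longrightarrow> t \<in> {0..T} \<Longrightarrow>
           norm (c t u v) \<le> M * norm u * norm v"
    and cond_b: "\<And>c t u. c \<in> {a1, b1} \<Longrightarrow> t \<in> {0..T} \<Longrightarrow>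
           kre (c t u u) \<ge> \<alpha> * (norm u)\<^sup>2"
    and cond_c: "\<And>c t u v. c \<in> {a1, b1} \<Longrightarrow> t \<in> {0..T} \<Longrightarrow>
           c t u v = kconj (c t v u)"
    and cond_d: "\<And>c i s t u v. c \<in> {a1, b1} \<Longrightarrow> i \<in> {1..n} \<Longrightarrow>
           s \<in> {\<tau> (i - 1)..\<tau> i} \<Longrightarrow> t \<in> {\<tau> (i - 1)..\<tau> i} \<Longrightarrow>
           norm (c t u v - c s u v) \<le> Mdot * \<bar>t - s\<bar> * norm u * norm v"
    and cond_e_measurable: "\<And>c u v. c \<in> {a2, b2} \<Longrightarrow>
           (\<lambda>t. c t u v) \<in> borel_measurable (lebesgue_on {0..T})"
    and cond_e_bound: "\<And>c t u v. c \<in> {a2, b2} \<Longrightarrow> t \<in> {0..T} \<Longrightarrow>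
           norm (c t u v) \<le> M * norm u * norm (j v)"
    and f: "f \<in> L2 T"
  shows "\<exists>u du.
           solves_cauchy ipH j T (\<lambda>t. assoc_op (a t)) (\<lambda>t. assoc_op (b t)) f u0 u1 u du \<and>
           (\<forall>w dw. solves_cauchy ipH j T (\<lambda>t. assoc_op (a t)) (\<lambda>t. assoc_op (b t)) f u0 u1 w dw
              \<longrightarrow> (\<forall>t\<in>{0..T}. w t = u t)) \<and>
           (\<forall>t\<in>{0..T}. du t \<in> range j)"
proof -
  interpret e: dense_hilbert_embedding scV ipV scH ipH j by (rule embedding)
  interpret j: bounded_linear j by (rule e.bounded_linear_j)
  define rV where "rV = (\<lambda>x y. kre (ipV x y))"
  define rH where "rH = (\<lambda>x y. kre (ipH x y))"
  define A1 where "A1 = (\<lambda>t x y. kre (a1 t x y))"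
  define A2 where "A2 = (\<lambda>t x y. kre (a2 t x y))"
  define B1 where "B1 = (\<lambda>t x y. kre (b1 t x y))"
  define B2 where "B2 = (\<lambda>t x y. kre (b2 t x y))"
  obtain C0 where C0: "\<And>v. norm (j v) \<le> C0 * norm v" using e.j_bounded by blast
  \<comment> \<open>Bounding \<open>a2\<close> and \<open>b2\<close> by the V-norm of the second
    argument costs the embedding constant; \<open>M'\<close> dominates that bound and
    \<open>M\<close> at once. The absolute value is taken because nothing is known about the sign of
    \<open>C0\<close>.\<close>
  define M' where "M' = M * (1 + \<bar>C0\<bar>)"
  have M': "0 \<le> M'" "M \<le> M'" "M * \<bar>C0\<bar> \<le> M'" using constants(1) by (simp_all add: M'_def algebra_simps)
  have sesq: "sesquilinear scV (c t)" if "c \<in> {a1, a2, b1, b2}" "t \<in> {0..T}" for c t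
    using forms[OF that(1)] that(2) unfolding nonaut_form_def by blast
  have n: "0 < n" using partition(1,3) T by (cases n) auto
  have lip: "norm (c t x y - c s x y) \<le> Mdot * \<bar>t - s\<bar> * norm x * norm y"
    if c: "c \<in> {a1, b1}" and s: "s \<in> {0..T}" and t: "t \<in> {0..T}" for c s t x y
  proof -
    have le: "norm (c t x y - c s x y) \<le> (Mdot * norm x * norm y) * (t - s)" if "0 \<le> s" "s \<le> t" "t \<le> T" for s t
    proof (rule lipschitz_of_pieces[where g="\<lambda>t. c t x y" and \<tau>=\<tau> and n=n and m=n])
      show "norm (c t x y - c s x y) \<le> Mdot * norm x * norm y * \<bar>t - s\<bar>"
        if "i \<in> {1..n}" "s \<in> {\<tau> (i - 1)..\<tau> i}" "t \<in> {\<tau> (i - 1)..\<tau> i}" for i s t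
        using cond_d[OF c that, of x y] by (simp add: mult_ac)
    qed (use partition that n in auto)
    show ?thesis
    proof (cases "s \<le> t")
      case True
      then show ?thesis using le[of s t] s t by (simp add: mult_ac)
    next
      case False
      then show ?thesis using le[of t s] s t by (simp add: mult_ac norm_minus_commute)
    qed
  qed
  have lf: "lipschitz_forms S M' Mdot (\<lambda>t x y. kre (c t x y))" if c: "c \<in> {a1, b1}" and S: "S \<le> T" for c S
    unfolding lipschitz_forms_def bounded_forms_def
  proof (intro conjI ballI allI M'(1))
    fix t assume "t \<in> {0..S}"
    then have t: "t \<in> {0..T}" using S by simp
    note ca = cond_a[OF c t]
    show "bounded_bilinear (\<lambda>x y. kre (c t x y))"
    proof (rule e.V.bounded_bilinear_kre_sesquilinear[where c="c t"])
      show "sesquilinear scV (c t)" by (rule sesq[OF _ t]) (use c in blast)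
    qed (rule ca)
    show "\<bar>kre (c t x y)\<bar> \<le> M' * norm x * norm y" for x y
    proof -
      have "M * (norm x * norm y) \<le> M' * (norm x * norm y)" by (intro mult_right_mono M') simp
      then show ?thesis using abs_kre_le[of "c t x y"] ca[of x y] by (simp add: mult.assoc)
    qed
    fix s x y assume "s \<in> {0..S}"
    then have s: "s \<in> {0..T}" using S by simp
    have "kre (c t x y - c s x y) = kre (c t x y) - kre (c s x y)"
      by (rule linear_diff[OF bounded_linear.linear[OF bounded_linear_kre]])
    then show "\<bar>kre (c s x y) - kre (c t x y)\<bar> \<le> Mdot * \<bar>s - t\<bar> * norm x * norm y"
      using abs_kre_le[of "c t x y - c s x y"] lip[OF c s t, of x y]
      unfolding abs_minus_commute[of s t] abs_minus_commute[of "kre (c s x y)"] by linarith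
  qed
  have c2_le: "\<bar>kre (c t x y)\<bar> \<le> M' * norm x * norm (j y)" if "c \<in> {a2, b2}" "t \<in> {0..T}" for c t x y
  proof -
    have "M * (norm x * norm (j y)) \<le> M' * (norm x * norm (j y))" by (intro mult_right_mono M') simp
    then show ?thesis using abs_kre_le[of "c t x y"] cond_e_bound[OF that, of x y] by (simp add: mult.assoc)
  qed
  have mf: "measurable_forms S M' (\<lambda>t x y. kre (c t x y))" if c: "c \<in> {a2, b2}" and S: "S \<le> T" for c S
    unfolding measurable_forms_def bounded_forms_def
  proof (intro conjI ballI allI M'(1))
    show "(\<lambda>t. kre (c t x y)) \<in> borel_measurable (Leb S)" for x y
      by (rule measurable_Icc_imp_Leb[OF cond_e_measurable[OF c] S])
    fix t assume "t \<in> {0..S}"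
    then have t: "t \<in> {0..T}" using S by simp
    have le: "norm (c t x y) \<le> M' * norm x * norm y" for x y
    proof -
      have "norm (j y) \<le> \<bar>C0\<bar> * norm y"
        using C0[of y] mult_right_mono[OF abs_ge_self[of C0] norm_ge_zero[of y]] by linarith
      then have "(M * norm x) * norm (j y) \<le> (M * norm x) * (\<bar>C0\<bar> * norm y)"
        by (rule mult_left_mono) (use constants in simp)
      moreover have "(M * norm x) * (\<bar>C0\<bar> * norm y) \<le> M' * norm x * norm y"
        using mult_right_mono[OF M'(3), of "norm x * norm y"] by (simp add: mult_ac)
      ultimately show ?thesis using cond_e_bound[OF c t, of x y] by linarith
    qed
    show "bounded_bilinear (\<lambda>x y. kre (c t x y))"
    proof (rule e.V.bounded_bilinear_kre_sesquilinear[where c="c t"])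
      show "sesquilinear scV (c t)" by (rule sesq[OF _ t]) (use c in blast)
    qed (rule le)
    show "\<bar>kre (c t x y)\<bar> \<le> M' * norm x * norm y" for x y
      using abs_kre_le[of "c t x y"] le[of x y] by linarith
  qed
  \<comment> \<open>The problem is set up on every [0,S] with S up to T, with constants independent
    of S.\<close>
  have dp: "damped_problem S M' Mdot \<alpha> rV rH j A1 A2 B1 B2" if S: "0 < S" "S \<le> T" for S
  proof
    show "lipschitz_forms S M' Mdot A1" "lipschitz_forms S M' Mdot B1"
      unfolding A1_def B1_def by (rule lf[OF _ S(2)], simp)+
    show "measurable_forms S M' A2" "measurable_forms S M' B2"
      unfolding A2_def B2_def by (rule mf[OF _ S(2)], simp)+
    show "inner_like rV" "inner_like rH"
      unfolding rV_def rH_def by (rule e.V.inner_like_kre_ip, rule e.H.inner_like_kre_ip)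
    fix t x y assume "t \<in> {0..S}"
    then have t: "t \<in> {0..T}" using S by simp
    show "\<bar>A2 t x y\<bar> \<le> M' * norm x * norm (j y)" "\<bar>B2 t x y\<bar> \<le> M' * norm x * norm (j y)"
      unfolding A2_def B2_def by (rule c2_le[OF _ t], simp)+
    have "b1 t x y = kconj (b1 t y x)" by (rule cond_c[OF _ t]) simp
    then show "B1 t x y = B1 t y x" unfolding B1_def by (simp only: kre_kconj)
    show "\<alpha> * (norm x)\<^sup>2 \<le> B1 t x x" unfolding B1_def by (rule cond_b[OF _ t]) simp
  qed (use S constants M' e.bounded_linear_j in auto)
  \<comment> \<open>The identity in the antidual becomes its real part against all x: the difference
    \<phi> of the two sides is antilinear, so \<open>kre_zero_imp_zero\<close> applies.\<close>
  have eq_iff: "embed_antidual ipH j h + blinfun_apply (assoc_op (b t)) v + blinfun_apply (assoc_op (a t)) u = embed_antidual ipH j g \<longleftrightarrow>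
      (\<forall>x. rH h (j x) + B1 t v x + B2 t v x + A1 t u x + A2 t u x = rH g (j x))" if t: "t \<in> {0..T}" for t h v u g
  proof -
    have ab: "blinfun_apply (blinfun_apply (assoc_op (c t)) y) x = c t y x \<and> sesquilinear scV (c t)"
      if cab: "c \<in> {a, b}" for c x y
    proof -
      have s: "sesquilinear scV (c t)" using V_bounded[OF cab] t unfolding V_bounded_form_def nonaut_form_def by blast
      obtain K where K: "\<forall>t\<in>{0..T}. \<forall>u v. norm (c t u v) \<le> K * norm u * norm v"
        using V_bounded[OF cab] unfolding V_bounded_form_def by blast
      show ?thesis using e.V.assoc_op_apply(1)[OF s, of K] K t s by blast
    qed
    define \<phi> where "\<phi> = (\<lambda>x. ipH h (j x) + b t v x + a t u x - ipH g (j x))"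
    have "embed_antidual ipH j h + blinfun_apply (assoc_op (b t)) v + blinfun_apply (assoc_op (a t)) u = embed_antidual ipH j g \<longleftrightarrow>
      (\<forall>x. \<phi> x = 0)"
    proof -
      have "blinfun_apply (embed_antidual ipH j h + blinfun_apply (assoc_op (b t)) v + blinfun_apply (assoc_op (a t)) u) x
          = ipH h (j x) + b t v x + a t u x" for x
        using ab[of a u x] ab[of b v x] by (simp add: blinfun.add_left e.embed_antidual_apply(1))
      then show ?thesis
        unfolding \<phi>_def by (metis blinfun_eqI e.embed_antidual_apply(1) eq_iff_diff_eq_0)
    qed
    also have "\<dots> \<longleftrightarrow> (\<forall>x. kre (\<phi> x) = 0)"
    proof
      assume z: "\<forall>x. kre (\<phi> x) = 0"
      have "\<phi> (scV k x) = kconj k * \<phi> x" for k x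
      proof -
        have "j (scV k x) = scH k (j x)" using e.j_linear by (simp add: Vector_Spaces.linear_iff)
        moreover have "a t u (scV k x) = kconj k * a t u x" "b t v (scV k x) = kconj k * b t v x"
          using ab[of a, THEN conjunct2] ab[of b, THEN conjunct2] unfolding sesquilinear_def by simp_all
        ultimately show ?thesis unfolding \<phi>_def by (simp add: e.H.ip_scale_right algebra_simps)
      qed
      then show "\<forall>x. \<phi> x = 0" using e.V.kre_zero_imp_zero[of \<phi>] z by blast
    next
      assume "\<forall>x. \<phi> x = 0"
      then show "\<forall>x. kre (\<phi> x) = 0" using kre_of_real[of 0, where 'k='k] by simp
    qed
    also have "\<dots> \<longleftrightarrow> (\<forall>x. rH h (j x) + B1 t v x + B2 t v x + A1 t u x + A2 t u x = rH g (j x))"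
    proof -
      have "kre (\<phi> x) = rH h (j x) + B1 t v x + B2 t v x + A1 t u x + A2 t u x - rH g (j x)" for x
        unfolding \<phi>_def a_sum[OF t] b_sum[OF t] rH_def A1_def A2_def B1_def B2_def
          linear_diff[OF bounded_linear.linear[OF bounded_linear_kre]] kre_add by simp
      then show ?thesis by simp
    qed
    finally show ?thesis .
  qed
  \<comment> \<open>A solution on (0,S) is recorded by its velocity \<open>v\<close> and
    acceleration \<open>w\<close> alone. Restriction to a shorter interval is then immediate, since
    the value of \<open>Prim\<close> at t does not refer to S.\<close>
  define sol where "sol = (\<lambda>S v w. v \<in> L2 S \<and> w \<in> L2 S \<and> (AE t in Leb S. j (v t) = j u1 + Prim w t) \<and>
    (AE t in Leb S. \<forall>x. rH (w t) (j x) + B1 t (v t) x + B2 t (v t) x + A1 t (u0 + Prim v t) x + A2 t (u0 + Prim v t) x = rH (f t) (j x)))"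
  have sol_ex: "\<exists>v w z. sol S v w \<and> j z = j u1 + Prim w S" if S: "0 < S" "S \<le> T" for S
    using damped_problem.existence[OF dp[OF S] L2_mono[OF f S(2)], where ?u0.0=u0 and ?u1.0=u1] unfolding sol_def by blast
  have sol_unique: "(AE t in Leb S. v1 t = v2 t) \<and> Prim w1 S = Prim w2 S"
    if S: "0 < S" "S \<le> T" and "sol S v1 w1" "sol S v2 w2" for S v1 w1 v2 w2
    using damped_problem.uniqueness[OF dp[OF S], of v1 w1 v2 w2 u1 u0 f] that(3,4) unfolding sol_def by blast
  have sol_mono: "sol S v w" if "S \<le> T" "sol T v w" for S v w
    using that unfolding sol_def by (blast intro: L2_mono AE_Leb_mono)
  obtain v w where sol: "sol T v w" using sol_ex[OF T order_refl] by blast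
  then have v: "v \<in> L2 T" and w: "w \<in> L2 T" and jv: "AE t in Leb T. j (v t) = j u1 + Prim w t"
    and eq: "AE t in Leb T. \<forall>x. rH (w t) (j x) + B1 t (v t) x + B2 t (v t) x + A1 t (u0 + Prim v t) x + A2 t (u0 + Prim v t) x = rH (f t) (j x)"
    unfolding sol_def by blast+
  define u where "u = (\<lambda>t. u0 + Prim v t)"
  define du where "du = (\<lambda>t. j u1 + Prim w t)"
  have T0: "0 \<le> T" using T by simp
  have pu: "primitive_on T u v" unfolding u_def by (rule primitive_on_integral[OF L2_integrable[OF v]])
  have pdu: "primitive_on T du w" unfolding du_def by (rule primitive_on_integral[OF L2_integrable[OF w]])
  have cu: "continuous_on {0..T} u" and cdu: "continuous_on {0..T} du" using pu pdu by (auto intro: continuous_on_primitive)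
  \<comment> \<open>The derivative j v obtained from u agrees almost everywhere with the continuous
    \<open>du\<close>, which makes \<open>du\<close> the required representative.\<close>
  have pju: "primitive_on T (\<lambda>t. j (u t)) du"
  proof (rule primitive_on_cong[OF primitive_on_linear[OF e.bounded_linear_j pu] refl])
    show "AE t in Leb T. du t = j (v t)" using jv by eventually_elim (simp add: du_def)
    show "du \<in> borel_measurable (Leb T)" by (rule continuous_on_borel_measurable_Leb[OF cdu])
  qed
  note wd = primitive_on_imp_weak_derivative[OF T0]
  have solves: "solves_cauchy ipH j T (\<lambda>t. assoc_op (a t)) (\<lambda>t. assoc_op (b t)) f u0 u1 u du"
    unfolding solves_cauchy_def
  proof (intro conjI cu cdu wd[OF pju])
    have "u \<in> H1 T" unfolding H1_def using continuous_on_L2[OF cu] v wd[OF pu] by blast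
    moreover have "du \<in> H1 T" unfolding H1_def using continuous_on_L2[OF cdu] w wd[OF pdu] by blast
    then have "(\<lambda>t. j (u t)) \<in> H2 T"
      unfolding H2_def using L2_bounded_linear[OF e.bounded_linear_j continuous_on_L2[OF cu]] wd[OF pju] by blast
    ultimately show "u \<in> MR j T" unfolding MR_def by blast
    have "AE t in Leb T. embed_antidual ipH j (w t) + blinfun_apply (assoc_op (b t)) (v t) + blinfun_apply (assoc_op (a t)) (u t)
      = embed_antidual ipH j (f t)"
      using eq AE_space
    proof eventually_elim
      case (elim t)
      then have t: "t \<in> {0..T}" by simp
      show ?case unfolding eq_iff[OF t] u_def by (rule elim(1))
    qed
    then show "\<exists>v\<in>L2 T. \<exists>w\<in>L2 T. weak_derivative T u v \<and> weak_derivative T du w \<and>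
        (AE t in Leb T. embed_antidual ipH j (w t) + blinfun_apply (assoc_op (b t)) (v t) + blinfun_apply (assoc_op (a t)) (u t)
      = embed_antidual ipH j (f t))"
      using v w wd[OF pu] wd[OF pdu] by blast
    show "u 0 = u0" "du 0 = j u1" unfolding u_def du_def integral_Leb_0 by simp_all
  qed
  have unique: "\<forall>t\<in>{0..T}. y t = u t"
    if y: "solves_cauchy ipH j T (\<lambda>t. assoc_op (a t)) (\<lambda>t. assoc_op (b t)) f u0 u1 y dy" for y dy
  proof -
    obtain v2 w2 where v2: "v2 \<in> L2 T" and w2: "w2 \<in> L2 T" and wdy: "weak_derivative T y v2" "weak_derivative T dy w2"
      and AEy: "AE t in Leb T. embed_antidual ipH j (w2 t) + blinfun_apply (assoc_op (b t)) (v2 t) + blinfun_apply (assoc_op (a t)) (y t)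
        = embed_antidual ipH j (f t)"
      using y unfolding solves_cauchy_def by blast
    have cy: "continuous_on {0..T} y" and cdy: "continuous_on {0..T} dy" and wjy: "weak_derivative T (\<lambda>t. j (y t)) dy"
      and y0: "y 0 = u0" "dy 0 = j u1"
      using y unfolding solves_cauchy_def by blast+
    have py: "primitive_on T y v2" by (rule weak_derivative_imp_primitive_on[OF T cy L2_integrable[OF v2] wdy(1)])
    have pdy: "primitive_on T dy w2" by (rule weak_derivative_imp_primitive_on[OF T cdy L2_integrable[OF w2] wdy(2)])
    have dyL2: "dy \<in> L2 T" by (rule continuous_on_L2[OF cdy])
    have pjy: "primitive_on T (\<lambda>t. j (y t)) dy"
      by (rule weak_derivative_imp_primitive_on[OF T _ L2_integrable[OF dyL2] wjy]) (rule j.continuous_on[OF cy])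
    have pjy': "primitive_on T (\<lambda>t. j (y t)) (\<lambda>t. j (v2 t))" by (rule primitive_on_linear[OF e.bounded_linear_j py])
    note i1 = primitive_on_integrable[OF pjy] and i2 = primitive_on_integrable[OF pjy']
    \<comment> \<open>\<open>dy\<close> is given as weak derivative of j o y and \<open>v2\<close>
      as that of y, independently of each other; \<open>dy\<close> and j o \<open>v2\<close> have
      the same primitive and therefore agree almost everywhere.\<close>
    have "AE t in Leb T. j (v2 t) - dy t = 0"
    proof (rule integral_zero_imp_AE_zero[OF Bochner_Integration.integrable_diff[OF i2 i1]])
      fix t assume t: "t \<in> {0..T}"
      then have tT: "t \<le> T" by simp
      have "Prim (\<lambda>t. j (v2 t)) t = Prim dy t"
        using primitive_on_eq[OF pjy t] primitive_on_eq[OF pjy' t] by (metis add_left_cancel)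
      then show "Prim (\<lambda>t. j (v2 t) - dy t) t = 0" unfolding Prim_diff[OF i2 i1 tT] by (rule right_minus_eq[THEN iffD2])
    qed
    then have jv2: "AE t in Leb T. j (v2 t) = j u1 + Prim w2 t"
      using AE_space
    proof eventually_elim
      case (elim t)
      then have "t \<in> {0..T}" by simp
      from primitive_on_eq[OF pdy this] elim(1) show ?case unfolding y0 by simp
    qed
    have y_eq: "y t = u0 + Prim v2 t" if "t \<in> {0..T}" for t
      using primitive_on_eq[OF py that] unfolding y0 .
    have "AE t in Leb T. \<forall>x. rH (w2 t) (j x) + B1 t (v2 t) x + B2 t (v2 t) x + A1 t (u0 + Prim v2 t) x + A2 t (u0 + Prim v2 t) x = rH (f t) (j x)"
      using AEy AE_space
    proof eventually_elim
      case (elim t)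
      then have t: "t \<in> {0..T}" by simp
      show ?case using elim(1) unfolding eq_iff[OF t] y_eq[OF t] .
    qed
    then have "sol T v2 w2" unfolding sol_def using v2 w2 jv2 by blast
    then have vv: "AE t in Leb T. v2 t = v t" using sol_unique[OF T order_refl _ sol] by blast
    show ?thesis
    proof
      fix t assume t: "t \<in> {0..T}"
      then have tT: "t \<le> T" by simp
      have "Prim v2 t = Prim v t"
        by (rule integral_cong_AE[OF borel_measurable_Leb_mono[OF L2_measurable[OF v2] tT]
              borel_measurable_Leb_mono[OF L2_measurable[OF v] tT] AE_Leb_mono[OF vv tT]])
      then show "y t = u t" unfolding y_eq[OF t] u_def by (rule arg_cong)
    qed
  qed
  have range: "\<forall>t\<in>{0..T}. du t \<in> range j"
  proof
    fix t assume t: "t \<in> {0..T}"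
    \<comment> \<open>At t = 0 the velocity is the initial value; \<open>sol_ex\<close> provides
      solutions on intervals of positive length only.\<close>
    show "du t \<in> range j"
    proof (cases "t = 0")
      case True
      then show ?thesis unfolding du_def True integral_Leb_0 by simp
    next
      case False
      then have S: "0 < t" "t \<le> T" using t by auto
      \<comment> \<open>A fresh solution on [0,t] has an end value \<open>z\<close> in V. By
        uniqueness its acceleration has the same integral over (0,t) as \<open>w\<close>, so j z is
        the velocity of the given solution at time t.\<close>
      obtain v' w' z where s: "sol t v' w'" and z: "j z = j u1 + Prim w' t" using sol_ex[OF S] by blast
      have "Prim w t = Prim w' t" using sol_unique[OF S sol_mono[OF S(2) sol] s] by blast
      then have "du t = j z" unfolding du_def z by (rule arg_cong)
      then show ?thesis by (rule range_eqI)
    qed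
  qed
  show ?thesis using solves unique range by blast
qed

end
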